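(* Let $\alpha:\mathcal P(E)\to(-\infty,\infty]$ be measurable, bounded from below and not identically $+\infty$, and define $\alpha_n,\rho_n$ as in the context. For any bounded lower semicontinuous $F:\mathcal P(E)\to\mathbb R$, $$\liminf_{n\to\infty}\frac1n\rho_n(nF\circ L_n)\ge\sup_{\nu\in\mathcal P(E)}\big(F(\nu)-\alpha(\nu)\big).$$ If in addition $\alpha$ is convex and has compact sub-level sets, then for any bounded upper semicontinuous $F:\mathcal P(E)\to\mathbb R$, $$\limsup_{n\to\infty}\frac1n\rho_n(nF\circ L_n)\le\sup_{\nu\in\mathcal P(E)}\big(F(\nu)-\alpha(\nu)\big).$$
   Context: $(E,d)$ is a complete separable metric space; $\mathcal P(E)$ has the weak topology and its Borel $\sigma$-field; $B(E^n)$ is the set of bounded measurable real functions on $E^n$. For $x\in E^n$ and $1\le k\le n$, $x_{-k}=(x_i)_{i\ne k}\in E^{n-1}$ and $\pi_{-k}(x)=x_{-k}$. For $\nu\in\mathcal P(E^n)$, $\nu_{-k}:E^{n-1}\to\mathcal P(E)$ is the measurable map (unique $\nu$-a.s.) given by the disintegration $\nu(\mathrm dx_1,\dots,\mathrm dx_n)=\nu_{-k}(x_{-k})(\mathrm dx_k)\,\nu\circ\pi_{-k}^{-1}(\mathrm dx_{-k})$, i.e. the conditional law of the $k$-th coordinate given the others. Define $\alpha_n(\nu)=\int_{E^n}\sum_{k=1}^n\alpha(\nu_{-k}(x_{-k}))\,\nu(\mathrm dx)$ for $\nu\in\mathcal P(E^n)$, and $\rho_n(f)=\sup_{\nu\in\mathcal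 P(E^n)}\big(\int f\,\mathrm d\nu-\alpha_n(\nu)\big)$ for $f\in B(E^n)$. $L_n(x_1,\dots,x_n)=\frac1n\sum_{k=1}^n\delta_{x_k}$ is the empirical measure map. *)

theory Defs
  imports "HOL-Analysis.Analysis" "HOL-Probability.Probability"
begin

definition PE :: "'a::topological_space measure set" where
  "PE = space (prob_algebra (borel :: 'a measure))"

definition weak_top :: "'a::topological_space measure topology" where
  "weak_top = topology_generated_by
     {{\<mu> \<in> PE. (\<integral>x. f x \<partial>\<mu>) \<in> U} | (f :: 'a \<Rightarrow> real) U.
        continuous_on UNIV f \<and> bounded (range f) \<and> open U}"

definition weak_borel :: "'a::topological_space measure measure" where
  "weak_borel = sigma (topspace weak_top) {S. openin weak_top S}"

definition lsc_on :: "'b topology \<Rightarrow> ('b \<Rightarrow> real) \<Rightarrow> bool" where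
  "lsc_on X F \<longleftrightarrow> (\<forall>a. openin X {x \<in> topspace X. F x > a})"

definition usc_on :: "'b topology \<Rightarrow> ('b \<Rightarrow> real) \<Rightarrow> bool" where
  "usc_on X F \<longleftrightarrow> (\<forall>a. openin X {x \<in> topspace X. F x < a})"

definition mix :: "real \<Rightarrow> 'a::topological_space measure \<Rightarrow> 'a measure \<Rightarrow> 'a measure" where
  "mix t \<mu> \<nu> = measure_of (space borel) (sets borel)
     (\<lambda>A. ennreal t * emeasure \<mu> A + ennreal (1 - t) * emeasure \<nu> A)"

definition En :: "nat \<Rightarrow> (nat \<Rightarrow> 'a::topological_space) measure" where
  "En n = PiM {..<n} (\<lambda>_. borel)"

definition Enk :: "nat \<Rightarrow> nat \<Rightarrow> (nat \<Rightarrow> 'a::topological_space) measure" where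
  "Enk n k = PiM ({..<n} - {k}) (\<lambda>_. borel)"

definition proj_k :: "nat \<Rightarrow> nat \<Rightarrow> (nat \<Rightarrow> 'a) \<Rightarrow> (nat \<Rightarrow> 'a)" where
  "proj_k n k x = restrict x ({..<n} - {k})"

definition is_cond_kernel ::
  "nat \<Rightarrow> nat \<Rightarrow> (nat \<Rightarrow> 'a::topological_space) measure \<Rightarrow> ((nat \<Rightarrow> 'a) \<Rightarrow> 'a measure) \<Rightarrow> bool" where
  "is_cond_kernel n k \<nu> K \<longleftrightarrow>
     K \<in> measurable (Enk n k) (prob_algebra borel) \<and>
     (\<forall>A \<in> sets (En n). emeasure \<nu> A =
        (\<integral>\<^sup>+ y. emeasure (K y) {z. y(k := z) \<in> A} \<partial>(distr \<nu> (Enk n k) (proj_k n k))))"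

definition cond_kernel :: "nat \<Rightarrow> nat \<Rightarrow> (nat \<Rightarrow> 'a::topological_space) measure \<Rightarrow> (nat \<Rightarrow> 'a) \<Rightarrow> 'a measure" where
  "cond_kernel n k \<nu> = (SOME K. is_cond_kernel n k \<nu> K)"

text \<open>Integral of an extended-real function (bounded below): positive part minus negative part.\<close>
definition ereal_integral :: "'b measure \<Rightarrow> ('b \<Rightarrow> ereal) \<Rightarrow> ereal" where
  "ereal_integral M g = enn2ereal (\<integral>\<^sup>+ x. e2ennreal (g x) \<partial>M) - enn2ereal (\<integral>\<^sup>+ x. e2ennreal (- g x) \<partial>M)"

definition alpha_n :: "('a::topological_space measure \<Rightarrow> ereal) \<Rightarrow> nat \<Rightarrow> (nat \<Rightarrow> 'a) measure \<Rightarrow> ereal" where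
  "alpha_n \<alpha> n \<nu> = (\<Sum>k<n. ereal_integral \<nu> (\<lambda>x. \<alpha> (cond_kernel n k \<nu> (proj_k n k x))))"

definition rho_n :: "('a::topological_space measure \<Rightarrow> ereal) \<Rightarrow> nat \<Rightarrow> ((nat \<Rightarrow> 'a) \<Rightarrow> real) \<Rightarrow> ereal" where
  "rho_n \<alpha> n f = (SUP \<nu> \<in> space (prob_algebra (En n)). ereal (\<integral>x. f x \<partial>\<nu>) - alpha_n \<alpha> n \<nu>)"

definition emp :: "nat \<Rightarrow> (nat \<Rightarrow> 'a::topological_space) \<Rightarrow> 'a measure" where
  "emp n x = measure_of (space borel) (sets borel)
     (\<lambda>A. ennreal (real (card {k \<in> {..<n}. x k \<in> A}) / real n))"

end

theory Submission
  imports Defs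
begin

text \<open>Lower bound: test with the product measure \<open>\<mu>\<^sup>n\<close>, all of whose conditional kernels are a.s. \<open>\<mu>\<close>;
  a variance estimate shows that the empirical measure concentrates at \<open>\<mu>\<close>.

  Upper bound: compactness of the sub-level sets reduces \<open>F\<close> to finitely many bounded continuous
  observables \<open>g\<close>, in the form \<open>F \<nu> \<le> S + 2\<epsilon> + inf\<^sub>\<mu> (\<alpha> \<mu> + K |g \<mu> - g \<nu>|\<^sup>2)\<close>. The infimum is dominated
  by the value at \<open>\<nu>\<close> of an affine minorant of \<open>\<alpha>\<close> whose slope depends on \<open>g \<nu>\<close> in a Lipschitz way. For \<open>\<nu> = L\<^sub>n\<close> the
  slope hardly changes when the \<open>k\<close>-th coordinate is dropped from \<open>g \<nu>\<close>; integrating the \<open>k\<close>-th summand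
  against the conditional law of the \<open>k\<close>-th coordinate then gives at most \<open>\<alpha>\<close> of that law.\<close>

section \<open>Regular conditional distributions on Polish spaces\<close>

text \<open>Both bounds are proved for each fixed \<open>n\<close> with an error constant that does
  not depend on \<open>n\<close>, so the passage to the limit is immediate. In the upper bound the
  constant is the sum of \<open>n\<close> replacement errors of order \<open>1 / n\<close>; in the
  lower bound it is \<open>n\<close> times a variance of order \<open>1 / n\<close>. Kernels enter
  \<open>alpha_n\<close> through a \<open>SOME\<close>. The upper bound therefore needs their
  existence for every law on \<open>En n\<close>, and the lower bound needs almost sure uniqueness,
  to identify the chosen kernel of a product measure with its factor. The obstacle in the upper
  bound is that \<open>alpha_n\<close> sees one conditional law at a time, while the empirical
  measure couples all coordinates. Affine functions of finitely many observables split into a sum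
  over coordinates, but the right affine function depends on the whole sample, coordinate
  \<open>k\<close> included. Mere existence of a minorant for each sample, as separation would give,
  does not control what happens when coordinate \<open>k\<close> is removed; regular dependence on
  the sample does.\<close>

text \<open>With digits 0 and 1 every tail \<open>T m\<close> lies between 0 and 1/2, so it never
  carries into the integer part; in base 2 an all-ones tail would reach 1. Multiplying by
  \<open>3 ^ Suc j\<close> puts digit \<open>j\<close> in the units place, and the earlier digits
  contribute a multiple of 3, which \<open>mod 3\<close> removes.\<close>

lemma floor_ternary_digit:
  fixes b :: "nat \<Rightarrow> bool"
  shows "\<lfloor>3 ^ Suc j * (\<Sum>i. of_bool (b i) * (1 / 3 :: real) ^ Suc i)\<rfloor> mod 3 = of_bool (b j)"
proof -
  define T where "T m = (\<Sum>i. of_bool (b (i + m)) * (1 / 3 :: real) ^ Suc i)" for m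
  have g: "summable (\<lambda>i. (1 / 3 :: real) ^ Suc i)"
    using summable_geometric[of "1/3::real"] by (simp add: summable_mult)
  have sm: "summable (\<lambda>i. of_bool (b (i + m)) * (1 / 3 :: real) ^ Suc i)" for m
    by (rule summable_comparison_test[OF _ g]) (auto intro!: exI[of _ 0])
  have T0: "0 \<le> T m" for m
    unfolding T_def by (rule suminf_nonneg[OF sm]) auto
  have "(\<Sum>i. (1 / 3 :: real) ^ Suc i) = 1 / 2"
    using suminf_geometric[of "1/3::real"] suminf_mult[OF summable_geometric[of "1/3::real"], of "1/3"] by simp
  moreover have "T m \<le> (\<Sum>i. (1 / 3 :: real) ^ Suc i)" for m
    unfolding T_def by (intro suminf_le[OF _ sm g]) (auto simp: of_bool_def)
  ultimately have T1: "T m \<le> 1 / 2" for m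
    by metis
  have step: "3 * T m = of_bool (b m) + T (Suc m)" for m
  proof -
    have "T m = of_bool (b m) * (1/3) + (\<Sum>i. of_bool (b (Suc i + m)) * (1 / 3 :: real) ^ Suc (Suc i))"
      unfolding T_def using suminf_split_head[OF sm[of m]] by simp
    also have "(\<Sum>i. of_bool (b (Suc i + m)) * (1 / 3 :: real) ^ Suc (Suc i)) = (1/3) * T (Suc m)"
      unfolding T_def using suminf_mult[OF sm[of "Suc m"], of "1/3"] by (simp add: ac_simps)
    finally show ?thesis by simp
  qed
  have "\<exists>N::int. 3 ^ m * T 0 = of_int N + T m" for m
  proof (induction m)
    case (Suc m)
    then obtain N :: int where "3 ^ m * T 0 = of_int N + T m" by blast
    then have "3 ^ Suc m * T 0 = of_int (3 * N + of_bool (b m)) + T (Suc m)"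
      using step[of m] by (simp add: algebra_simps)
    then show ?case by blast
  qed (auto intro: exI[of _ 0])
  then obtain N :: int where "3 ^ j * T 0 = of_int N + T j" by blast
  then have *: "3 ^ Suc j * T 0 = of_int (3 * N + of_bool (b j)) + T (Suc j)"
    using step[of j] by (simp add: algebra_simps)
  have "\<lfloor>3 ^ Suc j * T 0\<rfloor> = 3 * N + of_bool (b j)"
    unfolding * using T0[of "Suc j"] T1[of "Suc j"] by (intro floor_unique) auto
  then show ?thesis
    by (simp add: T_def)
qed

text \<open>\<open>\<phi> x\<close> codes the bits \<open>dist x (s i) < 2\<^sup>-\<^sup>m\<close>, for a dense sequence \<open>s\<close>, as ternary digits 0 and 1;
  leaving out the digit 2 makes them recoverable from \<open>\<phi> x\<close>.\<close>

lemma polish_borel_retract_of_real: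
  obtains \<phi> :: "'a::polish_space \<Rightarrow> real" and \<psi> :: "real \<Rightarrow> 'a"
  where "\<phi> \<in> borel_measurable borel" "\<psi> \<in> borel_measurable borel" "\<And>x. \<psi> (\<phi> x) = x"
proof -
  obtain D :: "'a set" where D: "countable D" "\<And>X. open X \<Longrightarrow> X \<noteq> {} \<Longrightarrow> \<exists>d\<in>D. d \<in> X"
    using countable_dense_exists by metis
  then have ne: "D \<noteq> {}" by (metis UNIV_not_empty empty_iff open_UNIV)
  define s where "s = from_nat_into D"
  have s: "\<exists>i. dist x (s i) < (1/2)^m" for x :: 'a and m
  proof -
    have "x \<in> ball x ((1/2)^m)" by simp
    then obtain d where "d \<in> D" "d \<in> ball x ((1/2)^m)"
      using D(2)[OF open_ball, of x "(1/2)^m"] by blast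
    then show ?thesis
      unfolding s_def using from_nat_into_surj[OF D(1)] by (metis mem_ball)
  qed
  define b where "b x j = (case prod_decode j of (m, i) \<Rightarrow> dist x (s i) < (1/2)^m)" for x j
  define \<phi> where "\<phi> x = (\<Sum>j. of_bool (b x j) * (1 / 3 :: real) ^ Suc j)" for x
  define dg where "dg j r \<longleftrightarrow> \<lfloor>3 ^ Suc j * (r::real)\<rfloor> mod 3 = 1" for j r
  \<comment> \<open>\<open>u m r\<close> is the first dense point that the decoded bits place within
    \<open>(1/2)^m\<close> of the coded point. The index ranges over a countable set, which makes it
    measurable in \<open>r\<close>.\<close>
  define u where "u m r = s (LEAST i. dg (prod_encode (m, i)) r)" for m r
  \<comment> \<open>A real outside the range of \<open>\<phi>\<close> may decode to a divergent
    sequence. The constant \<open>s 0\<close> on that measurable set makes the limit exist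
    everywhere.\<close>
  define v where "v m r = (if Cauchy (\<lambda>m. u m r) then u m r else s 0)" for m r
  define \<psi> where "\<psi> r = lim (\<lambda>m. v m r)" for r
  have dg: "dg j (\<phi> x) = b x j" for j x
    unfolding dg_def \<phi>_def floor_ternary_digit by auto
  have [measurable]: "Measurable.pred borel (\<lambda>x. b x j)" for j
    unfolding b_def by (cases "prod_decode j") simp
  have [measurable]: "Measurable.pred borel (dg j)" for j
    unfolding dg_def by measurable
  have \<phi>: "\<phi> \<in> borel_measurable borel"
    unfolding \<phi>_def of_bool_def by measurable
  have [measurable]: "(\<lambda>r. LEAST i. dg (prod_encode (m, i)) r) \<in> measurable borel (count_space UNIV)" for m
    by measurable
  have u[measurable]: "u m \<in> borel_measurable borel" for m
    unfolding u_def by measurable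
  have v: "v m \<in> borel_measurable borel" for m
  proof -
    have "{r \<in> space borel. Cauchy (\<lambda>m. u m r)} \<in> sets borel" by measurable
    then show ?thesis unfolding v_def by (intro measurable_If) auto
  qed
  have "(\<lambda>m. v m r) \<longlonglongrightarrow> \<psi> r" for r
  proof -
    have "convergent (\<lambda>m. v m r)"
      by (cases "Cauchy (\<lambda>m. u m r)") (auto simp: v_def Cauchy_convergent_iff convergent_const)
    then show ?thesis unfolding \<psi>_def by (simp add: convergent_LIMSEQ_iff)
  qed
  then have \<psi>: "\<psi> \<in> borel_measurable borel"
    by (intro borel_measurable_LIMSEQ_metric[OF v]) auto
  have "\<psi> (\<phi> x) = x" for x
  proof -
    have d: "dist (u m (\<phi> x)) x < (1/2)^m" for m
    proof -
      have "\<exists>i. dg (prod_encode (m, i)) (\<phi> x)"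
        using s[of x m] by (simp add: dg b_def)
      from LeastI_ex[OF this] show ?thesis
        unfolding u_def by (simp add: dg b_def dist_commute)
    qed
    have "(\<lambda>m. dist (u m (\<phi> x)) x) \<longlonglongrightarrow> 0"
    proof (rule Lim_null_comparison[OF _ LIMSEQ_power_zero[of "1/2::real"]])
      show "\<forall>\<^sub>F m in sequentially. norm (dist (u m (\<phi> x)) x) \<le> (1/2)^m"
        using d by (intro always_eventually allI) (simp add: less_imp_le)
    qed simp
    then have "(\<lambda>m. u m (\<phi> x)) \<longlonglongrightarrow> x"
      by (simp only: tendsto_dist_iff[symmetric])
    moreover from this have "Cauchy (\<lambda>m. u m (\<phi> x))" by (rule LIMSEQ_imp_Cauchy)
    ultimately show ?thesis by (simp add: \<psi>_def v_def limI)
  qed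
  with \<phi> \<psi> show ?thesis using that by blast
qed

section \<open>Conditional distributions of real random variables\<close>

text \<open>The infimum runs over rationals strictly above \<open>x\<close>, so a rational
  witnessing \<open>F x < a\<close> gives the same bound on an interval to the right of
  \<open>x\<close>: right-continuity is automatic. A conditional distribution function can thus be
  built from countably many almost sure identities.\<close>

lemma cdf_from_rational_values:
  fixes H :: "rat \<Rightarrow> real"
  assumes mono: "\<And>p q. p \<le> q \<Longrightarrow> H p \<le> H q"
    and bnd: "\<And>q. 0 \<le> H q" "\<And>q. H q \<le> 1"
    and bot: "\<And>e. e > 0 \<Longrightarrow> \<exists>q. H q < e" and top: "\<And>e. e > 0 \<Longrightarrow> \<exists>q. H q > 1 - e"
  defines "F \<equiv> \<lambda>x::real. INF q\<in>{q. x < of_rat q}. H q"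
  shows "x \<le> y \<Longrightarrow> F x \<le> F y" "continuous (at_right x) F" "(F \<longlongrightarrow> 0) at_bot" "(F \<longlongrightarrow> 1) at_top"
proof -
  have ne: "{q. x < of_rat q} \<noteq> {}" for x :: real
    using of_rat_dense[of x "x + 1"] by auto
  have bb: "bdd_below (H ` A)" for A
    using bnd(1) by (auto intro!: bdd_belowI[of _ 0])
  have le: "F x \<le> H q" if "x < of_rat q" for x q
    unfolding F_def using that by (intro cINF_lower[OF bb]) auto
  have ge: "c \<le> F x" if "\<And>q. x < of_rat q \<Longrightarrow> c \<le> H q" for x c
    unfolding F_def using that ne[of x] by (intro cINF_greatest) auto
  have less: "\<exists>q. x < of_rat q \<and> H q < c" if "F x < c" for x c
    using that cINF_less_iff[OF ne[of x] bb] unfolding F_def by auto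
  show mF: "F x \<le> F y" if "x \<le> y" for x y
    using that by (intro ge le) auto
  have F0: "0 \<le> F x" for x by (intro ge bnd)
  have F1: "F x \<le> 1" for x
    using ne[of x] le[of x] bnd(2) by (auto intro: order_trans)
  have "(F \<longlongrightarrow> F x) (at_right x)"
  proof (rule order_tendstoI)
    fix a assume "a < F x"
    then show "\<forall>\<^sub>F z in at_right x. a < F z"
      by (auto simp: eventually_at_right_field intro!: exI[of _ "x + 1"] less_le_trans[OF _ mF[of x]])
  next
    fix a assume "F x < a"
    then obtain q where "x < of_rat q" "H q < a" using less by blast
    then show "\<forall>\<^sub>F z in at_right x. F z < a"
      by (auto simp: eventually_at_right_field intro!: exI[of _ "of_rat q"] le_less_trans[OF le[of _ q]])
  qed
  then show "continuous (at_right x) F" by (simp add: continuous_within)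
  show "(F \<longlongrightarrow> 0) at_bot"
  proof (rule order_tendstoI)
    fix a :: real assume "0 < a"
    then obtain q where "H q < a" using bot by blast
    then show "\<forall>\<^sub>F z in at_bot. F z < a"
      using eventually_gt_at_bot[of "of_rat q"]
      by (intro eventually_mono[OF eventually_at_bot_dense[THEN iffD2, of "\<lambda>z. z < of_rat q"]])
         (auto intro: le_less_trans[OF le[of _ q]])
  qed (use F0 in \<open>auto intro!: always_eventually intro: less_le_trans[of _ 0]\<close>)
  show "(F \<longlongrightarrow> 1) at_top"
  proof (rule order_tendstoI)
    fix a :: real assume "a < 1"
    then obtain q where "H q > 1 - (1 - a)" using top[of "1 - a"] by auto
    moreover have "H q \<le> F z" if "of_rat q \<le> z" for z
    proof (intro ge mono)
      fix p :: rat assume "z < of_rat p"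
      with that have "(of_rat q :: real) \<le> of_rat p" by linarith
      then show "q \<le> p" by (simp only: of_rat_less_eq)
    qed
    ultimately have "a < F z" if "of_rat q \<le> z" for z
      using that by fastforce
    then show "\<forall>\<^sub>F z in at_top. a < F z"
      by (auto simp: eventually_at_top_linorder)
  qed (use F1 in \<open>auto intro!: always_eventually intro: le_less_trans[of _ 1]\<close>)
qed

text \<open>\<open>g\<close> is the Radon-Nikodym derivative, with respect to the law of
  \<open>Y\<close>, of the law of \<open>Y\<close> restricted to the event \<open>B\<close>.\<close>

lemma (in prob_space) conditional_probability_of_set:
  assumes Y[measurable]: "Y \<in> measurable M N" and B[measurable]: "B \<in> sets M"
  obtains g :: "'b \<Rightarrow> real" where "g \<in> borel_measurable N" "\<And>y. 0 \<le> g y" "\<And>y. g y \<le> 1"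
    "\<And>C. C \<in> sets N \<Longrightarrow> emeasure M (Y -` C \<inter> B) = (\<integral>\<^sup>+y. ennreal (g y) * indicator C y \<partial>distr M N Y)"
proof -
  let ?\<eta> = "distr M N Y"
  interpret \<eta>: prob_space ?\<eta> by (rule prob_space_distr) simp
  have RN: "\<exists>f. f \<in> borel_measurable N \<and>
      (\<forall>C\<in>sets N. emeasure M (Y -` C \<inter> A) = (\<integral>\<^sup>+y. f y * indicator C y \<partial>?\<eta>))"
    if A[measurable]: "A \<in> sets M" for A
  proof -
    define \<mu> where "\<mu> = distr (density M (indicator A)) N Y"
    have s: "sets \<mu> = sets ?\<eta>" by (simp add: \<mu>_def)
    have eq: "emeasure \<mu> C = emeasure M (Y -` C \<inter> A)" if C[measurable]: "C \<in> sets N" for C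
    proof -
      have "emeasure \<mu> C = (\<integral>\<^sup>+x. indicator A x * indicator (Y -` C \<inter> space M) x \<partial>M)"
        unfolding \<mu>_def by (subst emeasure_distr) (auto simp: emeasure_density)
      also have "\<dots> = (\<integral>\<^sup>+x. indicator (Y -` C \<inter> space M \<inter> A) x \<partial>M)"
        by (intro nn_integral_cong) (auto split: split_indicator)
      also have "\<dots> = emeasure M (Y -` C \<inter> space M \<inter> A)" by simp
      also have "Y -` C \<inter> space M \<inter> A = Y -` C \<inter> A" using sets.sets_into_space[OF A] by auto
      finally show ?thesis .
    qed
    have ac: "absolutely_continuous ?\<eta> \<mu>"
      unfolding absolutely_continuous_def
    proof safe
      fix C assume C: "C \<in> null_sets ?\<eta>"
      then have [measurable]: "C \<in> sets N" by auto
      have "emeasure M (Y -` C \<inter> A) \<le> emeasure M (Y -` C \<inter> space M)"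
        using sets.sets_into_space[OF A] by (intro emeasure_mono) auto
      also have "\<dots> = 0" using C by (auto simp: null_sets_def emeasure_distr)
      finally show "C \<in> null_sets \<mu>" using eq by (auto simp: null_sets_def s)
    qed
    have d: "density ?\<eta> (RN_deriv ?\<eta> \<mu>) = \<mu>" by (rule \<eta>.density_RN_deriv[OF ac s])
    have "emeasure M (Y -` C \<inter> A) = (\<integral>\<^sup>+y. RN_deriv ?\<eta> \<mu> y * indicator C y \<partial>?\<eta>)" if "C \<in> sets N" for C
      using eq[OF that] emeasure_density[of "RN_deriv ?\<eta> \<mu>" ?\<eta> C] that unfolding d by simp
    moreover have "RN_deriv ?\<eta> \<mu> \<in> borel_measurable N"
      using borel_measurable_RN_deriv[of ?\<eta> \<mu>] by simp
    ultimately show ?thesis by blast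
  qed
  obtain f where f[measurable]: "f \<in> borel_measurable N"
    and fC: "\<And>C. C \<in> sets N \<Longrightarrow> emeasure M (Y -` C \<inter> B) = (\<integral>\<^sup>+y. f y * indicator C y \<partial>?\<eta>)"
    using RN[OF B] by blast
  obtain f' where f'[measurable]: "f' \<in> borel_measurable N"
    and fC': "\<And>C. C \<in> sets N \<Longrightarrow> emeasure M (Y -` C \<inter> (space M - B)) = (\<integral>\<^sup>+y. f' y * indicator C y \<partial>?\<eta>)"
    using RN[of "space M - B"] by auto
  \<comment> \<open>The densities for \<open>B\<close> and for its complement add up to 1 almost
    everywhere. Hence truncating \<open>f\<close> at 1, which makes the bounds hold at every point,
    changes it only on a null set.\<close>
  have "AE y in ?\<eta>. f y + f' y = 1"
  proof (rule \<eta>.density_unique2)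
    fix C assume "C \<in> sets ?\<eta>"
    then have C[measurable]: "C \<in> sets N" by simp
    have "(\<integral>\<^sup>+y. (f y + f' y) * indicator C y \<partial>?\<eta>) = emeasure M (Y -` C \<inter> B) + emeasure M (Y -` C \<inter> (space M - B))"
      by (simp add: fC fC' nn_integral_add distrib_right)
    also have "\<dots> = emeasure M ((Y -` C \<inter> space M \<inter> B) \<union> (Y -` C \<inter> space M \<inter> (space M - B)))"
      using sets.sets_into_space[OF B]
      by (subst plus_emeasure[symmetric]) (auto intro!: arg_cong2[where f="(+)"] arg_cong[where f="emeasure M"])
    also have "(Y -` C \<inter> space M \<inter> B) \<union> (Y -` C \<inter> space M \<inter> (space M - B)) = Y -` C \<inter> space M" by auto
    also have "emeasure M (Y -` C \<inter> space M) = (\<integral>\<^sup>+y. 1 * indicator C y \<partial>?\<eta>)" by (simp add: emeasure_distr)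
    finally show "(\<integral>\<^sup>+y. (f y + f' y) * indicator C y \<partial>?\<eta>) = (\<integral>\<^sup>+y. 1 * indicator C y \<partial>?\<eta>)" .
  qed auto
  then have 1: "AE y in ?\<eta>. f y = ennreal (enn2real (min 1 (f y)))"
  proof eventually_elim
    case (elim y)
    then have "f y \<le> 1" by (metis le_iff_add)
    then show ?case by (simp add: min_absorb2 order_le_less_trans[OF _ ennreal_one_less_top])
  qed
  show ?thesis
  proof (rule that[of "\<lambda>y. enn2real (min 1 (f y))"])
    show "enn2real (min 1 (f y)) \<le> 1" for y
      using enn2real_mono[of "min 1 (f y)" 1] by simp
    fix C assume "C \<in> sets N"
    then show "emeasure M (Y -` C \<inter> B) = (\<integral>\<^sup>+y. ennreal (enn2real (min 1 (f y))) * indicator C y \<partial>?\<eta>)"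
      using 1 by (subst fC) (auto intro!: nn_integral_cong_AE)
  qed auto
qed

text \<open>Conditional probabilities of single sets are additive and continuous only up to null
  sets that depend on the sets. The kernel is built from half-lines with rational endpoints alone,
  so countably many null sets matter; the joint law is then recovered from products with
  half-lines.\<close>

lemma (in prob_space) regular_conditional_distribution_real:
  fixes X :: "'a \<Rightarrow> real"
  assumes Y[measurable]: "Y \<in> measurable M N" and X[measurable]: "X \<in> borel_measurable M"
  obtains K where "K \<in> measurable N (prob_algebra borel)"
    "\<And>A. A \<in> sets (N \<Otimes>\<^sub>M borel) \<Longrightarrow>
       emeasure M {\<omega>\<in>space M. (Y \<omega>, X \<omega>) \<in> A} = (\<integral>\<^sup>+y. emeasure (K y) {r. (y, r) \<in> A} \<partial>distr M N Y)"
proof -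
  let ?\<eta> = "distr M N Y"
  interpret \<eta>: prob_space ?\<eta> by (rule prob_space_distr) simp
  let ?B = "sets (borel :: real measure)"
  have "\<forall>B\<in>?B. \<exists>g :: 'b \<Rightarrow> real. g \<in> borel_measurable N \<and> (\<forall>y. 0 \<le> g y \<and> g y \<le> 1) \<and>
    (\<forall>C\<in>sets N. emeasure M (Y -` C \<inter> (X -` B \<inter> space M)) = (\<integral>\<^sup>+y. ennreal (g y) * indicator C y \<partial>?\<eta>))"
  proof
    fix B :: "real set" assume "B \<in> ?B"
    then have "X -` B \<inter> space M \<in> sets M" by measurable
    then obtain g where "g \<in> borel_measurable N" "\<And>y. 0 \<le> g y" "\<And>y. g y \<le> 1"
      "\<And>C. C \<in> sets N \<Longrightarrow> emeasure M (Y -` C \<inter> (X -` B \<inter> space M)) = (\<integral>\<^sup>+y. ennreal (g y) * indicator C y \<partial>?\<eta>)"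
      using conditional_probability_of_set[OF Y] by blast
    then show "\<exists>g :: 'b \<Rightarrow> real. g \<in> borel_measurable N \<and> (\<forall>y. 0 \<le> g y \<and> g y \<le> 1) \<and>
      (\<forall>C\<in>sets N. emeasure M (Y -` C \<inter> (X -` B \<inter> space M)) = (\<integral>\<^sup>+y. ennreal (g y) * indicator C y \<partial>?\<eta>))"
      by (intro exI[of _ g]) simp
  qed
  from bchoice[OF this]
  obtain g :: "real set \<Rightarrow> 'b \<Rightarrow> real" where g[measurable]: "\<And>B. B \<in> ?B \<Longrightarrow> g B \<in> borel_measurable N"
    and g01: "\<And>B y. B \<in> ?B \<Longrightarrow> 0 \<le> g B y" "\<And>B y. B \<in> ?B \<Longrightarrow> g B y \<le> 1"
    and gC: "\<And>B C. B \<in> ?B \<Longrightarrow> C \<in> sets N \<Longrightarrow>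
      emeasure M (Y -` C \<inter> (X -` B \<inter> space M)) = (\<integral>\<^sup>+y. ennreal (g B y) * indicator C y \<partial>?\<eta>)"
    by blast
  have g_add: "AE y in ?\<eta>. g (A \<union> B) y = g A y + g B y"
    if A[measurable]: "A \<in> ?B" and B[measurable]: "B \<in> ?B" and AB: "A \<inter> B = {}" for A B
  proof -
    have "AE y in ?\<eta>. ennreal (g (A \<union> B) y) = ennreal (g A y) + ennreal (g B y)"
    proof (rule \<eta>.density_unique2)
      fix C assume "C \<in> sets ?\<eta>"
      then have C[measurable]: "C \<in> sets N" by simp
      have "(\<integral>\<^sup>+y. (ennreal (g A y) + ennreal (g B y)) * indicator C y \<partial>?\<eta>)
        = emeasure M (Y -` C \<inter> (X -` A \<inter> space M)) + emeasure M (Y -` C \<inter> (X -` B \<inter> space M))"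
        by (simp add: gC nn_integral_add distrib_right)
      also have "\<dots> = emeasure M ((Y -` C \<inter> space M \<inter> (X -` A \<inter> space M)) \<union> (Y -` C \<inter> space M \<inter> (X -` B \<inter> space M)))"
        using AB
        by (subst plus_emeasure[symmetric]) (auto intro!: arg_cong2[where f="(+)"] arg_cong[where f="emeasure M"])
      also have "(Y -` C \<inter> space M \<inter> (X -` A \<inter> space M)) \<union> (Y -` C \<inter> space M \<inter> (X -` B \<inter> space M))
         = Y -` C \<inter> (X -` (A \<union> B) \<inter> space M)" by auto
      finally show "(\<integral>\<^sup>+y. ennreal (g (A \<union> B) y) * indicator C y \<partial>?\<eta>)
         = (\<integral>\<^sup>+y. (ennreal (g A y) + ennreal (g B y)) * indicator C y \<partial>?\<eta>)"
        using gC[of "A \<union> B" C] by simp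
    qed auto
    then show ?thesis
    proof eventually_elim
      case (elim y)
      then show ?case
        using g01[of A y] g01[of B y] g01[of "A \<union> B" y] A B
        by (simp add: ennreal_plus[symmetric] sets.Un del: ennreal_plus)
    qed
  qed
  have g_mono: "AE y in ?\<eta>. g A y \<le> g B y" if A: "A \<in> ?B" and B: "B \<in> ?B" and "A \<subseteq> B" for A B
  proof -
    have "AE y in ?\<eta>. g (A \<union> (B - A)) y = g A y + g (B - A) y"
      using A B by (intro g_add) auto
    then show ?thesis
    proof eventually_elim
      case (elim y)
      then show ?case using g01(1)[of "B - A" y] A B that(3) by (simp add: Un_absorb1)
    qed
  qed
  have g_UNIV: "AE y in ?\<eta>. g UNIV y = 1"
  proof -
    have "AE y in ?\<eta>. ennreal (g UNIV y) = 1"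
    proof (rule \<eta>.density_unique2)
      fix C assume "C \<in> sets ?\<eta>"
      then have C[measurable]: "C \<in> sets N" by simp
      then show "(\<integral>\<^sup>+y. ennreal (g UNIV y) * indicator C y \<partial>?\<eta>) = (\<integral>\<^sup>+y. 1 * indicator C y \<partial>?\<eta>)"
        by (simp add: gC[symmetric] emeasure_distr)
    qed auto
    then show ?thesis by simp
  qed
  \<comment> \<open>The integral of the infimum is at most the probability of
    \<open>X \<in> B n\<close> for every \<open>n\<close>, which tends to 0, and a nonnegative
    function with zero integral vanishes almost everywhere.\<close>
  have g_decseq: "AE y in ?\<eta>. \<forall>e>0. \<exists>n. g (B n) y < e"
    if B: "\<And>n. B n \<in> ?B" and dec: "decseq B" and empty: "(\<Inter>n. B n) = {}" for B :: "nat \<Rightarrow> real set"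
  proof -
    let ?i = "\<lambda>y. INF n. ennreal (g (B n) y)"
    have [measurable]: "B n \<in> ?B" for n by (rule B)
    have le: "(\<integral>\<^sup>+y. ?i y \<partial>?\<eta>) \<le> emeasure M (X -` B n \<inter> space M)" for n
    proof -
      have "(\<integral>\<^sup>+y. ?i y \<partial>?\<eta>) \<le> (\<integral>\<^sup>+y. ennreal (g (B n) y) * indicator (space N) y \<partial>?\<eta>)"
        by (intro nn_integral_mono) (auto intro!: INF_lower2)
      also have "\<dots> = emeasure M (Y -` space N \<inter> (X -` B n \<inter> space M))"
        by (intro gC[symmetric]) auto
      also have "\<dots> \<le> emeasure M (X -` B n \<inter> space M)" by (intro emeasure_mono) auto
      finally show ?thesis .
    qed
    have "(\<integral>\<^sup>+y. ?i y \<partial>?\<eta>) \<le> (INF n. emeasure M (X -` B n \<inter> space M))"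
      by (intro INF_greatest le)
    also have "\<dots> = emeasure M (\<Inter>n. X -` B n \<inter> space M)"
      using dec by (intro INF_emeasure_decseq) (auto simp: decseq_def)
    also have "(\<Inter>n. X -` B n \<inter> space M) = {}" using empty by auto
    finally have "(\<integral>\<^sup>+y. ?i y \<partial>?\<eta>) = 0" by simp
    then have "AE y in ?\<eta>. ?i y = 0"
      by (subst (asm) nn_integral_0_iff_AE) auto
    then show ?thesis
    proof eventually_elim
      case (elim y)
      show ?case
      proof safe
        fix e :: real assume "e > 0"
        then have "?i y < ennreal e" using elim by simp
        then obtain n where "ennreal (g (B n) y) < ennreal e" by (auto simp: INF_less_iff)
        then show "\<exists>n. g (B n) y < e" using \<open>e > 0\<close> by (auto simp: ennreal_less_iff g01)
      qed
    qed
  qed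
  define H where "H y q = g {..real_of_rat q} y" for y q
  have H[measurable]: "(\<lambda>y. H y q) \<in> borel_measurable N" for q unfolding H_def by simp
  \<comment> \<open>Countably many conditions, hence a measurable set; the thresholds
    \<open>1 / real (Suc n)\<close> stand for arbitrary positive reals.\<close>
  define good where "good y \<longleftrightarrow> (\<forall>p q. p \<le> q \<longrightarrow> H y p \<le> H y q) \<and>
    (\<forall>n::nat. \<exists>q. H y q < 1 / real (Suc n)) \<and> (\<forall>n::nat. \<exists>q. H y q > 1 - 1 / real (Suc n))" for y
  have [measurable]: "Measurable.pred N good" unfolding good_def by measurable
  \<comment> \<open>Off the good set the distribution function of the point mass at 0 is used, so
    that \<open>K y\<close> is a probability measure for every \<open>y\<close>.\<close>
  define F where "F y x = (if good y then (INF q\<in>{q. x < real_of_rat q}. H y q) else if 0 \<le> x then 1 else 0)" for y x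
  have F: "(\<forall>x x'. x \<le> x' \<longrightarrow> F y x \<le> F y x') \<and> (\<forall>x. continuous (at_right x) (F y)) \<and> (F y \<longlongrightarrow> 0) at_bot \<and> (F y \<longlongrightarrow> 1) at_top" for y
  proof (cases "good y")
    case True
    have inv: "\<exists>n. 1 / real (Suc n) < e" if "e > 0" for e
      using that by (rule nat_approx_posE) auto
    have 1: "p \<le> q \<Longrightarrow> H y p \<le> H y q" "0 \<le> H y q" "H y q \<le> 1" for p q
      using True by (auto simp: good_def H_def g01)
    have 2: "\<exists>q. H y q < e" if "e > 0" for e
      using True inv[OF that] unfolding good_def by (meson less_trans)
    have 3: "\<exists>q. 1 - e < H y q" if "e > 0" for e
      using True inv[OF that] unfolding good_def by (smt (verit))
    have "F y = (\<lambda>x. INF q\<in>{q. x < real_of_rat q}. H y q)" using True by (simp add: F_def fun_eq_iff)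
    with cdf_from_rational_values[of "H y", OF 1 2 3] show ?thesis by presburger
  next
    case False
    \<comment> \<open>The fallback is itself an infimum over rationals, of the values
      \<open>of_bool (0 < q)\<close>, so the same lemma covers it.\<close>
    have "F y = (\<lambda>x. INF q\<in>{q. x < real_of_rat q}. of_bool (0 < q))"
    proof
      fix x
      show "F y x = (INF q\<in>{q. x < real_of_rat q}. of_bool (0 < q))"
      proof (cases "0 \<le> x")
        case True
        have "real_of_rat q > 0" if "x < real_of_rat q" for q using that True by linarith
        then have "(\<lambda>q. of_bool (0 < q) :: real) ` {q. x < real_of_rat q} = {1}"
          using of_rat_dense[of x "x + 1"] by (auto simp: image_iff)
        then show ?thesis using False True by (simp add: F_def)
      next
        case x: False
        then obtain q where "x < real_of_rat q" "real_of_rat q < 0" using of_rat_dense[of x 0] by auto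
        then have "(INF q\<in>{q. x < real_of_rat q}. of_bool (0 < q)) \<le> (0::real)"
          by (intro cINF_lower2[where x=q]) (auto intro!: bdd_belowI[of _ 0])
        moreover have "0 \<le> (INF q\<in>{q. x < real_of_rat q}. of_bool (0 < q) :: real)"
          using \<open>x < real_of_rat q\<close> by (intro cINF_greatest) auto
        ultimately show ?thesis using False x by (simp add: F_def)
      qed
    qed
    moreover have "\<exists>q::rat. of_bool (0 < q) < e" if "e > 0" for e :: real
      by (rule exI[of _ 0]) (simp add: that)
    moreover have "\<exists>q::rat. 1 - e < of_bool (0 < q)" if "e > 0" for e :: real
      by (rule exI[of _ 1]) (simp add: that)
    ultimately show ?thesis
      using cdf_from_rational_values[of "\<lambda>q. of_bool (0 < q)"] by (simp add: of_bool_def)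
  qed
  have F_meas[measurable]: "(\<lambda>y. F y x) \<in> borel_measurable N" for x
    unfolding F_def by measurable
  define K where "K y = interval_measure (F y)" for y
  have em: "emeasure (K y) {..x} = ennreal (F y x)" for x y
    unfolding K_def by (rule emeasure_interval_measure_Iic) (use F[of y] in auto)
  have K_prob: "prob_space (K y)" for y
    unfolding K_def using real_distribution_interval_measure[of "F y"] F[of y]
    by (auto simp: real_distribution_def)
  have sK: "sets (K y) = ?B" "space (K y) = UNIV" for y by (auto simp: K_def)
  have Iic: "sets borel = sigma_sets UNIV (range (\<lambda>a::real. {..a}))"
    by (subst borel_eq_atMost) simp
  have K: "K \<in> measurable N (prob_algebra borel)"
  proof (intro measurable_prob_algebraI K_prob measurable_subprob_algebra_generated[OF Iic])
    show "Int_stable (range (\<lambda>a::real. {..a}))" by (auto simp: Int_stable_def)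
    fix A :: "real set" assume "A \<in> range (\<lambda>a. {..a})"
    then show "(\<lambda>y. emeasure (K y) A) \<in> borel_measurable N" by (auto simp: em)
  next
    show "(\<lambda>y. emeasure (K y) UNIV) \<in> borel_measurable N"
      using prob_space.emeasure_space_1[OF K_prob] by (simp add: sK)
  qed (auto simp: sK K_prob prob_space_imp_subprob_space)
  note K' = measurable_prob_algebraD[OF K]
  \<comment> \<open>The null set may depend on \<open>x\<close>, because the identity is only
    integrated for one \<open>x\<close> at a time. Monotonicity along the rationals gives one
    inequality; the other holds because \<open>g {x<..x + 1 / real (Suc n)} y\<close> becomes
    arbitrarily small.\<close>
  have Fg: "AE y in ?\<eta>. F y x = g {..x} y" for x
  proof -
    have 1: "AE y in ?\<eta>. \<forall>p q. p \<le> q \<longrightarrow> H y p \<le> H y q"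
      unfolding AE_all_countable H_def by (auto intro!: g_mono simp: of_rat_less_eq)
    \<comment> \<open>\<open>2\<close> excludes that mass escapes to minus infinity;
      \<open>3\<close> and \<open>4\<close> exclude it at plus infinity.\<close>
    have 2: "AE y in ?\<eta>. \<forall>e>0. \<exists>n. g {..- real n} y < e"
    proof (rule g_decseq)
      show "(\<Inter>n. {..- real n}) = {}"
      proof safe
        fix z :: real assume z: "z \<in> (\<Inter>n. {..- real n})"
        obtain n where "- z < real n" using reals_Archimedean2 by blast
        then show "z \<in> {}" using z by (auto dest!: spec[of _ n])
      qed
    qed (auto simp: decseq_def)
    have 3: "AE y in ?\<eta>. \<forall>e>0. \<exists>n. g {real n<..} y < e"
    proof (rule g_decseq)
      show "(\<Inter>n. {real n<..}) = {}"
      proof safe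
        fix z :: real assume z: "z \<in> (\<Inter>n. {real n<..})"
        obtain n where "z < real n" using reals_Archimedean2 by blast
        then show "z \<in> {}" using z by (auto dest!: spec[of _ n])
      qed
    qed (auto simp: decseq_def)
    have 4: "AE y in ?\<eta>. \<forall>n. g {..real n} y + g {real n<..} y = 1"
      unfolding AE_all_countable
    proof
      fix n
      have "{..real n} \<union> {real n<..} = UNIV" "{..real n} \<inter> {real n<..} = {}" by auto
      with g_add[of "{..real n}" "{real n<..}"] g_UNIV show "AE y in ?\<eta>. g {..real n} y + g {real n<..} y = 1"
        by auto
    qed
    have 5: "AE y in ?\<eta>. \<forall>e>0. \<exists>n. g {x<..x + 1 / real (Suc n)} y < e"
    proof (rule g_decseq)
      show "decseq (\<lambda>n. {x<..x + 1 / real (Suc n)})"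
        unfolding decseq_def
      proof (intro allI impI)
        fix m n :: nat assume "m \<le> n"
        then have "1 / real (Suc n) \<le> 1 / real (Suc m)" by (intro frac_le) auto
        then show "{x<..x + 1 / real (Suc n)} \<subseteq> {x<..x + 1 / real (Suc m)}" by auto
      qed
      show "(\<Inter>n. {x<..x + 1 / real (Suc n)}) = {}"
      proof safe
        fix z assume z: "z \<in> (\<Inter>n. {x<..x + 1 / real (Suc n)})"
        then have "z - x > 0" by auto
        then obtain n where "1 / real (Suc n) < z - x" by (rule nat_approx_posE) blast
        then show "z \<in> {}" using z by (auto dest!: spec[of _ n])
      qed
    qed auto
    have 6: "AE y in ?\<eta>. \<forall>n. g {..x + 1 / real (Suc n)} y = g {..x} y + g {x<..x + 1 / real (Suc n)} y"
      unfolding AE_all_countable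
    proof
      fix n
      have "0 \<le> 1 / real (Suc n)" by simp
      then have "{..x} \<union> {x<..x + 1 / real (Suc n)} = {..x + 1 / real (Suc n)}" "{..x} \<inter> {x<..x + 1 / real (Suc n)} = {}"
        by (auto intro: order_trans)
      with g_add[of "{..x}" "{x<..x + 1 / real (Suc n)}"]
      show "AE y in ?\<eta>. g {..x + 1 / real (Suc n)} y = g {..x} y + g {x<..x + 1 / real (Suc n)} y"
        by auto
    qed
    have 7: "AE y in ?\<eta>. \<forall>q n. real_of_rat q \<le> x + 1 / real (Suc n) \<longrightarrow> H y q \<le> g {..x + 1 / real (Suc n)} y"
      unfolding AE_all_countable H_def by (auto intro!: g_mono)
    have 8: "AE y in ?\<eta>. \<forall>q. x \<le> real_of_rat q \<longrightarrow> g {..x} y \<le> H y q"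
      unfolding AE_all_countable H_def by (auto intro!: g_mono)
    from 1 2 3 4 5 6 7 8 show ?thesis
    proof eventually_elim
      case (elim y)
      note e = elim
      have "\<exists>q. H y q < 1 / real (Suc n)" for n
      proof -
        obtain m where "g {..- real m} y < 1 / real (Suc n)" using e(2) by (meson of_nat_0_less_iff zero_less_Suc zero_less_divide_1_iff)
        then show ?thesis unfolding H_def by (intro exI[of _ "- of_nat m"]) (simp add: of_rat_minus)
      qed
      moreover have "\<exists>q. H y q > 1 - 1 / real (Suc n)" for n
      proof -
        obtain m where "g {real m<..} y < 1 / real (Suc n)" using e(3) by (meson of_nat_0_less_iff zero_less_Suc zero_less_divide_1_iff)
        then show ?thesis using e(4)[rule_format, of m] unfolding H_def by (intro exI[of _ "of_nat m"]) simp
      qed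
      ultimately have "good y" using e(1) by (auto simp: good_def)
      then have Fy: "F y x = (INF q\<in>{q. x < real_of_rat q}. H y q)" by (simp add: F_def)
      have "F y x \<ge> g {..x} y"
        unfolding Fy using of_rat_dense[of x "x+1"] e(8) by (intro cINF_greatest) auto
      moreover have "F y x \<le> g {..x} y + d" if d: "d > 0" for d
      proof -
        obtain n where n: "g {x<..x + 1 / real (Suc n)} y < d" using e(5)[rule_format, OF d] by blast
        obtain q where q: "x < real_of_rat q" "real_of_rat q < x + 1 / real (Suc n)"
          using of_rat_dense[of x "x + 1 / real (Suc n)"] by auto
        have "F y x \<le> H y q"
          unfolding Fy using q by (intro cINF_lower) (auto intro!: bdd_belowI[of _ 0] simp: H_def g01)
        also have "\<dots> \<le> g {..x} y + g {x<..x + 1 / real (Suc n)} y"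
          using e(7)[rule_format, of q n] e(6)[rule_format, of n] q by simp
        finally show ?thesis using n by simp
      qed
      then have "F y x \<le> g {..x} y" by (rule field_le_epsilon)
      ultimately show ?case by simp
    qed
  qed
  \<comment> \<open>\<open>P\<close> is the joint law of \<open>Y\<close> and \<open>X\<close>, and
    \<open>Q\<close> the law obtained by sampling \<open>y\<close> from \<open>?\<eta>\<close> and
    then from \<open>K y\<close>. They are compared on products of a set of \<open>N\<close> with a
    half-line, an intersection-stable generator.\<close>
  define P where "P = distr M (N \<Otimes>\<^sub>M borel) (\<lambda>\<omega>. (Y \<omega>, X \<omega>))"
  have pair: "(\<lambda>y. distr (K y) (N \<Otimes>\<^sub>M borel) (Pair y)) \<in> measurable N (subprob_algebra (N \<Otimes>\<^sub>M borel))"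
    by (rule measurable_distr2[OF _ K']) simp
  then have pair': "(\<lambda>y. distr (K y) (N \<Otimes>\<^sub>M borel) (Pair y)) \<in> measurable ?\<eta> (subprob_algebra (N \<Otimes>\<^sub>M borel))"
    by simp
  define Q where "Q = ?\<eta> \<bind> (\<lambda>y. distr (K y) (N \<Otimes>\<^sub>M borel) (Pair y))"
  have ne: "space ?\<eta> \<noteq> {}" by (rule \<eta>.not_empty)
  have Pair_m: "Pair y \<in> measurable (K y) (N \<Otimes>\<^sub>M borel)" if "y \<in> space N" for y
    using that by (simp add: K_def)
  have Q: "emeasure Q A = (\<integral>\<^sup>+y. emeasure (K y) {r. (y, r) \<in> A} \<partial>?\<eta>)" if A: "A \<in> sets (N \<Otimes>\<^sub>M borel)" for A
    unfolding Q_def using A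
    by (subst emeasure_bind[OF ne pair' A]) (auto intro!: nn_integral_cong simp: emeasure_distr Pair_m sK vimage_def)
  have "P = Q"
  proof (rule measure_eqI_generator_eq[where \<Omega>="space N \<times> UNIV" and E="{a \<times> b | a b. a \<in> sets N \<and> b \<in> range (\<lambda>x::real. {..x})}"
        and A="\<lambda>n. space N \<times> {..real n}"])
    have "sets (N \<Otimes>\<^sub>M (borel::real measure)) = sets (sigma (space N \<times> space (borel::real measure)) {a \<times> b | a b. a \<in> sets N \<and> b \<in> range (\<lambda>x::real. {..x})})"
    proof (rule sets_pair_eq[where Ca="{space N}" and Cb="range (\<lambda>n. {..real n})"])
      show "\<Union> (range (\<lambda>n. {..real n})) = space (borel::real measure)"
        by (auto intro: real_arch_simple)
    qed (auto simp: Iic sets.sigma_sets_eq sets.space_closed)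
    then have s: "sets (N \<Otimes>\<^sub>M (borel::real measure)) = sigma_sets (space N \<times> UNIV) {a \<times> b | a b. a \<in> sets N \<and> b \<in> range (\<lambda>x::real. {..x})}"
      by (subst (asm) sets_measure_of) (auto dest: sets.sets_into_space)
    show "sets P = sigma_sets (space N \<times> UNIV) {a \<times> b | a b. a \<in> sets N \<and> b \<in> range (\<lambda>x::real. {..x})}"
      by (simp add: P_def s)
    have "sets Q = sets (N \<Otimes>\<^sub>M borel)"
      unfolding Q_def using ne by (intro sets_bind) auto
    then show "sets Q = sigma_sets (space N \<times> UNIV) {a \<times> b | a b. a \<in> sets N \<and> b \<in> range (\<lambda>x::real. {..x})}"
      by (simp add: s)
    show "Int_stable {a \<times> b | a b. a \<in> sets N \<and> b \<in> range (\<lambda>x::real. {..x})}"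
      unfolding Int_stable_def
    proof safe
      fix a a' x x' assume "a \<in> sets N" "a' \<in> sets N"
      then show "\<exists>c d. a \<times> {..x} \<inter> a' \<times> {..x'} = c \<times> d \<and> c \<in> sets N \<and> d \<in> range (\<lambda>x::real. {..x})"
        by (intro exI[of _ "a \<inter> a'"] exI[of _ "{..min x x'}"]) auto
    qed
    show "{a \<times> b | a b. a \<in> sets N \<and> b \<in> range (\<lambda>x::real. {..x})} \<subseteq> Pow (space N \<times> UNIV)"
      by (auto dest: sets.sets_into_space)
    show "range (\<lambda>n. space N \<times> {..real n}) \<subseteq> {a \<times> b |a b. a \<in> sets N \<and> b \<in> range (\<lambda>x::real. {..x})}" by auto
    show "(\<Union>n. space N \<times> {..real n}) = space N \<times> UNIV" by (auto intro: real_arch_simple)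
    show "emeasure P (space N \<times> {..real n}) \<noteq> \<infinity>" for n
      unfolding P_def by (subst emeasure_distr) auto
    fix A assume "A \<in> {a \<times> b |a b. a \<in> sets N \<and> b \<in> range (\<lambda>x::real. {..x})}"
    then obtain C x where A: "A = C \<times> {..x}" and C[measurable]: "C \<in> sets N" by auto
    have "emeasure P A = emeasure M (Y -` C \<inter> (X -` {..x} \<inter> space M))"
      unfolding P_def A by (subst emeasure_distr) (auto intro!: arg_cong[where f="emeasure M"])
    also have "\<dots> = (\<integral>\<^sup>+y. ennreal (g {..x} y) * indicator C y \<partial>?\<eta>)"
      by (rule gC) auto
    also have "\<dots> = (\<integral>\<^sup>+y. emeasure (K y) {r. (y, r) \<in> A} \<partial>?\<eta>)"
      using Fg[of x] by (intro nn_integral_cong_AE) (auto elim!: eventually_mono simp: A em atMost_def[symmetric] split: split_indicator)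
    also have "\<dots> = emeasure Q A" unfolding A by (rule Q[symmetric]) auto
    finally show "emeasure P A = emeasure Q A" .
  qed
  show ?thesis
  proof (rule that[OF K])
    fix A assume A: "A \<in> sets (N \<Otimes>\<^sub>M (borel::real measure))"
    have "emeasure M {\<omega>\<in>space M. (Y \<omega>, X \<omega>) \<in> A} = emeasure P A"
      unfolding P_def using A by (subst emeasure_distr) (auto intro!: arg_cong[where f="emeasure M"])
    then show "emeasure M {\<omega>\<in>space M. (Y \<omega>, X \<omega>) \<in> A} = (\<integral>\<^sup>+y. emeasure (K y) {r. (y, r) \<in> A} \<partial>?\<eta>)"
      using Q[OF A] \<open>P = Q\<close> by simp
  qed
qed

section \<open>Kernels on Polish spaces and for one coordinate of a product\<close>

text \<open>The real variable \<open>\<phi> (X \<omega>)\<close> is disintegrated instead, with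
  \<open>\<phi>\<close> the coding of the space, and its kernel is pushed forward under the
  measurable left inverse \<open>\<psi>\<close>.\<close>

lemma (in prob_space) regular_conditional_distribution:
  fixes X :: "'a \<Rightarrow> 'c::polish_space"
  assumes Y[measurable]: "Y \<in> measurable M N" and X[measurable]: "X \<in> borel_measurable M"
  obtains K where "K \<in> measurable N (prob_algebra borel)"
    "\<And>A. A \<in> sets (N \<Otimes>\<^sub>M borel) \<Longrightarrow>
       emeasure M {\<omega>\<in>space M. (Y \<omega>, X \<omega>) \<in> A} = (\<integral>\<^sup>+y. emeasure (K y) {z. (y, z) \<in> A} \<partial>distr M N Y)"
proof -
  obtain \<phi> :: "'c \<Rightarrow> real" and \<psi> where [measurable]: "\<phi> \<in> borel_measurable borel"
    "\<psi> \<in> borel_measurable borel" and \<psi>\<phi>: "\<And>x. \<psi> (\<phi> x) = x"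
    using polish_borel_retract_of_real by blast
  have "(\<lambda>\<omega>. \<phi> (X \<omega>)) \<in> borel_measurable M" by measurable
  then obtain K where K: "K \<in> measurable N (prob_algebra borel)"
    and KA: "\<And>A. A \<in> sets (N \<Otimes>\<^sub>M borel) \<Longrightarrow>
       emeasure M {\<omega>\<in>space M. (Y \<omega>, \<phi> (X \<omega>)) \<in> A} = (\<integral>\<^sup>+y. emeasure (K y) {r. (y, r) \<in> A} \<partial>distr M N Y)"
    using regular_conditional_distribution_real[OF Y, of "\<lambda>\<omega>. \<phi> (X \<omega>)"] by blast
  show ?thesis
  proof (rule that[of "\<lambda>y. distr (K y) borel \<psi>"])
    show "(\<lambda>y. distr (K y) borel \<psi>) \<in> measurable N (prob_algebra borel)"
      by (rule measurable_compose[OF K measurable_distr_prob_space]) simp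
    fix A :: "('b \<times> 'c) set" assume A[measurable]: "A \<in> sets (N \<Otimes>\<^sub>M borel)"
    define A' where "A' = (\<lambda>(y, r). (y, \<psi> r)) -` A \<inter> space (N \<Otimes>\<^sub>M borel)"
    have A': "A' \<in> sets (N \<Otimes>\<^sub>M borel)" unfolding A'_def by measurable
    have "{\<omega>\<in>space M. (Y \<omega>, X \<omega>) \<in> A} = {\<omega>\<in>space M. (Y \<omega>, \<phi> (X \<omega>)) \<in> A'}"
      using measurable_space[OF Y] by (auto simp: A'_def \<psi>\<phi> space_pair_measure)
    then have "emeasure M {\<omega>\<in>space M. (Y \<omega>, X \<omega>) \<in> A} = (\<integral>\<^sup>+y. emeasure (K y) {r. (y, r) \<in> A'} \<partial>distr M N Y)"
      using KA[OF A'] by simp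
    also have "\<dots> = (\<integral>\<^sup>+y. emeasure (distr (K y) borel \<psi>) {z. (y, z) \<in> A} \<partial>distr M N Y)"
    proof (intro nn_integral_cong)
      fix y assume "y \<in> space (distr M N Y)"
      then have y: "y \<in> space N" by simp
      then have sK: "sets (K y) = sets borel" "space (K y) = UNIV"
        using measurable_space[OF K y] by (auto simp: space_prob_algebra dest: sets_eq_imp_space_eq)
      have "Pair y -` A \<in> sets borel" by (rule sets_Pair1[OF A])
      then have "{z. (y, z) \<in> A} \<in> sets borel" by (simp add: vimage_def)
      then show "emeasure (K y) {r. (y, r) \<in> A'} = emeasure (distr (K y) borel \<psi>) {z. (y, z) \<in> A}"
        using y by (subst emeasure_distr) (auto simp: sK A'_def space_pair_measure vimage_def
            cong: measurable_cong_sets intro!: arg_cong[where f="emeasure (K y)"])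
    qed
    finally show "emeasure M {\<omega>\<in>space M. (Y \<omega>, X \<omega>) \<in> A}
        = (\<integral>\<^sup>+y. emeasure (distr (K y) borel \<psi>) {z. (y, z) \<in> A} \<partial>distr M N Y)" .
  qed
qed

lemma measurable_proj_k[measurable]: "proj_k n k \<in> measurable (En n) (Enk n k)"
  unfolding proj_k_def En_def Enk_def by (rule measurable_restrict_subset) auto

lemma measurable_fun_upd_Enk:
  "k < n \<Longrightarrow> (\<lambda>(y, z). y(k := z)) \<in> measurable (Enk n k \<Otimes>\<^sub>M borel) (En n)"
  using measurable_add_dim[of k "{..<n} - {k}" "\<lambda>_. borel"]
  by (simp add: En_def Enk_def insert_absorb)

lemma proj_k_fun_upd: "y \<in> space (Enk n k) \<Longrightarrow> proj_k n k (y(k := z)) = y"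
  by (auto simp: proj_k_def Enk_def space_PiM PiE_def extensional_def fun_eq_iff)

lemma fun_upd_proj_k: "x \<in> space (En n) \<Longrightarrow> k < n \<Longrightarrow> (proj_k n k x)(k := x k) = x"
  by (auto simp: proj_k_def En_def space_PiM PiE_def extensional_def fun_eq_iff)

text \<open>This gives the \<open>SOME\<close> in \<open>cond_kernel\<close> its meaning.
  \<open>Y\<close> is the point without coordinate \<open>k\<close>, \<open>X\<close> is that
  coordinate, and a function update rebuilds the point from the pair.\<close>

lemma is_cond_kernel_cond_kernel:
  fixes \<nu> :: "(nat \<Rightarrow> 'a::polish_space) measure"
  assumes \<nu>: "\<nu> \<in> space (prob_algebra (En n))" and k: "k < n"
  shows "is_cond_kernel n k \<nu> (cond_kernel n k \<nu>)"
proof -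
  have sets: "sets \<nu> = sets (En n)" and p: "prob_space \<nu>" using \<nu> by (auto simp: space_prob_algebra)
  note [measurable_cong] = sets
  note space = sets_eq_imp_space_eq[OF sets]
  have Y: "proj_k n k \<in> measurable \<nu> (Enk n k)" by measurable
  have "(\<lambda>x. x k) \<in> borel_measurable (En n)"
    unfolding En_def by (rule measurable_component_singleton) (simp add: k)
  then have X: "(\<lambda>x. x k) \<in> borel_measurable \<nu>" by measurable
  obtain K where K: "K \<in> measurable (Enk n k) (prob_algebra borel)"
    and KA: "\<And>A. A \<in> sets (Enk n k \<Otimes>\<^sub>M borel) \<Longrightarrow>
       emeasure \<nu> {x\<in>space \<nu>. (proj_k n k x, x k) \<in> A} = (\<integral>\<^sup>+y. emeasure (K y) {z. (y, z) \<in> A} \<partial>distr \<nu> (Enk n k) (proj_k n k))"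
    using prob_space.regular_conditional_distribution[OF p Y X] by blast
  have "is_cond_kernel n k \<nu> K"
    unfolding is_cond_kernel_def
  proof (intro conjI K ballI)
    fix A :: "(nat \<Rightarrow> 'a) set" assume A: "A \<in> sets (En n)"
    let ?A = "(\<lambda>(y, z). y(k := z)) -` A \<inter> space (Enk n k \<Otimes>\<^sub>M borel)"
    have A': "?A \<in> sets (Enk n k \<Otimes>\<^sub>M borel)"
      by (rule measurable_sets[OF measurable_fun_upd_Enk[OF k] A])
    have "{x\<in>space \<nu>. (proj_k n k x, x k) \<in> ?A} = A"
    proof -
      have "(proj_k n k x, x k) \<in> ?A \<longleftrightarrow> x \<in> A" if "x \<in> space (En n)" for x
        using that measurable_space[OF Y, of x] by (simp add: space space_pair_measure fun_upd_proj_k k)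
      then show ?thesis
        using sets.sets_into_space[OF A] by (auto simp: space)
    qed
    with KA[OF A'] have "emeasure \<nu> A = (\<integral>\<^sup>+y. emeasure (K y) {z. (y, z) \<in> ?A} \<partial>distr \<nu> (Enk n k) (proj_k n k))"
      by simp
    also have "\<dots> = (\<integral>\<^sup>+y. emeasure (K y) {z. y(k := z) \<in> A} \<partial>distr \<nu> (Enk n k) (proj_k n k))"
      by (intro nn_integral_cong) (auto simp: space_pair_measure)
    finally show "emeasure \<nu> A = \<dots>" .
  qed
  then show ?thesis unfolding cond_kernel_def by (rule someI[of "is_cond_kernel n k \<nu>"])
qed

text \<open>The monadic form makes \<open>integral_bind\<close> available, which extends the
  disintegration from sets to bounded functions of either sign.\<close>

lemma is_cond_kernel_bind:
  assumes \<nu>: "\<nu> \<in> space (prob_algebra (En n))" and k: "k < n" and K: "is_cond_kernel n k \<nu> K"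
  shows "\<nu> = distr \<nu> (Enk n k) (proj_k n k) \<bind> (\<lambda>y. distr (K y) (En n) (\<lambda>z. y(k := z)))"
    and "(\<lambda>y. distr (K y) (En n) (\<lambda>z. y(k := z))) \<in> measurable (Enk n k) (subprob_algebra (En n))"
proof -
  let ?\<eta> = "distr \<nu> (Enk n k) (proj_k n k)"
  have sets: "sets \<nu> = sets (En n)" and p: "prob_space \<nu>" using \<nu> by (auto simp: space_prob_algebra)
  note [measurable_cong] = sets
  interpret \<eta>: prob_space ?\<eta> by (rule prob_space.prob_space_distr[OF p]) measurable
  have Km: "K \<in> measurable (Enk n k) (prob_algebra borel)" using K by (simp add: is_cond_kernel_def)
  show m: "(\<lambda>y. distr (K y) (En n) (\<lambda>z. y(k := z))) \<in> measurable (Enk n k) (subprob_algebra (En n))"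
    by (rule measurable_distr2[OF _ measurable_prob_algebraD[OF Km]]) (use measurable_fun_upd_Enk[OF k] in simp)
  then have m': "(\<lambda>y. distr (K y) (En n) (\<lambda>z. y(k := z))) \<in> measurable ?\<eta> (subprob_algebra (En n))"
    by simp
  show "\<nu> = ?\<eta> \<bind> (\<lambda>y. distr (K y) (En n) (\<lambda>z. y(k := z)))"
  proof (rule measure_eqI)
    show "sets \<nu> = sets (?\<eta> \<bind> (\<lambda>y. distr (K y) (En n) (\<lambda>z. y(k := z))))"
      unfolding sets by (rule sets_bind[symmetric]) (use \<eta>.not_empty in auto)
    fix A assume "A \<in> sets \<nu>"
    then have A: "A \<in> sets (En n)" by (simp add: sets)
    have "emeasure \<nu> A = (\<integral>\<^sup>+y. emeasure (K y) {z. y(k := z) \<in> A} \<partial>?\<eta>)"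
      using K A by (simp add: is_cond_kernel_def)
    also have "\<dots> = (\<integral>\<^sup>+y. emeasure (distr (K y) (En n) (\<lambda>z. y(k := z))) A \<partial>?\<eta>)"
    proof (intro nn_integral_cong)
      fix y assume "y \<in> space ?\<eta>"
      then have y: "y \<in> space (Enk n k)" by simp
      then have sK: "sets (K y) = sets borel" "space (K y) = UNIV"
        using measurable_space[OF Km y] by (auto simp: space_prob_algebra dest: sets_eq_imp_space_eq)
      have "(\<lambda>z. y(k := z)) \<in> measurable borel (En n)"
        using measurable_compose[OF measurable_Pair1'[OF y] measurable_fun_upd_Enk[OF k]] by simp
      then have "(\<lambda>z. y(k := z)) \<in> measurable (K y) (En n)"
        by (simp add: sK cong: measurable_cong_sets)
      then show "emeasure (K y) {z. y(k := z) \<in> A} = emeasure (distr (K y) (En n) (\<lambda>z. y(k := z))) A"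
        using A by (subst emeasure_distr) (auto simp: sK vimage_def)
    qed
    also have "\<dots> = emeasure (?\<eta> \<bind> (\<lambda>y. distr (K y) (En n) (\<lambda>z. y(k := z)))) A"
      by (rule emeasure_bind[symmetric, OF \<eta>.not_empty m' A])
    finally show "emeasure \<nu> A = \<dots>" .
  qed
qed

lemma is_cond_kernel_integral:
  fixes f :: "(nat \<Rightarrow> 'a::topological_space) \<Rightarrow> real"
  assumes \<nu>: "\<nu> \<in> space (prob_algebra (En n))" and k: "k < n" and K: "is_cond_kernel n k \<nu> K"
    and f: "f \<in> borel_measurable (En n)" and bnd: "\<And>x. x \<in> space (En n) \<Longrightarrow> \<bar>f x\<bar> \<le> c"
  shows "(\<integral>x. f x \<partial>\<nu>) = (\<integral>x. (\<integral>z. f ((proj_k n k x)(k := z)) \<partial>K (proj_k n k x)) \<partial>\<nu>)"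
    and "(\<lambda>x. \<integral>z. f ((proj_k n k x)(k := z)) \<partial>K (proj_k n k x)) \<in> borel_measurable \<nu>"
proof -
  let ?\<eta> = "distr \<nu> (Enk n k) (proj_k n k)"
  have sets: "sets \<nu> = sets (En n)" and p: "prob_space \<nu>" using \<nu> by (auto simp: space_prob_algebra)
  note [measurable_cong] = sets
  interpret \<eta>: prob_space ?\<eta> by (rule prob_space.prob_space_distr[OF p]) measurable
  have Km: "K \<in> measurable (Enk n k) (prob_algebra borel)" using K by (simp add: is_cond_kernel_def)
  note m = is_cond_kernel_bind(2)[OF \<nu> k K]
  have inner: "(\<integral>x. f x \<partial>distr (K y) (En n) (\<lambda>z. y(k := z))) = (\<integral>z. f (y(k := z)) \<partial>K y)"
    if y: "y \<in> space (Enk n k)" for y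
  proof (rule integral_distr[OF _ f])
    have sK: "sets (K y) = sets borel" "space (K y) = UNIV"
      using measurable_space[OF Km y] by (auto simp: space_prob_algebra dest: sets_eq_imp_space_eq)
    have "(\<lambda>z. y(k := z)) \<in> measurable borel (En n)"
      using measurable_compose[OF measurable_Pair1'[OF y] measurable_fun_upd_Enk[OF k]] by simp
    then show "(\<lambda>z. y(k := z)) \<in> measurable (K y) (En n)"
      by (simp add: sK cong: measurable_cong_sets)
  qed
  have "(\<lambda>y. \<integral>x. f x \<partial>distr (K y) (En n) (\<lambda>z. y(k := z))) \<in> borel_measurable (Enk n k)"
    by (rule measurable_compose[OF m integral_measurable_subprob_algebra[OF f]])
  then have im: "(\<lambda>y. \<integral>z. f (y(k := z)) \<partial>K y) \<in> borel_measurable (Enk n k)"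
    by (subst (asm) measurable_cong[OF inner])
  show "(\<lambda>x. \<integral>z. f ((proj_k n k x)(k := z)) \<partial>K (proj_k n k x)) \<in> borel_measurable \<nu>"
    by (rule measurable_compose[OF _ im]) measurable
  have "(\<integral>x. f x \<partial>\<nu>) = (\<integral>x. f x \<partial>(?\<eta> \<bind> (\<lambda>y. distr (K y) (En n) (\<lambda>z. y(k := z)))))"
    using is_cond_kernel_bind(1)[OF \<nu> k K] by simp
  also have "\<dots> = (\<integral>y. \<integral>x. f x \<partial>distr (K y) (En n) (\<lambda>z. y(k := z)) \<partial>?\<eta>)"
  proof (rule integral_bind[OF f bnd])
    show m': "(\<lambda>y. distr (K y) (En n) (\<lambda>z. y(k := z))) \<in> measurable ?\<eta> (subprob_algebra (En n))"
      using m by simp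
    show "finite_measure ?\<eta>" by unfold_locales
    show "AE y in ?\<eta>. emeasure (distr (K y) (En n) (\<lambda>z. y(k := z)))
        (space (distr (K y) (En n) (\<lambda>z. y(k := z)))) \<le> ennreal 1"
      using subprob_space.emeasure_space_le_1[OF subprob_space_kernel[OF m']] by (intro AE_I2) simp
  qed
  also have "\<dots> = (\<integral>y. (\<integral>z. f (y(k := z)) \<partial>K y) \<partial>?\<eta>)"
    by (intro Bochner_Integration.integral_cong) (auto simp: inner)
  also have "\<dots> = (\<integral>x. (\<integral>z. f ((proj_k n k x)(k := z)) \<partial>K (proj_k n k x)) \<partial>\<nu>)"
    by (rule integral_distr[OF _ im]) measurable
  finally show "(\<integral>x. f x \<partial>\<nu>) = \<dots>" .
qed

section \<open>The weak topology and empirical measures\<close>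

definition Cb :: "('a::topological_space \<Rightarrow> real) set" where
  "Cb = {f. continuous_on UNIV f \<and> bounded (range f)}"

lemma PE_iff: "\<mu> \<in> PE \<longleftrightarrow> sets \<mu> = sets borel \<and> prob_space \<mu>"
  by (simp add: PE_def space_prob_algebra)

lemma space_PE: "\<mu> \<in> PE \<Longrightarrow> space \<mu> = UNIV"
  by (auto simp: PE_iff dest: sets_eq_imp_space_eq)

lemma Cb_measurable: "f \<in> Cb \<Longrightarrow> f \<in> borel_measurable borel"
  by (auto simp: Cb_def intro: borel_measurable_continuous_onI)

lemma Cb_bounded:
  assumes "f \<in> Cb" obtains B where "0 < B" "\<And>x. \<bar>f x\<bar> \<le> B"
  using assms unfolding Cb_def bounded_pos by auto

lemma finite_Cb_bounded:
  assumes "finite J" "J \<subseteq> Cb" obtains B where "0 < B" "\<And>f x. f \<in> J \<Longrightarrow> \<bar>f x\<bar> \<le> B"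
proof -
  have "\<exists>B>0. \<forall>f\<in>J. \<forall>x. \<bar>f x\<bar> \<le> B"
    using assms
  proof (induction J)
    case (insert f J)
    then obtain B B' where "0 < B" "\<forall>f\<in>J. \<forall>x. \<bar>f x\<bar> \<le> B" "\<And>x. \<bar>f x\<bar> \<le> B'"
      using Cb_bounded[of f] by (metis insert_subset)
    then show ?case by (intro exI[of _ "max B B'"]) (auto simp: le_max_iff_disj)
  qed (auto intro: exI[of _ 1])
  then show ?thesis using that by blast
qed

lemma bounded_integrable_PE:
  fixes f :: "'a::topological_space \<Rightarrow> real"
  assumes "f \<in> borel_measurable borel" "\<And>x. \<bar>f x\<bar> \<le> B" "\<mu> \<in> PE"
  shows "integrable \<mu> f"
proof -
  interpret prob_space \<mu> using assms by (simp add: PE_iff)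
  show ?thesis
    using assms by (intro integrable_const_bound[of _ B]) (auto simp: PE_iff cong: measurable_cong_sets)
qed

lemma Cb_integrable: "f \<in> Cb \<Longrightarrow> \<mu> \<in> PE \<Longrightarrow> integrable \<mu> f"
  using Cb_bounded bounded_integrable_PE Cb_measurable by metis

lemma abs_integral_le_PE:
  fixes f :: "'a::topological_space \<Rightarrow> real"
  assumes f: "f \<in> borel_measurable borel" and B: "\<And>x. \<bar>f x\<bar> \<le> B" and \<mu>: "\<mu> \<in> PE"
  shows "\<bar>\<integral>x. f x \<partial>\<mu>\<bar> \<le> B"
proof -
  interpret prob_space \<mu> using \<mu> by (simp add: PE_iff)
  have "\<bar>\<integral>x. f x \<partial>\<mu>\<bar> \<le> (\<integral>x. \<bar>f x\<bar> \<partial>\<mu>)" by (rule integral_abs_bound)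
  also have "\<dots> \<le> B"
    using B bounded_integrable_PE[OF f B \<mu>] by (intro integral_le_const) auto
  finally show ?thesis .
qed

lemma topspace_weak_top [simp]: "topspace weak_top = PE"
proof -
  have "{\<mu> \<in> PE. (\<integral>x. (0::real) \<partial>\<mu>) \<in> UNIV} \<in> {{\<mu> \<in> PE. (\<integral>x. f x \<partial>\<mu>) \<in> U} | (f :: 'a \<Rightarrow> real) U.
        continuous_on UNIV f \<and> bounded (range f) \<and> open U}"
    by (intro CollectI exI[of _ "\<lambda>_. 0"] exI[of _ UNIV]) auto
  then show ?thesis
    unfolding weak_top_def by auto
qed

lemma openin_weak_top_integral:
  "f \<in> Cb \<Longrightarrow> open U \<Longrightarrow> openin weak_top {\<mu> \<in> PE. (\<integral>x. f x \<partial>\<mu>) \<in> U}"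
  unfolding weak_top_def Cb_def by (intro topology_generated_by_Basis) auto

lemma openin_weak_top_ball:
  assumes "finite J" "J \<subseteq> Cb"
  shows "openin weak_top {\<nu> \<in> PE. \<forall>f\<in>J. \<bar>(\<integral>x. f x \<partial>\<nu>) - c f\<bar> < \<delta>}"
  using assms
proof (induction J)
  case empty
  then show ?case using openin_topspace[of weak_top] by simp
next
  case (insert f J)
  have "openin weak_top {\<nu> \<in> PE. (\<integral>x. f x \<partial>\<nu>) \<in> ball (c f) \<delta>}"
    using insert by (intro openin_weak_top_integral) auto
  moreover have "{\<nu> \<in> PE. \<forall>f\<in>insert f J. \<bar>(\<integral>x. f x \<partial>\<nu>) - c f\<bar> < \<delta>} =
    {\<nu> \<in> PE. (\<integral>x. f x \<partial>\<nu>) \<in> ball (c f) \<delta>} \<inter> {\<nu> \<in> PE. \<forall>f\<in>J. \<bar>(\<integral>x. f x \<partial>\<nu>) - c f\<bar> < \<delta>}"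
    by (auto simp: dist_real_def abs_minus_commute)
  ultimately show ?case using insert by auto
qed

text \<open>Intersections merge the observables and take the smaller radius; unions keep the data of
  one member. This is how semicontinuity of \<open>F\<close> and of \<open>\<alpha>\<close> is
  reduced to finitely many observables.\<close>

lemma weak_top_nbhd_base:
  assumes U: "openin weak_top U" and \<mu>: "\<mu> \<in> U"
  obtains J \<delta> where "finite J" "J \<subseteq> Cb" "0 < \<delta>"
    "\<And>\<nu>. \<nu> \<in> PE \<Longrightarrow> (\<And>f. f \<in> J \<Longrightarrow> \<bar>(\<integral>x. f x \<partial>\<nu>) - (\<integral>x. f x \<partial>\<mu>)\<bar> < \<delta>) \<Longrightarrow> \<nu> \<in> U"
proof -
  let ?P = "\<lambda>U J \<delta>. finite J \<and> J \<subseteq> Cb \<and> 0 < \<delta> \<and>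
    (\<forall>\<nu>\<in>PE. (\<forall>f\<in>J. \<bar>(\<integral>x. f x \<partial>\<nu>) - (\<integral>x. f x \<partial>\<mu>)\<bar> < \<delta>) \<longrightarrow> \<nu> \<in> U)"
  have "\<exists>J \<delta>. ?P U J \<delta>"
    using openin_topology_generated_by[OF U[unfolded weak_top_def]] \<mu>
  proof (induction rule: generate_topology_on.induct)
    case (Int a b)
    then obtain J \<delta> J' \<delta>' where "?P a J \<delta>" "?P b J' \<delta>'" by blast
    then show ?case
      by (intro exI[of _ "J \<union> J'"] exI[of _ "min \<delta> \<delta>'"]) auto
  next
    case (UN K)
    then obtain k where k: "k \<in> K" "\<mu> \<in> k" by blast
    then obtain J \<delta> where "?P k J \<delta>" using UN.IH by meson
    then show ?case using k(1) by (intro exI[of _ J] exI[of _ \<delta>]) auto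
  next
    case (Basis s)
    then obtain f V where s: "s = {\<mu> \<in> PE. (\<integral>x. f x \<partial>\<mu>) \<in> V}" "f \<in> Cb" "open V"
      unfolding Cb_def by blast
    then have "(\<integral>x. f x \<partial>\<mu>) \<in> V" using Basis by auto
    then obtain \<delta> where "\<delta> > 0" "ball (\<integral>x. f x \<partial>\<mu>) \<delta> \<subseteq> V" using s(3) open_contains_ball by blast
    then show ?case using s
      by (intro exI[of _ "{f}"] exI[of _ \<delta>]) (auto simp: subset_iff dist_real_def abs_minus_commute)
  qed simp
  then obtain J \<delta> where "?P U J \<delta>" by (elim exE) (rule that)
  then show ?thesis by (intro that[of J \<delta>]) auto
qed

lemma measure_eqI_Cb:
  fixes \<mu> \<nu> :: "'a::metric_space measure"
  assumes \<mu>: "\<mu> \<in> PE" and \<nu>: "\<nu> \<in> PE" and eq: "\<And>f. f \<in> Cb \<Longrightarrow> (\<integral>x. f x \<partial>\<mu>) = (\<integral>x. f x \<partial>\<nu>)"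
  shows "\<mu> = \<nu>"
proof (rule measure_eqI_generator_eq[where E="Collect closed" and \<Omega>=UNIV and A="\<lambda>_. UNIV"])
  interpret \<mu>: prob_space \<mu> using \<mu> by (simp add: PE_iff)
  interpret \<nu>: prob_space \<nu> using \<nu> by (simp add: PE_iff)
  show "Int_stable (Collect (closed :: 'a set \<Rightarrow> bool))" by (auto simp: Int_stable_def)
  have s: "sets (borel :: 'a measure) = sigma_sets UNIV (Collect closed)"
    by (subst borel_eq_closed) simp
  then show "sets \<mu> = sigma_sets UNIV (Collect closed)" "sets \<nu> = sigma_sets UNIV (Collect closed)"
    using \<mu> \<nu> by (auto simp: PE_iff)
  show "emeasure \<mu> UNIV \<noteq> \<infinity>" by simp
  fix C :: "'a set" assume "C \<in> Collect closed"
  then have C: "closed C" by simp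
  show "emeasure \<mu> C = emeasure \<nu> C"
  \<comment> \<open>The empty set is split off because \<open>infdist\<close> to it is 0 by
    convention, which would make the approximations constantly 1.\<close>
  proof (cases "C = {}")
    case False
    define f where "f n x = max 0 (1 - real n * infdist x C)" for n x
    have f01: "0 \<le> f n x" "f n x \<le> 1" for n x by (auto simp: f_def infdist_nonneg)
    have f: "f n \<in> Cb" for n
      unfolding Cb_def using f01
      by (auto simp: f_def[abs_def] bounded_iff intro!: continuous_intros exI[of _ 1])
    have lim: "(\<lambda>n. f n x) \<longlonglongrightarrow> indicat_real C x" for x
    proof (cases "x \<in> C")
      case True
      then show ?thesis by (simp add: f_def)
    next
      case x: False
      then have "infdist x C > 0"
        using in_closed_iff_infdist_zero[OF C False] infdist_nonneg[of x C] by fastforce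
      then obtain N where N: "1 < real N * infdist x C" using reals_Archimedean3 by blast
      have "f n x = 0" if "n \<ge> N" for n
      proof -
        have "real N * infdist x C \<le> real n * infdist x C"
          using that \<open>infdist x C > 0\<close> by (intro mult_right_mono) auto
        with N show ?thesis by (simp add: f_def)
      qed
      then have "eventually (\<lambda>n. f n x = 0) sequentially" by (auto simp: eventually_sequentially)
      then show ?thesis using x by (simp add: tendsto_eventually)
    qed
    have "(\<lambda>n. \<integral>x. f n x \<partial>M) \<longlonglongrightarrow> measure M C" if M: "M \<in> PE" for M
    proof -
      interpret M: prob_space M using M by (simp add: PE_iff)
      have sM: "sets M = sets borel" using M by (simp add: PE_iff)
      have "(\<lambda>n. \<integral>x. f n x \<partial>M) \<longlonglongrightarrow> (\<integral>x. indicat_real C x \<partial>M)"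
        by (rule integral_dominated_convergence[where w="\<lambda>_. 1"])
           (use lim f01 Cb_measurable[OF f] C in \<open>auto simp: sM cong: measurable_cong_sets\<close>)
      then show ?thesis using C by (simp add: sM space_PE[OF M])
    qed
    from LIMSEQ_unique[OF this[OF \<mu>]] this[OF \<nu>] have "measure \<mu> C = measure \<nu> C"
      by (simp add: eq[OF f])
    then show ?thesis by (simp add: \<mu>.emeasure_eq_measure \<nu>.emeasure_eq_measure)
  qed simp
qed auto

text \<open>Serves to make the compact sub-level sets of \<open>\<alpha>\<close> closed, so that
  \<open>\<alpha>\<close> is lower semicontinuous.\<close>

lemma Hausdorff_weak_top: "Hausdorff_space (weak_top :: 'a::metric_space measure topology)"
  unfolding Hausdorff_space_def
proof (intro allI impI, elim conjE)
  fix \<mu> \<nu> :: "'a measure"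
  assume "\<mu> \<in> topspace weak_top" "\<nu> \<in> topspace weak_top" and ne: "\<mu> \<noteq> \<nu>"
  then have PE: "\<mu> \<in> PE" "\<nu> \<in> PE" by auto
  then obtain f where f: "f \<in> Cb" "(\<integral>x. f x \<partial>\<mu>) \<noteq> (\<integral>x. f x \<partial>\<nu>)"
    using measure_eqI_Cb ne by blast
  obtain U V where UV: "open U" "open V" "(\<integral>x. f x \<partial>\<mu>) \<in> U" "(\<integral>x. f x \<partial>\<nu>) \<in> V" "U \<inter> V = {}"
    using hausdorff[OF f(2)] by blast
  show "\<exists>U V. openin weak_top U \<and> openin weak_top V \<and> \<mu> \<in> U \<and> \<nu> \<in> V \<and> disjnt U V"
    by (intro exI[of _ "{\<mu> \<in> PE. (\<integral>x. f x \<partial>\<mu>) \<in> U}"] exI[of _ "{\<mu> \<in> PE. (\<integral>x. f x \<partial>\<mu>) \<in> V}"])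
       (use UV PE f openin_weak_top_integral in \<open>auto simp: disjnt_def\<close>)
qed

section \<open>Mixtures and empirical measures\<close>

text \<open>\<open>mix\<close> and \<open>emp\<close> are built with \<open>measure_of\<close>,
  which falls back to the zero measure unless the set function is a measure. Identifying them with
  measures obtained otherwise settles this.\<close>

lemma measure_of_borel_eq:
  fixes M :: "'a::topological_space measure"
  assumes sM: "sets M = sets borel" and eq: "\<And>A. A \<in> sets borel \<Longrightarrow> f A = emeasure M A"
  shows "measure_of (space borel) (sets borel) f = M"
proof -
  have "measure_of (space borel) (sets borel) f = measure_of (space M) (sets M) (emeasure M)"
    unfolding sM sets_eq_imp_space_eq[OF sM]
    by (rule measure_of_eq) (use sets.sigma_sets_eq[of "borel :: 'a measure"] eq in \<open>auto dest: sets.sets_into_space\<close>)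
  also have "\<dots> = M"
  proof (rule measure_eqI)
    fix A assume "A \<in> sets (measure_of (space M) (sets M) (emeasure M))"
    then show "emeasure (measure_of (space M) (sets M) (emeasure M)) A = emeasure M A"
      by (intro emeasure_measure_of_sigma sets.sigma_algebra_axioms)
         (auto simp: emeasure_positive emeasure_countably_additive)
  qed simp
  finally show ?thesis .
qed

text \<open>A mixture is the law of a two-stage experiment: a Bernoulli variable selects one of the
  two measures, which is then sampled.\<close>

lemma mix_PE:
  assumes \<mu>: "\<mu> \<in> PE" and \<nu>: "\<nu> \<in> PE" and t: "0 \<le> t" "t \<le> 1"
  shows "mix t \<mu> \<nu> \<in> PE"
    and "f \<in> Cb \<Longrightarrow> (\<integral>x. f x \<partial>mix t \<mu> \<nu>) = t * (\<integral>x. f x \<partial>\<mu>) + (1 - t) * (\<integral>x. f x \<partial>\<nu>)"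
proof -
  let ?K = "\<lambda>b. if b then \<mu> else \<nu>"
  let ?B = "measure_pmf (bernoulli_pmf t) \<bind> ?K"
  have sP: "\<mu> \<in> space (prob_algebra borel)" "\<nu> \<in> space (prob_algebra borel)"
    using \<mu> \<nu> by (auto simp: PE_def)
  then have Kp: "?K \<in> measurable (measure_pmf (bernoulli_pmf t)) (prob_algebra borel)"
    by (simp add: space_prob_algebra)
  note K = measurable_prob_algebraD[OF Kp]
  have B: "?B \<in> space (prob_algebra borel)"
  proof -
    have "(\<lambda>_::unit. measure_pmf (bernoulli_pmf t)) \<in> measurable (count_space UNIV) (prob_algebra (measure_pmf (bernoulli_pmf t)))"
      by (simp add: space_prob_algebra measure_pmf.prob_space_axioms)
    from measurable_space[OF measurable_bind_prob_space[OF this Kp], of "()"] show ?thesis by simp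
  qed
  have "mix t \<mu> \<nu> = ?B"
    unfolding mix_def
  proof (rule measure_of_borel_eq)
    fix A :: "'a set" assume "A \<in> sets borel"
    then show "ennreal t * emeasure \<mu> A + ennreal (1 - t) * emeasure \<nu> A = emeasure ?B A"
      using t by (subst emeasure_bind[OF _ K]) (auto simp: mult.commute)
  qed (use B in \<open>simp add: space_prob_algebra\<close>)
  then show "mix t \<mu> \<nu> \<in> PE" using B by (simp add: PE_def)
  assume f: "f \<in> Cb"
  then obtain b where b: "\<And>x. \<bar>f x\<bar> \<le> b" using Cb_bounded by metis
  have "(\<integral>x. f x \<partial>?B) = (\<integral>b. (\<integral>x. f x \<partial>?K b) \<partial>bernoulli_pmf t)"
  proof (rule integral_bind[OF Cb_measurable[OF f] b K])
    show "finite_measure (measure_pmf (bernoulli_pmf t))" by unfold_locales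
    show "AE b in measure_pmf (bernoulli_pmf t). emeasure (?K b) (space (?K b)) \<le> ennreal 1"
      using \<mu> \<nu> by (auto simp: PE_iff prob_space.emeasure_space_1)
  qed
  also have "\<dots> = t * (\<integral>x. f x \<partial>\<mu>) + (1 - t) * (\<integral>x. f x \<partial>\<nu>)"
    using t by simp
  finally show "(\<integral>x. f x \<partial>mix t \<mu> \<nu>) = t * (\<integral>x. f x \<partial>\<mu>) + (1 - t) * (\<integral>x. f x \<partial>\<nu>)"
    using \<open>mix t \<mu> \<nu> = ?B\<close> by simp
qed

lemma emp_eq_distr:
  assumes n: "0 < n"
  shows "emp n x = distr (measure_pmf (pmf_of_set {..<n})) borel x"
  unfolding emp_def
proof (rule measure_of_borel_eq)
  have ne: "{..<n} \<noteq> {}" using n by auto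
  fix A :: "'a set" assume "A \<in> sets borel"
  then show "ennreal (real (card {k \<in> {..<n}. x k \<in> A}) / real n) = emeasure (distr (measure_pmf (pmf_of_set {..<n})) borel x) A"
    using ne by (subst emeasure_distr) (auto simp: emeasure_pmf_of_set intro!: arg_cong[where f=card])
qed simp

lemma emp_PE: "0 < n \<Longrightarrow> emp n x \<in> PE"
  by (auto simp: emp_eq_distr PE_iff intro!: prob_space.prob_space_distr measure_pmf.prob_space_axioms)

lemma integral_emp:
  fixes f :: "'a::topological_space \<Rightarrow> real"
  assumes n: "0 < n" and f: "f \<in> borel_measurable borel"
  shows "(\<integral>z. f z \<partial>emp n x) = (\<Sum>k<n. f (x k)) / real n"
proof -
  have ne: "{..<n} \<noteq> {}" using n by auto
  have "(\<integral>z. f z \<partial>emp n x) = (\<integral>k. f (x k) \<partial>measure_pmf (pmf_of_set {..<n}))"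
    unfolding emp_eq_distr[OF n] by (rule integral_distr[OF _ f]) simp
  also have "\<dots> = (\<Sum>k<n. f (x k)) / real n"
    using ne by (simp add: integral_pmf_of_set)
  finally show ?thesis .
qed

text \<open>Observables of \<open>emp n x\<close> are averages of the \<open>f (x k)\<close>, hence
  continuous for the product topology on the full function space. The Borel measurability that
  follows is carried over to \<open>En n\<close> by \<open>borel_measurable_En\<close>.\<close>

lemma open_vimage_emp:
  assumes n: "0 < n" and U: "openin weak_top U"
  shows "open {x. emp n x \<in> U}"
proof (subst open_subopen, safe)
  fix x assume "emp n x \<in> U"
  then obtain J \<delta> where J: "finite J" "J \<subseteq> Cb" "0 < \<delta>"
    and JU: "\<And>\<nu>. \<nu> \<in> PE \<Longrightarrow> (\<And>f. f \<in> J \<Longrightarrow> \<bar>(\<integral>x. f x \<partial>\<nu>) - (\<integral>z. f z \<partial>emp n x)\<bar> < \<delta>) \<Longrightarrow> \<nu> \<in> U"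
    using weak_top_nbhd_base[OF U] by blast
  let ?T = "\<Inter>f\<in>J. {y. \<bar>(\<integral>z. f z \<partial>emp n y) - (\<integral>z. f z \<partial>emp n x)\<bar> < \<delta>}"
  have "open ?T"
  proof (intro open_INT J ballI)
    fix f assume "f \<in> J"
    then have "f \<in> Cb" using J by auto
    then have [continuous_intros]: "continuous_on UNIV (\<lambda>y. f (y k))" for k
      unfolding Cb_def using continuous_on_compose2[OF _ continuous_on_product_coordinates[of k], of UNIV f] by auto
    show "open {y. \<bar>(\<integral>z. f z \<partial>emp n y) - (\<integral>z. f z \<partial>emp n x)\<bar> < \<delta>}"
      unfolding integral_emp[OF n Cb_measurable[OF \<open>f \<in> Cb\<close>]] using n
      by (intro open_Collect_less continuous_intros) auto
  qed
  moreover have "x \<in> ?T" using J by auto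
  moreover have "?T \<subseteq> {x. emp n x \<in> U}" using JU emp_PE[OF n] by auto
  ultimately show "\<exists>T. open T \<and> x \<in> T \<and> T \<subseteq> {x. emp n x \<in> U}" by blast
qed

lemma borel_measurable_En:
  fixes f :: "(nat \<Rightarrow> 'a::second_countable_topology) \<Rightarrow> real"
  assumes "f \<in> borel_measurable borel"
  shows "f \<in> borel_measurable (En n)"
proof -
  have "(\<lambda>x. x k) \<in> borel_measurable (En n :: (nat \<Rightarrow> 'a) measure)" for k
  proof (cases "k < n")
    case True
    then show ?thesis unfolding En_def by (intro measurable_component_singleton) auto
  next
    case False
    \<comment> \<open>Points of \<open>En n\<close> take the value \<open>undefined\<close> at every
      coordinate from \<open>n\<close> on.\<close>
    have "(\<lambda>x. x k) \<in> borel_measurable (En n :: (nat \<Rightarrow> 'a) measure)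
       \<longleftrightarrow> (\<lambda>x. undefined :: 'a) \<in> borel_measurable (En n :: (nat \<Rightarrow> 'a) measure)"
      using False by (intro measurable_cong) (auto simp: En_def space_PiM PiE_def extensional_def)
    then show ?thesis by simp
  qed
  then have "(\<lambda>x. x) \<in> measurable (En n :: (nat \<Rightarrow> 'a) measure) borel"
    by (rule measurable_coordinatewise_then_product)
  from measurable_compose[OF this assms] show ?thesis .
qed

lemma lsc_on_emp_measurable:
  fixes F :: "'a::second_countable_topology measure \<Rightarrow> real"
  assumes F: "lsc_on weak_top F" and n: "0 < n"
  shows "(\<lambda>x. F (emp n x)) \<in> borel_measurable (En n)"
proof (rule borel_measurable_En, rule borel_measurableI_greater)
  fix a
  have "open {x. emp n x \<in> {\<nu> \<in> topspace weak_top. F \<nu> > a}}"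
    using F by (intro open_vimage_emp n) (auto simp: lsc_on_def)
  then show "{x \<in> space borel. a < F (emp n x)} \<in> sets borel"
    by (simp add: emp_PE n)
qed

lemma usc_on_emp_measurable:
  fixes F :: "'a::second_countable_topology measure \<Rightarrow> real"
  assumes F: "usc_on weak_top F" and n: "0 < n"
  shows "(\<lambda>x. F (emp n x)) \<in> borel_measurable (En n)"
proof (rule borel_measurable_En, rule borel_measurableI_less)
  fix a
  have "open {x. emp n x \<in> {\<nu> \<in> topspace weak_top. F \<nu> < a}}"
    using F by (intro open_vimage_emp n) (auto simp: usc_on_def)
  then show "{x \<in> space borel. F (emp n x) < a} \<in> sets borel"
    by (simp add: emp_PE n)
qed

section \<open>Upper bound\<close>

lemma continuous_map_weak_top_integral:
  assumes "f \<in> Cb" shows "continuous_map weak_top euclideanreal (\<lambda>\<mu>. \<integral>x. f x \<partial>\<mu>)"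
  using openin_weak_top_integral[OF assms] by (auto simp: continuous_map_def)

text \<open>Let \<open>t\<close> tend to 0. In the application \<open>t\<close> is the weight of a
  competitor mixed into a minimiser, and \<open>t * y\<close> is the second-order term after
  division by \<open>t\<close>.\<close>

lemma nonneg_of_perturbation:
  fixes x y :: real
  assumes "\<And>t. 0 < t \<Longrightarrow> t \<le> 1 \<Longrightarrow> 0 \<le> x + t * y"
  shows "0 \<le> x"
proof -
  have "((\<lambda>t. x + t * y) \<longlongrightarrow> x + 0 * y) (at_right 0)"
    by (intro tendsto_intros)
  moreover have "\<forall>\<^sub>F t in at_right 0. 0 \<le> x + t * y"
    unfolding eventually_at_right_field using assms by (intro exI[of _ 1]) auto
  ultimately show ?thesis
    using tendsto_lowerbound[of "\<lambda>t. x + t * y" "x + 0 * y" "at_right 0" 0] by simp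
qed

locale convex_rate =
  fixes \<alpha> :: "'a::polish_space measure \<Rightarrow> ereal" and c :: real
  assumes lower: "\<mu> \<in> PE \<Longrightarrow> ereal c \<le> \<alpha> \<mu>"
    and proper: "\<exists>\<mu>\<in>PE. \<alpha> \<mu> \<noteq> \<infinity>"
    and convex: "\<mu> \<in> PE \<Longrightarrow> \<nu> \<in> PE \<Longrightarrow> t \<in> {0..1} \<Longrightarrow>
      \<alpha> (mix t \<mu> \<nu>) \<le> ereal t * \<alpha> \<mu> + ereal (1 - t) * \<alpha> \<nu>"
    and compact: "compactin weak_top {\<mu> \<in> PE. \<alpha> \<mu> \<le> ereal r}"
begin

lemma real_valued: "\<mu> \<in> PE \<Longrightarrow> \<alpha> \<mu> \<noteq> \<infinity> \<Longrightarrow> \<alpha> \<mu> = ereal (real_of_ereal (\<alpha> \<mu>))"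
  using lower[of \<mu>] by (cases "\<alpha> \<mu>") auto

lemma openin_superlevel: "openin weak_top {\<mu> \<in> PE. ereal s < \<alpha> \<mu>}"
proof -
  have "closedin weak_top {\<mu> \<in> PE. \<alpha> \<mu> \<le> ereal s}"
    by (rule compactin_imp_closedin[OF Hausdorff_weak_top compact])
  then have "openin weak_top (topspace weak_top - {\<mu> \<in> PE. \<alpha> \<mu> \<le> ereal s})"
    by (simp add: closedin_def)
  moreover have "topspace weak_top - {\<mu> \<in> PE. \<alpha> \<mu> \<le> ereal s} = {\<mu> \<in> PE. ereal s < \<alpha> \<mu>}"
    by auto
  ultimately show ?thesis by simp
qed

text \<open>Direct method: \<open>h\<close> is lower semicontinuous, and because \<open>g\<close> is
  nonnegative the sub-level sets of \<open>h\<close> lie in the compact ones of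
  \<open>\<alpha>\<close>.\<close>

lemma attains_min:
  assumes g: "continuous_map weak_top euclideanreal g" and g0: "\<And>\<mu>. \<mu> \<in> PE \<Longrightarrow> 0 \<le> g \<mu>"
  obtains \<mu> where "\<mu> \<in> PE" "\<alpha> \<mu> \<noteq> \<infinity>" "\<And>\<nu>. \<nu> \<in> PE \<Longrightarrow> \<alpha> \<mu> + ereal (g \<mu>) \<le> \<alpha> \<nu> + ereal (g \<nu>)"
proof -
  define h where "h \<mu> = \<alpha> \<mu> + ereal (g \<mu>)" for \<mu>
  have h_open: "openin weak_top {\<mu> \<in> PE. ereal r < h \<mu>}" for r
  proof -
    \<comment> \<open>A sum exceeds \<open>r\<close> iff some \<open>s\<close> splits the threshold
      between the summands, so the superlevel set of \<open>h\<close> is a union of open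
      sets.\<close>
    have "ereal r < h \<mu> \<longleftrightarrow> (\<exists>s. ereal s < \<alpha> \<mu> \<and> r - s < g \<mu>)" if "\<mu> \<in> PE" for \<mu>
    proof (cases "\<alpha> \<mu>")
      case (real a)
      have "r < a + g \<mu> \<longleftrightarrow> (\<exists>s. s < a \<and> r - s < g \<mu>)"
      proof
        assume "r < a + g \<mu>"
        then show "\<exists>s. s < a \<and> r - s < g \<mu>"
          by (intro exI[of _ "(a + (r - g \<mu>)) / 2"]) (simp add: field_simps)
      qed auto
      then show ?thesis by (simp add: h_def real)
    next
      case PInf
      then show ?thesis by (auto simp: h_def intro!: exI[of _ "r - g \<mu> + 1"])
    qed (use lower[OF that] in auto)
    then have "{\<mu> \<in> PE. ereal r < h \<mu>} = (\<Union>s. {\<mu> \<in> PE. ereal s < \<alpha> \<mu>} \<inter> {\<mu> \<in> topspace weak_top. g \<mu> \<in> {r - s<..}})"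
      by auto
    moreover have "openin weak_top {\<mu> \<in> topspace weak_top. g \<mu> \<in> {r - s<..}}" for s
      by (rule openin_continuous_map_preimage[OF g]) auto
    ultimately show ?thesis
      using openin_superlevel by (auto intro!: openin_Union openin_Int)
  qed
  have h_lower: "ereal c \<le> h \<mu>" if "\<mu> \<in> PE" for \<mu>
    using add_mono[OF lower[OF that], of 0 "ereal (g \<mu>)"] g0[OF that] by (simp add: h_def zero_ereal_def)
  have \<alpha>_h: "\<alpha> \<mu> \<le> h \<mu>" if "\<mu> \<in> PE" for \<mu>
    using add_left_mono[of 0 "ereal (g \<mu>)" "\<alpha> \<mu>"] g0[OF that] by (simp add: h_def zero_ereal_def)
  obtain \<mu>0 where \<mu>0: "\<mu>0 \<in> PE" "\<alpha> \<mu>0 \<noteq> \<infinity>" using proper by blast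
  define I where "I = (INF \<mu>\<in>PE. h \<mu>)"
  have "ereal c \<le> I" unfolding I_def by (intro INF_greatest h_lower)
  moreover have "h \<mu>0 < \<infinity>"
    using \<mu>0(2) by (cases "\<alpha> \<mu>0") (auto simp: h_def)
  then have "I < \<infinity>"
    unfolding I_def by (intro le_less_trans[OF INF_lower[OF \<mu>0(1)]])
  ultimately obtain m where m: "I = ereal m" by (cases I) auto
  have le: "ereal m \<le> h \<mu>" if "\<mu> \<in> PE" for \<mu> unfolding m[symmetric] I_def by (rule INF_lower[OF that])
  have "\<exists>\<mu>\<in>PE. h \<mu> = ereal m"
  proof (rule ccontr)
    assume "\<not> (\<exists>\<mu>\<in>PE. h \<mu> = ereal m)"
    then have gt: "ereal m < h \<mu>" if "\<mu> \<in> PE" for \<mu> using le[OF that] that by (metis order_le_imp_less_or_eq)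
    \<comment> \<open>If the infimum \<open>m\<close> is not attained, the open sets
      \<open>?O n\<close> cover the compact set \<open>?A\<close>. Finitely many suffice, which
      keeps \<open>h\<close> uniformly above \<open>m\<close> on \<open>?A\<close>; off
      \<open>?A\<close> it exceeds \<open>m + 1\<close> already.\<close>
    let ?A = "{\<mu> \<in> PE. \<alpha> \<mu> \<le> ereal (m + 1)}"
    let ?O = "\<lambda>n. {\<mu> \<in> PE. ereal (m + 1 / real (Suc n)) < h \<mu>}"
    have "?A \<subseteq> \<Union>(range ?O)"
    proof
      fix \<mu> assume "\<mu> \<in> ?A"
      then have \<mu>: "\<mu> \<in> PE" by simp
      then obtain b where b: "ereal m < ereal b" "ereal b < h \<mu>" using ereal_dense2[OF gt[OF \<mu>]] by blast
      then have "b - m > 0" by simp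
      then obtain n where "1 / real (Suc n) < b - m" by (rule nat_approx_posE) blast
      then have "ereal (m + 1 / real (Suc n)) < h \<mu>" using b(2) by (intro less_trans[OF _ b(2)]) simp
      then show "\<mu> \<in> \<Union>(range ?O)" using \<mu> by blast
    qed
    then obtain \<F> where F: "finite \<F>" "\<F> \<subseteq> range ?O" "?A \<subseteq> \<Union>\<F>"
      using compactinD[OF compact, of "range ?O" "m + 1"] h_open by blast
    obtain N where N: "finite N" "\<F> = ?O ` N" using finite_subset_image[OF F(1,2)] by blast
    define k where "k = Max (insert 0 N)"
    have k: "n \<le> k" if "n \<in> N" for n unfolding k_def using N(1) that by (intro Max_ge) auto
    have bound: "ereal (m + 1 / real (Suc k)) \<le> h \<mu>" if \<mu>: "\<mu> \<in> PE" for \<mu>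
    proof (cases "\<mu> \<in> ?A")
      case True
      then obtain n where n: "n \<in> N" "ereal (m + 1 / real (Suc n)) < h \<mu>" using F(3) N(2) by auto
      have "1 / real (Suc k) \<le> 1 / real (Suc n)" using k[OF n(1)] by (intro frac_le) auto
      then have "ereal (m + 1 / real (Suc k)) \<le> ereal (m + 1 / real (Suc n))" by simp
      with n(2) show ?thesis by (metis less_imp_le order_trans)
    next
      case False
      then have "ereal (m + 1) < h \<mu>" using \<mu> \<alpha>_h[OF \<mu>] by auto
      moreover have "ereal (m + 1 / real (Suc k)) \<le> ereal (m + 1)" by (simp add: field_simps)
      ultimately show ?thesis by (metis less_imp_le order_trans)
    qed
    have "ereal (m + 1 / real (Suc k)) \<le> I" unfolding I_def by (rule INF_greatest) (rule bound)
    then show False by (simp add: m)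
  qed
  then obtain \<mu> where \<mu>: "\<mu> \<in> PE" "h \<mu> = ereal m" by blast
  show ?thesis
  proof (rule that[OF \<mu>(1)])
    show "\<alpha> \<mu> \<noteq> \<infinity>" using \<mu>(2) by (auto simp: h_def)
    show "\<alpha> \<mu> + ereal (g \<mu>) \<le> \<alpha> \<nu> + ereal (g \<nu>)" if "\<nu> \<in> PE" for \<nu>
      using le[OF that] \<mu>(2) by (simp add: h_def)
  qed
qed

text \<open>A quadratic penalty replaces Hahn--Banach separation: the first-order condition at the
  minimiser of \<open>\<alpha> + K |J - z|\<^sup>2\<close> yields an affine minorant of \<open>\<alpha>\<close>, and nonexpansiveness of the
  proximal map makes this minorant depend on \<open>z\<close> in a Lipschitz way.\<close>

lemma lipschitz_affine_minorants:
  assumes J: "finite J" "J \<subseteq> Cb" and K: "0 < K"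
  obtains L :: real and l :: "(('a \<Rightarrow> real) \<Rightarrow> real) \<Rightarrow> ('a \<Rightarrow> real) \<Rightarrow> real" and r
  where "0 \<le> L"
    "\<And>z \<mu>. \<mu> \<in> PE \<Longrightarrow> ereal ((\<Sum>f\<in>J. l z f * (\<integral>x. f x \<partial>\<mu>)) - r z) \<le> \<alpha> \<mu>"
    "\<And>z. \<exists>\<mu>\<in>PE. \<exists>a. \<alpha> \<mu> = ereal a \<and>
       a + K * (\<Sum>f\<in>J. ((\<integral>x. f x \<partial>\<mu>) - z f)\<^sup>2) \<le> (\<Sum>f\<in>J. l z f * z f) - r z"
    "\<And>z z' f. f \<in> J \<Longrightarrow> \<bar>l z f - l z' f\<bar> \<le> L * (\<Sum>f\<in>J. \<bar>z f - z' f\<bar>)"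
    "\<And>z z'. \<bar>r z - r z'\<bar> \<le> L * (\<Sum>f\<in>J. \<bar>z f - z' f\<bar>)"
proof -
  obtain B where B: "0 < B" "\<And>f x. f \<in> J \<Longrightarrow> \<bar>f x\<bar> \<le> B" using finite_Cb_bounded[OF J] by blast
  define e where "e f \<mu> = (\<integral>x. f x \<partial>\<mu>)" for f :: "'a \<Rightarrow> real" and \<mu> :: "'a measure"
  have eB: "\<bar>e f \<mu>\<bar> \<le> B" if "f \<in> J" "\<mu> \<in> PE" for f \<mu>
    unfolding e_def using that J B by (intro abs_integral_le_PE Cb_measurable) auto
  have "\<forall>z. \<exists>\<mu>. \<mu> \<in> PE \<and> \<alpha> \<mu> \<noteq> \<infinity> \<and> (\<forall>\<nu>\<in>PE. \<alpha> \<mu> + ereal (K * (\<Sum>f\<in>J. (e f \<mu> - z f)\<^sup>2)) \<le> \<alpha> \<nu> + ereal (K * (\<Sum>f\<in>J. (e f \<nu> - z f)\<^sup>2)))"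
  proof
    fix z
    have "continuous_map weak_top euclideanreal (\<lambda>\<mu>. K * (\<Sum>f\<in>J. (e f \<mu> - z f)\<^sup>2))"
      unfolding e_def power2_eq_square using J
      by (intro continuous_map_sum continuous_map_real_mult continuous_map_diff continuous_map_weak_top_integral) auto
    then show "\<exists>\<mu>. \<mu> \<in> PE \<and> \<alpha> \<mu> \<noteq> \<infinity> \<and> (\<forall>\<nu>\<in>PE. \<alpha> \<mu> + ereal (K * (\<Sum>f\<in>J. (e f \<mu> - z f)\<^sup>2)) \<le> \<alpha> \<nu> + ereal (K * (\<Sum>f\<in>J. (e f \<nu> - z f)\<^sup>2)))"
      using K by (elim attains_min) (auto intro!: sum_nonneg mult_nonneg_nonneg)
  qed
  from choice[OF this] obtain p where p: "\<And>z. p z \<in> PE" "\<And>z. \<alpha> (p z) \<noteq> \<infinity>"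
    and pmin: "\<And>z \<nu>. \<nu> \<in> PE \<Longrightarrow> \<alpha> (p z) + ereal (K * (\<Sum>f\<in>J. (e f (p z) - z f)\<^sup>2)) \<le> \<alpha> \<nu> + ereal (K * (\<Sum>f\<in>J. (e f \<nu> - z f)\<^sup>2))"
    by blast
  define a where "a z = real_of_ereal (\<alpha> (p z))" for z
  have a: "\<alpha> (p z) = ereal (a z)" for z unfolding a_def by (rule real_valued[OF p])
  \<comment> \<open>\<open>l z\<close> is minus the gradient of the penalty at the minimiser
    \<open>p z\<close>, and \<open>r z\<close> is fixed so that the affine function equals
    \<open>\<alpha>\<close> at \<open>p z\<close>.\<close>
  define l where "l z f = 2 * K * (z f - e f (p z))" for z f
  define r where "r z = (\<Sum>f\<in>J. l z f * e f (p z)) - a z" for z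
  have first_order: "ereal ((\<Sum>f\<in>J. l z f * e f \<mu>) - r z) \<le> \<alpha> \<mu>" if \<mu>: "\<mu> \<in> PE" for z \<mu>
  proof (cases "\<alpha> \<mu> = \<infinity>")
    case False
    then obtain b where b: "\<alpha> \<mu> = ereal b" using real_valued[OF \<mu>] by blast
    define u where "u f = e f (p z) - z f" for f
    define d where "d f = e f \<mu> - e f (p z)" for f
    \<comment> \<open>The minimiser is compared with its mixture with \<open>\<mu>\<close>:
      convexity bounds \<open>\<alpha>\<close> there, and the penalty is expanded exactly. The
      resulting inequality is then divided by \<open>t\<close>.\<close>
    have "0 \<le> (b - a z + 2 * K * (\<Sum>f\<in>J. u f * d f)) + t * (K * (\<Sum>f\<in>J. (d f)\<^sup>2))" if t: "0 < t" "t \<le> 1" for t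
    proof -
      let ?m = "mix t \<mu> (p z)"
      have m: "?m \<in> PE" using \<mu> p t by (intro mix_PE) auto
      have em: "e f ?m - z f = u f + t * d f" if "f \<in> J" for f
        unfolding e_def u_def d_def using that J \<mu> p t
        by (subst mix_PE(2)) (auto simp: algebra_simps)
      have "ereal (a z + K * (\<Sum>f\<in>J. (u f)\<^sup>2)) \<le> \<alpha> ?m + ereal (K * (\<Sum>f\<in>J. (u f + t * d f)\<^sup>2))"
        using pmin[OF m, of z] by (simp add: a em u_def)
      also have "\<dots> \<le> (ereal t * \<alpha> \<mu> + ereal (1 - t) * \<alpha> (p z)) + ereal (K * (\<Sum>f\<in>J. (u f + t * d f)\<^sup>2))"
        using t \<mu> p by (intro add_right_mono convex) auto
      also have "\<dots> = ereal (t * b + (1 - t) * a z + K * (\<Sum>f\<in>J. (u f + t * d f)\<^sup>2))"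
        by (simp add: a b)
      finally have "a z + K * (\<Sum>f\<in>J. (u f)\<^sup>2) \<le> t * b + (1 - t) * a z + K * (\<Sum>f\<in>J. (u f + t * d f)\<^sup>2)"
        by simp
      moreover have "(\<Sum>f\<in>J. (u f + t * d f)\<^sup>2) = (\<Sum>f\<in>J. (u f)\<^sup>2) + t * (2 * (\<Sum>f\<in>J. u f * d f)) + t * (t * (\<Sum>f\<in>J. (d f)\<^sup>2))"
        by (simp add: sum.distrib[symmetric] sum_distrib_left power2_eq_square algebra_simps)
      ultimately have "0 \<le> t * ((b - a z + 2 * K * (\<Sum>f\<in>J. u f * d f)) + t * (K * (\<Sum>f\<in>J. (d f)\<^sup>2)))"
        by (simp add: algebra_simps)
      then show ?thesis using t by (simp add: zero_le_mult_iff)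
    qed
    then have "0 \<le> b - a z + 2 * K * (\<Sum>f\<in>J. u f * d f)" by (rule nonneg_of_perturbation)
    moreover have "2 * K * (\<Sum>f\<in>J. u f * d f) = (\<Sum>f\<in>J. l z f * e f (p z)) - (\<Sum>f\<in>J. l z f * e f \<mu>)"
      by (simp add: l_def u_def d_def sum_distrib_left sum_subtractf[symmetric] algebra_simps)
    ultimately show ?thesis by (simp add: b r_def)
  qed simp
  define D where "D z z' = (\<Sum>f\<in>J. \<bar>z f - z' f\<bar>)" for z z' :: "('a \<Rightarrow> real) \<Rightarrow> real"
  have D0: "0 \<le> D z z'" for z z' unfolding D_def by (intro sum_nonneg) auto
  have Dsym: "D z z' = D z' z" for z z' unfolding D_def by (simp add: abs_minus_commute)
  \<comment> \<open>Adding the minorant for \<open>z\<close> at \<open>p z'\<close> and the one for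
    \<open>z'\<close> at \<open>p z\<close> cancels the values of \<open>\<alpha>\<close>. What
    remains says that the sum of \<open>(v f)\<^sup>2\<close> is at most the sum of
    \<open>w f * v f\<close>, so the observables of \<open>p z\<close> move no further than
    \<open>z\<close> in Euclidean distance.\<close>
  have prox: "\<bar>e f (p z) - e f (p z')\<bar> \<le> D z z'" if f: "f \<in> J" for f z z'
  proof -
    define w where "w f = z f - z' f" for f
    define v where "v f = e f (p z) - e f (p z')" for f
    have 1: "(\<Sum>f\<in>J. l z f * e f (p z')) - r z \<le> a z'" using first_order[OF p(1)[of z'], of z] by (simp add: a)
    have 2: "(\<Sum>f\<in>J. l z' f * e f (p z)) - r z' \<le> a z" using first_order[OF p(1)[of z], of z'] by (simp add: a)
    have "(\<Sum>f\<in>J. l z f * e f (p z')) - (\<Sum>f\<in>J. l z f * e f (p z)) + (\<Sum>f\<in>J. l z' f * e f (p z)) - (\<Sum>f\<in>J. l z' f * e f (p z')) \<le> 0"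
      using 1 2 by (simp add: r_def)
    also have "(\<Sum>f\<in>J. l z f * e f (p z')) - (\<Sum>f\<in>J. l z f * e f (p z)) + (\<Sum>f\<in>J. l z' f * e f (p z)) - (\<Sum>f\<in>J. l z' f * e f (p z'))
       = 2 * K * (\<Sum>f\<in>J. (v f)\<^sup>2 - w f * v f)"
      by (simp add: l_def v_def w_def sum_distrib_left sum_subtractf[symmetric] sum.distrib[symmetric] power2_eq_square algebra_simps)
    finally have "(\<Sum>f\<in>J. (v f)\<^sup>2 - w f * v f) \<le> 0" using K by (simp add: mult_le_0_iff)
    then have "(\<Sum>f\<in>J. (v f)\<^sup>2) \<le> (\<Sum>f\<in>J. w f * v f)" by (simp add: sum_subtractf)
    also have "\<dots> \<le> (\<Sum>f\<in>J. ((w f)\<^sup>2 + (v f)\<^sup>2) / 2)"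
      by (intro sum_mono) (use sum_squares_bound in \<open>auto simp: field_simps\<close>)
    also have "\<dots> = ((\<Sum>f\<in>J. (w f)\<^sup>2) + (\<Sum>f\<in>J. (v f)\<^sup>2)) / 2"
      by (simp add: sum_divide_distrib[symmetric] sum.distrib)
    finally have "(\<Sum>f\<in>J. (v f)\<^sup>2) \<le> (\<Sum>f\<in>J. (w f)\<^sup>2)" by simp
    then have "L2_set v J \<le> L2_set w J" by (simp add: L2_set_def)
    also have "\<dots> \<le> (\<Sum>f\<in>J. \<bar>w f\<bar>)" by (rule L2_set_le_sum_abs)
    finally have "L2_set v J \<le> D z z'" by (simp add: D_def w_def)
    moreover have "\<bar>v f\<bar> \<le> L2_set v J"
    proof -
      have "(v f)\<^sup>2 \<le> (\<Sum>f\<in>J. (v f)\<^sup>2)" using f J(1) by (intro member_le_sum) auto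
      then have "sqrt ((v f)\<^sup>2) \<le> L2_set v J" unfolding L2_set_def by (rule real_sqrt_le_mono)
      then show ?thesis by simp
    qed
    ultimately show ?thesis by (simp add: v_def)
  qed
  have l_lip: "\<bar>l z f - l z' f\<bar> \<le> 4 * K * D z z'" if f: "f \<in> J" for f z z'
  proof -
    have "l z f - l z' f = 2 * K * ((z f - z' f) - (e f (p z) - e f (p z')))"
      by (simp add: l_def algebra_simps)
    then have "\<bar>l z f - l z' f\<bar> = 2 * K * \<bar>(z f - z' f) - (e f (p z) - e f (p z'))\<bar>"
      using K by (simp add: abs_mult)
    also have "\<dots> \<le> 2 * K * (\<bar>z f - z' f\<bar> + \<bar>e f (p z) - e f (p z')\<bar>)"
      using K by (intro mult_left_mono abs_triangle_ineq4) auto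
    also have "\<dots> \<le> 2 * K * (D z z' + D z z')"
    proof (intro mult_left_mono add_mono prox f)
      show "\<bar>z f - z' f\<bar> \<le> D z z'" unfolding D_def using f J(1) by (intro member_le_sum) auto
    qed (use K in auto)
    finally show ?thesis by simp
  qed
  \<comment> \<open>The minorant for \<open>z'\<close> at the point \<open>p z\<close> gives one
    side; the other comes from exchanging \<open>z\<close> and \<open>z'\<close>.\<close>
  have r_half: "r z - r z' \<le> real (card J) * (4 * K * B) * D z z'" for z z'
  proof -
    have "(\<Sum>f\<in>J. l z' f * e f (p z)) - r z' \<le> a z" using first_order[OF p(1)[of z], of z'] by (simp add: a)
    then have "r z - r z' \<le> (\<Sum>f\<in>J. (l z f - l z' f) * e f (p z))"
      by (simp add: r_def left_diff_distrib sum_subtractf)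
    also have "\<dots> \<le> (\<Sum>f\<in>J. 4 * K * D z z' * B)"
    proof (intro sum_mono)
      fix f assume f: "f \<in> J"
      have "(l z f - l z' f) * e f (p z) \<le> \<bar>l z f - l z' f\<bar> * \<bar>e f (p z)\<bar>"
        by (metis abs_ge_self abs_mult)
      also have "\<dots> \<le> 4 * K * D z z' * B"
        using l_lip[OF f] eB[OF f p(1)] K D0 by (intro mult_mono) auto
      finally show "(l z f - l z' f) * e f (p z) \<le> 4 * K * D z z' * B" .
    qed
    finally show ?thesis by (simp add: ac_simps)
  qed
  define L where "L = 4 * K + real (card J) * (4 * K * B)"
  have L: "4 * K \<le> L" "real (card J) * (4 * K * B) \<le> L" using K B(1) by (auto simp: L_def)
  show ?thesis
  proof (rule that[of L l r])
    show "0 \<le> L" using L K by linarith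
    show "ereal ((\<Sum>f\<in>J. l z f * (\<integral>x. f x \<partial>\<mu>)) - r z) \<le> \<alpha> \<mu>" if "\<mu> \<in> PE" for z \<mu>
      using first_order[OF that] by (simp add: e_def)
    show "\<bar>l z f - l z' f\<bar> \<le> L * (\<Sum>f\<in>J. \<bar>z f - z' f\<bar>)" if "f \<in> J" for z z' f
      using l_lip[OF that, of z z'] mult_right_mono[OF L(1) D0[of z z']] by (simp add: D_def)
    show "\<bar>r z - r z'\<bar> \<le> L * (\<Sum>f\<in>J. \<bar>z f - z' f\<bar>)" for z z'
      using r_half[of z z'] r_half[of z' z, unfolded Dsym[of z' z]] mult_right_mono[OF L(2) D0[of z z']]
      unfolding D_def[symmetric] by linarith
    show "\<exists>\<mu>\<in>PE. \<exists>a. \<alpha> \<mu> = ereal a \<and>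
       a + K * (\<Sum>f\<in>J. ((\<integral>x. f x \<partial>\<mu>) - z f)\<^sup>2) \<le> (\<Sum>f\<in>J. l z f * z f) - r z" for z
    proof (intro bexI[of _ "p z"] exI[of _ "a z"] conjI a p)
      \<comment> \<open>At \<open>z\<close> itself the affine function exceeds
        \<open>\<alpha> (p z)\<close> by twice the penalty; one copy is claimed, and the other is
        nonnegative.\<close>
      have "(\<Sum>f\<in>J. l z f * z f) - r z = a z + 2 * (K * (\<Sum>f\<in>J. (e f (p z) - z f)\<^sup>2))"
        by (simp add: r_def l_def sum_distrib_left sum_subtractf[symmetric] sum.distrib[symmetric] power2_eq_square algebra_simps)
      moreover have "0 \<le> K * (\<Sum>f\<in>J. (e f (p z) - z f)\<^sup>2)" using K by (intro mult_nonneg_nonneg sum_nonneg) auto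
      ultimately show "a z + K * (\<Sum>f\<in>J. ((\<integral>x. f x \<partial>p z) - z f)\<^sup>2) \<le> (\<Sum>f\<in>J. l z f * z f) - r z"
        by (simp add: e_def)
    qed
  qed
qed

end

section \<open>Integrating the minorants against conditional laws\<close>

text \<open>\<open>g\<close> may be infinite, so positive and negative parts are compared
  separately. Those of \<open>\<phi>\<close> are finite, which bounds the negative part of
  \<open>g\<close> and keeps \<open>\<infinity> - \<infinity>\<close> out of the comparison.\<close>

lemma ereal_integral_ge:
  fixes \<phi> :: "'b \<Rightarrow> real"
  assumes \<phi>: "integrable M \<phi>" and le: "\<And>x. x \<in> space M \<Longrightarrow> ereal (\<phi> x) \<le> g x"
  shows "ereal (\<integral>x. \<phi> x \<partial>M) \<le> ereal_integral M g"
proof -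
  let ?p = "\<integral>\<^sup>+x. ennreal (\<phi> x) \<partial>M" and ?q = "\<integral>\<^sup>+x. ennreal (- \<phi> x) \<partial>M"
  have fin: "?p \<noteq> \<infinity>" "?q \<noteq> \<infinity>" using \<phi> by (auto simp: real_integrable_def)
  have e: "e2ennreal (ereal r) = ennreal r" for r by (simp add: e2ennreal_def ennreal_def)
  have p: "?p \<le> (\<integral>\<^sup>+x. e2ennreal (g x) \<partial>M)"
    using e2ennreal_mono[OF le] by (intro nn_integral_mono) (simp add: e)
  have q: "(\<integral>\<^sup>+x. e2ennreal (- g x) \<partial>M) \<le> ?q"
  proof (intro nn_integral_mono)
    fix x assume "x \<in> space M"
    then have "- g x \<le> ereal (- \<phi> x)" using le[of x] ereal_minus_le_minus[of "g x" "ereal (\<phi> x)"] by simp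
    from e2ennreal_mono[OF this] show "e2ennreal (- g x) \<le> ennreal (- \<phi> x)" by (simp only: e)
  qed
  have en: "enn2ereal t = ereal (enn2real t)" if "t \<noteq> \<infinity>" for t :: ennreal
    using that by (cases t) (auto simp: enn2ereal_ennreal)
  have "ereal (\<integral>x. \<phi> x \<partial>M) = enn2ereal ?p - enn2ereal ?q"
    using fin by (simp add: real_lebesgue_integral_def[OF \<phi>] en)
  also have "\<dots> \<le> ereal_integral M g"
    unfolding ereal_integral_def using p q by (intro ereal_minus_mono) (simp_all add: less_eq_ennreal.rep_eq)
  finally show ?thesis .
qed

text \<open>The maps \<open>l\<close> and \<open>r\<close> come from a choice of minimisers. Their
  Lipschitz bounds make them continuous in the sample, hence measurable.\<close>

lemma continuous_on_lipschitz_sum: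
  fixes g :: "'b::topological_space \<Rightarrow> real" and u :: "'c \<Rightarrow> 'b \<Rightarrow> real"
  assumes lip: "\<And>x y. \<bar>g x - g y\<bar> \<le> L * (\<Sum>f\<in>J. \<bar>u f x - u f y\<bar>)"
    and u: "\<And>f. f \<in> J \<Longrightarrow> continuous_on UNIV (u f)"
  shows "continuous_on UNIV g"
  unfolding continuous_on_def
proof
  fix x
  have "((\<lambda>y. L * (\<Sum>f\<in>J. \<bar>u f y - u f x\<bar>)) \<longlongrightarrow> L * (\<Sum>f\<in>J. \<bar>u f x - u f x\<bar>)) (at x)"
    using u by (intro tendsto_intros) (auto simp: continuous_on_def)
  then have lim: "((\<lambda>y. L * (\<Sum>f\<in>J. \<bar>u f y - u f x\<bar>)) \<longlongrightarrow> 0) (at x)" by simp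
  have "((\<lambda>y. g y - g x) \<longlongrightarrow> 0) (at x)"
    by (rule Lim_null_comparison[OF _ lim]) (auto intro!: always_eventually lip)
  then show "(g \<longlongrightarrow> g x) (at x)" by (simp add: LIM_zero_iff)
qed

context convex_rate
begin

text \<open>If \<open>\<alpha> \<mu>\<close> exceeds \<open>b - s\<close>, boundedness of
  \<open>F\<close> is enough. Otherwise \<open>\<mu>\<close> lies near one of finitely many centres
  \<open>t\<close>. If \<open>\<nu>\<close> is close to \<open>\<mu>\<close>, passing to
  \<open>t\<close> costs one \<open>\<epsilon>\<close> in \<open>F\<close> and one in
  \<open>\<alpha>\<close>. If some observable separates \<open>\<nu>\<close> from
  \<open>\<mu>\<close>, the penalty covers every possible gap.\<close>

lemma usc_le_quadratic_penalty:
  assumes F: "usc_on weak_top F" and b: "\<And>\<mu>. \<mu> \<in> PE \<Longrightarrow> \<bar>F \<mu>\<bar> \<le> b"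
    and s: "\<And>\<mu>. \<mu> \<in> PE \<Longrightarrow> ereal (F \<mu>) - \<alpha> \<mu> \<le> ereal s" and \<epsilon>: "0 < \<epsilon>"
  obtains J K where "finite J" "J \<subseteq> Cb" "0 < K"
    "\<And>\<mu> \<nu> a. \<mu> \<in> PE \<Longrightarrow> \<nu> \<in> PE \<Longrightarrow> \<alpha> \<mu> = ereal a \<Longrightarrow>
       F \<nu> \<le> s + 2 * \<epsilon> + a + K * (\<Sum>f\<in>J. ((\<integral>x. f x \<partial>\<mu>) - (\<integral>x. f x \<partial>\<nu>))\<^sup>2)"
proof -
  define e where "e f \<mu> = (\<integral>x. f x \<partial>\<mu>)" for f :: "'a \<Rightarrow> real" and \<mu> :: "'a measure"
  let ?A = "{\<mu> \<in> PE. \<alpha> \<mu> \<le> ereal (b - s)}"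
  let ?P = "\<lambda>\<mu> J \<delta>. finite J \<and> J \<subseteq> Cb \<and> 0 < \<delta> \<and> (\<forall>\<nu>\<in>PE. (\<forall>f\<in>J. \<bar>e f \<nu> - e f \<mu>\<bar> < \<delta>)
       \<longrightarrow> F \<nu> < F \<mu> + \<epsilon> \<and> \<alpha> \<mu> < \<alpha> \<nu> + ereal \<epsilon>)"
  have "\<forall>\<mu>\<in>?A. \<exists>Jd. ?P \<mu> (fst Jd) (snd Jd)"
  proof
    fix \<mu> assume "\<mu> \<in> ?A"
    then have \<mu>: "\<mu> \<in> PE" "\<alpha> \<mu> \<noteq> \<infinity>" by auto
    then obtain a where a: "\<alpha> \<mu> = ereal a" using real_valued by blast
    let ?U = "{\<nu> \<in> topspace weak_top. F \<nu> < F \<mu> + \<epsilon>} \<inter> {\<nu> \<in> PE. ereal (a - \<epsilon>) < \<alpha> \<nu>}"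
    have "openin weak_top ?U" using F openin_superlevel unfolding usc_on_def by blast
    moreover have "\<mu> \<in> ?U" using \<mu> \<epsilon> a by simp
    ultimately obtain J \<delta> where J: "finite J" "J \<subseteq> Cb" "0 < \<delta>"
      and U: "\<And>\<nu>. \<nu> \<in> PE \<Longrightarrow> (\<And>f. f \<in> J \<Longrightarrow> \<bar>(\<integral>x. f x \<partial>\<nu>) - (\<integral>x. f x \<partial>\<mu>)\<bar> < \<delta>) \<Longrightarrow> \<nu> \<in> ?U"
      by (rule weak_top_nbhd_base) blast
    have "?P \<mu> J \<delta>"
    proof (intro conjI J ballI impI)
      fix \<nu> assume "\<nu> \<in> PE" "\<forall>f\<in>J. \<bar>e f \<nu> - e f \<mu>\<bar> < \<delta>"
      then have "\<nu> \<in> ?U" by (intro U) (auto simp: e_def)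
      then show "F \<nu> < F \<mu> + \<epsilon>" "\<alpha> \<mu> < \<alpha> \<nu> + ereal \<epsilon>"
        by simp (cases "\<alpha> \<nu>"; use \<open>\<nu> \<in> ?U\<close> a in auto)
    qed
    then show "\<exists>Jd. ?P \<mu> (fst Jd) (snd Jd)" by (intro exI[of _ "(J, \<delta>)"]) simp
  qed
  from bchoice[OF this] obtain Jd where Jd: "\<And>\<mu>. \<mu> \<in> ?A \<Longrightarrow> ?P \<mu> (fst (Jd \<mu>)) (snd (Jd \<mu>))"
    by blast
  \<comment> \<open>Half radii leave room for \<open>\<nu>\<close>: within half a radius of some
    \<open>\<mu>\<close> in \<open>V t\<close>, it is within the full radius of
    \<open>t\<close>.\<close>
  define V where "V \<mu> = {\<nu> \<in> PE. \<forall>f\<in>fst (Jd \<mu>). \<bar>(\<integral>x. f x \<partial>\<nu>) - e f \<mu>\<bar> < snd (Jd \<mu>) / 2}" for \<mu>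
  have "\<exists>\<F>. finite \<F> \<and> \<F> \<subseteq> V ` ?A \<and> ?A \<subseteq> \<Union>\<F>"
  proof (rule compactinD[OF compact])
    fix U assume "U \<in> V ` ?A"
    then obtain t where "t \<in> ?A" "U = V t" by blast
    then show "openin weak_top U"
      using Jd[of t] openin_weak_top_ball[of "fst (Jd t)" "\<lambda>f. e f t" "snd (Jd t) / 2"] by (simp add: V_def)
  next
    show "?A \<subseteq> \<Union>(V ` ?A)"
    proof
      fix \<mu> assume \<mu>: "\<mu> \<in> ?A"
      then have "\<mu> \<in> V \<mu>" using Jd[OF \<mu>] by (auto simp: V_def e_def)
      with \<mu> show "\<mu> \<in> \<Union>(V ` ?A)" by blast
    qed
  qed
  then obtain \<F> where \<F>: "finite \<F>" "\<F> \<subseteq> V ` ?A" "?A \<subseteq> \<Union>\<F>" by blast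
  obtain T where T: "T \<subseteq> ?A" "finite T" "\<F> = V ` T" using finite_subset_image[OF \<F>(1,2)] by blast
  define J where "J = (\<Union>\<mu>\<in>T. fst (Jd \<mu>))"
  \<comment> \<open>\<open>insert 1\<close> keeps the minimum defined when there are no centres. In
    the far case \<open>K * \<delta>\<^sup>2\<close> has to cover \<open>b - s - c\<close>, the
    largest possible excess of \<open>F\<close> over \<open>s\<close> plus a value of
    \<open>\<alpha>\<close>; the summand 1 in \<open>K\<close> keeps it positive.\<close>
  define \<delta> where "\<delta> = Min (insert 1 ((\<lambda>\<mu>. snd (Jd \<mu>) / 2) ` T))"
  define K where "K = (\<bar>b - c - s\<bar> + 1) / \<delta>\<^sup>2"
  have JP: "?P \<mu> (fst (Jd \<mu>)) (snd (Jd \<mu>))" if "\<mu> \<in> T" for \<mu> using Jd T(1) that by blast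
  have J: "finite J" "J \<subseteq> Cb"
    unfolding J_def using T(2) JP by (simp, intro UN_least) simp
  have \<delta>0: "0 < \<delta>" unfolding \<delta>_def using T(2) JP by (subst Min_gr_iff) auto
  have \<delta>le: "\<delta> \<le> snd (Jd \<mu>) / 2" if "\<mu> \<in> T" for \<mu> unfolding \<delta>_def using T(2) that by (intro Min_le) auto
  have K0: "0 < K" unfolding K_def using \<delta>0 by simp
  have K\<delta>: "K * \<delta>\<^sup>2 = \<bar>b - c - s\<bar> + 1" unfolding K_def using \<delta>0 by simp
  show ?thesis
  proof (rule that[OF J K0])
    fix \<mu> \<nu> :: "'a measure" and a assume \<mu>: "\<mu> \<in> PE" and \<nu>: "\<nu> \<in> PE" and a: "\<alpha> \<mu> = ereal a"
    let ?S = "\<Sum>f\<in>J. ((\<integral>x. f x \<partial>\<mu>) - (\<integral>x. f x \<partial>\<nu>))\<^sup>2"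
    have S0: "0 \<le> K * ?S" using K0 by (intro mult_nonneg_nonneg sum_nonneg) auto
    have ca: "c \<le> a" using lower[OF \<mu>] a by simp
    show "F \<nu> \<le> s + 2 * \<epsilon> + a + K * ?S"
    proof (cases "\<mu> \<in> ?A")
      case False
      then have "b - s < a" using \<mu> a by auto
      then show ?thesis using b[OF \<nu>] S0 \<epsilon> by linarith
    next
      case True
      then obtain t where t: "t \<in> T" "\<mu> \<in> V t" using \<F>(3) T(3) by auto
      show ?thesis
      proof (cases "\<forall>f\<in>J. \<bar>e f \<nu> - e f \<mu>\<bar> < \<delta>")
        case near: True
        have t': "t \<in> PE" "\<alpha> t \<noteq> \<infinity>" using T(1) t(1) by auto
        obtain a' where a': "\<alpha> t = ereal a'" using real_valued[OF t'] by blast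
        have \<mu>t: "\<bar>e f \<mu> - e f t\<bar> < snd (Jd t) / 2" if "f \<in> fst (Jd t)" for f
          using t(2) that by (auto simp: V_def e_def)
        have "\<bar>e f \<nu> - e f t\<bar> < snd (Jd t)" if f: "f \<in> fst (Jd t)" for f
        proof -
          have "f \<in> J" using f t(1) by (auto simp: J_def)
          then have "\<bar>e f \<nu> - e f \<mu>\<bar> < snd (Jd t) / 2" using near \<delta>le[OF t(1)] by force
          then show ?thesis using \<mu>t[OF f] by linarith
        qed
        then have 1: "F \<nu> < F t + \<epsilon>" using JP[OF t(1)] \<nu> by blast
        have "\<bar>e f \<mu> - e f t\<bar> < snd (Jd t)" if f: "f \<in> fst (Jd t)" for f
          using \<mu>t[OF f] JP[OF t(1)] by linarith
        then have "\<alpha> t < \<alpha> \<mu> + ereal \<epsilon>" using JP[OF t(1)] \<mu> by blast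
        then have 2: "a' < a + \<epsilon>" by (simp add: a' a)
        have "F t - a' \<le> s" using s[OF t'(1)] by (simp add: a')
        then show ?thesis using 1 2 S0 by linarith
      next
        case far: False
        then obtain f where f: "f \<in> J" "\<delta> \<le> \<bar>e f \<nu> - e f \<mu>\<bar>" by (auto simp: not_less)
        then have "\<delta>\<^sup>2 \<le> \<bar>e f \<nu> - e f \<mu>\<bar>\<^sup>2" using \<delta>0 by (intro power_mono) auto
        also have "\<dots> = (e f \<mu> - e f \<nu>)\<^sup>2" by (simp add: power2_commute)
        also have "\<dots> \<le> ?S" unfolding e_def using f(1) J(1) by (intro member_le_sum) auto
        finally have "K * \<delta>\<^sup>2 \<le> K * ?S" using K0 by (intro mult_left_mono) auto
        then show ?thesis using K\<delta> b[OF \<nu>] ca \<epsilon> by linarith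
      qed
    qed
  qed
qed

text \<open>The leave-one-out average of the observables differs from the full one by \<open>O(1/n)\<close> and does
  not involve the coordinate \<open>k\<close>, so the \<open>k\<close>-th affine minorant, taken at the leave-one-out average,
  can be integrated against the conditional law of the \<open>k\<close>-th coordinate.\<close>

lemma rho_n_upper:
  assumes F: "usc_on weak_top F" and b: "\<And>\<mu>. \<mu> \<in> PE \<Longrightarrow> \<bar>F \<mu>\<bar> \<le> b"
    and s: "\<And>\<mu>. \<mu> \<in> PE \<Longrightarrow> ereal (F \<mu>) - \<alpha> \<mu> \<le> ereal s" and \<epsilon>: "0 < \<epsilon>"
  obtains Q where "\<And>n. 0 < n \<Longrightarrow>
    rho_n \<alpha> n (\<lambda>x. real n * F (emp n x)) \<le> ereal (real n * (s + 2 * \<epsilon>) + Q)"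
proof -
  obtain J K where J: "finite J" "J \<subseteq> Cb" and K: "0 < K"
    and pen: "\<And>\<mu> \<nu> a. \<mu> \<in> PE \<Longrightarrow> \<nu> \<in> PE \<Longrightarrow> \<alpha> \<mu> = ereal a \<Longrightarrow>
       F \<nu> \<le> s + 2 * \<epsilon> + a + K * (\<Sum>f\<in>J. ((\<integral>x. f x \<partial>\<mu>) - (\<integral>x. f x \<partial>\<nu>))\<^sup>2)"
    using usc_le_quadratic_penalty[OF F b s \<epsilon>] by blast
  show ?thesis
  proof (rule lipschitz_affine_minorants[OF J K])
    fix L :: real and l :: "(('a \<Rightarrow> real) \<Rightarrow> real) \<Rightarrow> ('a \<Rightarrow> real) \<Rightarrow> real" and r
    assume L: "0 \<le> L"
      and minorant: "\<And>z \<mu>. \<mu> \<in> PE \<Longrightarrow> ereal ((\<Sum>f\<in>J. l z f * (\<integral>x. f x \<partial>\<mu>)) - r z) \<le> \<alpha> \<mu>"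
      and touch: "\<And>z. \<exists>\<mu>\<in>PE. \<exists>a. \<alpha> \<mu> = ereal a \<and>
         a + K * (\<Sum>f\<in>J. ((\<integral>x. f x \<partial>\<mu>) - z f)\<^sup>2) \<le> (\<Sum>f\<in>J. l z f * z f) - r z"
      and l_lip: "\<And>z z' f. f \<in> J \<Longrightarrow> \<bar>l z f - l z' f\<bar> \<le> L * (\<Sum>f\<in>J. \<bar>z f - z' f\<bar>)"
      and r_lip: "\<And>z z'. \<bar>r z - r z'\<bar> \<le> L * (\<Sum>f\<in>J. \<bar>z f - z' f\<bar>)"
    obtain B where B: "0 < B" "\<And>f x. f \<in> J \<Longrightarrow> \<bar>f x\<bar> \<le> B" using finite_Cb_bounded[OF J] by blast
    \<comment> \<open>Integrating \<open>H w\<close> against a law evaluates the minorant with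
      parameter \<open>w\<close> there, so the result is at most \<open>\<alpha>\<close> of that
      law. Keeping \<open>w\<close> and \<open>y\<close> apart allows the parameter to be replaced
      without moving the coordinate.\<close>
    define H where "H w y = (\<Sum>f\<in>J. l w f * f y) - r w" for w y
    \<comment> \<open>\<open>Q0\<close> is a Lipschitz constant of \<open>H\<close> in its
      parameter: \<open>card J\<close> slopes weighted by values up to \<open>B\<close>, and one
      share for \<open>r\<close>. Dropping a coordinate moves the parameter by at most
      \<open>card J * B / n\<close>, so \<open>n\<close> replacements cost at most
      \<open>Q\<close>.\<close>
    define Q0 where "Q0 = (real (card J) * B + 1) * L"
    define Q where "Q = Q0 * (real (card J) * B)"
    \<comment> \<open>A bound for \<open>H\<close> when the parameter is an average of observables,
      found by comparison with the parameter 0; it serves integrability.\<close>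
    define cH where "cH = (\<Sum>f\<in>J. \<bar>l (\<lambda>_. 0) f\<bar> * B) + \<bar>r (\<lambda>_. 0)\<bar> + Q"
    have Q0: "0 \<le> Q0" unfolding Q0_def using L B(1) by simp
    have H_lip: "\<bar>H w y - H w' y\<bar> \<le> Q0 * (\<Sum>f\<in>J. \<bar>w f - w' f\<bar>)" for w w' y
    proof -
      let ?D = "\<Sum>f\<in>J. \<bar>w f - w' f\<bar>"
      have "H w y - H w' y = (\<Sum>f\<in>J. (l w f - l w' f) * f y) - (r w - r w')"
        by (simp add: H_def left_diff_distrib sum_subtractf)
      then have "\<bar>H w y - H w' y\<bar> \<le> \<bar>\<Sum>f\<in>J. (l w f - l w' f) * f y\<bar> + \<bar>r w - r w'\<bar>" by linarith
      also have "\<bar>\<Sum>f\<in>J. (l w f - l w' f) * f y\<bar> \<le> (\<Sum>f\<in>J. L * ?D * B)"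
        using l_lip B L by (intro order_trans[OF sum_abs] sum_mono)
          (auto simp: abs_mult intro!: mult_mono mult_nonneg_nonneg sum_nonneg)
      finally show ?thesis using r_lip[of w w'] by (simp add: Q0_def algebra_simps)
    qed
    have H_bnd: "\<bar>H w y\<bar> \<le> cH" if w: "\<And>f. f \<in> J \<Longrightarrow> \<bar>w f\<bar> \<le> B" for w y
    proof -
      have "(\<Sum>f\<in>J. \<bar>w f - 0\<bar>) \<le> real (card J) * B"
        using sum_bounded_above[of J "\<lambda>f. \<bar>w f - 0\<bar>" B] w by simp
      then have "\<bar>H w y - H (\<lambda>_. 0) y\<bar> \<le> Q"
        unfolding Q_def using H_lip[of w y "\<lambda>_. 0"] mult_left_mono[OF _ Q0] by (meson order_trans)
      moreover have "\<bar>\<Sum>f\<in>J. l (\<lambda>_. 0) f * f y\<bar> \<le> (\<Sum>f\<in>J. \<bar>l (\<lambda>_. 0) f\<bar> * B)"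
        using B by (intro order_trans[OF sum_abs] sum_mono) (auto simp: abs_mult intro!: mult_left_mono)
      ultimately show ?thesis unfolding cH_def by (auto simp: H_def[of "\<lambda>_. 0"])
    qed
    show ?thesis
    proof (rule that[of Q])
      fix n :: nat assume n: "0 < n"
      define z where "z x f = (\<Sum>i<n. f (x i)) / real n" for x :: "nat \<Rightarrow> 'a" and f :: "'a \<Rightarrow> real"
      \<comment> \<open>Division is by \<open>n\<close>, not by \<open>n - 1\<close>, so that the
        difference to \<open>z x f\<close> is exactly \<open>f (x k) / real n\<close>.\<close>
      define zk where "zk k x f = (\<Sum>i\<in>{..<n} - {k}. f (x i)) / real n" for k and x :: "nat \<Rightarrow> 'a" and f :: "'a \<Rightarrow> real"
      have zk_bnd: "\<bar>zk k x f\<bar> \<le> B" if f: "f \<in> J" for k x f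
      proof -
        have "\<bar>\<Sum>i\<in>{..<n} - {k}. f (x i)\<bar> \<le> (\<Sum>i\<in>{..<n} - {k}. B)"
          using B(2)[OF f] by (intro order_trans[OF sum_abs] sum_mono) auto
        also have "\<dots> \<le> real n * B"
          using B(1) card_mono[of "{..<n}" "{..<n} - {k}"] by (auto intro!: mult_right_mono)
        finally show ?thesis using n by (simp add: zk_def field_simps)
      qed
      have zk_z: "(\<Sum>f\<in>J. \<bar>z x f - zk k x f\<bar>) \<le> real (card J) * B / real n" if k: "k < n" for k x
      proof -
        have "\<bar>z x f - zk k x f\<bar> \<le> B / real n" if f: "f \<in> J" for f
        proof -
          have "(\<Sum>i<n. f (x i)) = f (x k) + (\<Sum>i\<in>{..<n} - {k}. f (x i))"
            using k by (intro sum.remove) auto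
          then have "z x f - zk k x f = f (x k) / real n" by (simp add: z_def zk_def add_divide_distrib)
          then show ?thesis using B(2)[OF f, of "x k"] n by (simp add: divide_right_mono)
        qed
        from sum_bounded_above[of J, OF this] show ?thesis by simp
      qed
      have cf: "continuous_on UNIV (\<lambda>x. f (x i))" if "f \<in> J" for f :: "'a \<Rightarrow> real" and i :: nat
        using that J continuous_on_compose2[OF _ continuous_on_product_coordinates[of i], of UNIV f]
        by (auto simp: Cb_def)
      have H_meas: "(\<lambda>x. H (zk k x) (x k)) \<in> borel_measurable (En n)" for k
      proof (rule borel_measurable_En, rule borel_measurable_continuous_onI)
        have czk: "continuous_on UNIV (\<lambda>x. zk k x f)" if "f \<in> J" for f
          unfolding zk_def using n by (intro continuous_intros cf that) auto
        have "continuous_on UNIV (\<lambda>x. l (zk k x) f)" if f: "f \<in> J" for f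
          by (rule continuous_on_lipschitz_sum[where u="\<lambda>f x. zk k x f"]) (rule l_lip[OF f], rule czk)
        moreover have "continuous_on UNIV (\<lambda>x. r (zk k x))"
          by (rule continuous_on_lipschitz_sum[where u="\<lambda>f x. zk k x f"]) (rule r_lip, rule czk)
        ultimately show "continuous_on UNIV (\<lambda>x. H (zk k x) (x k))"
          unfolding H_def by (intro continuous_intros cf) auto
      qed
      have pointwise: "real n * F (emp n x) \<le> real n * (s + 2 * \<epsilon>) + (\<Sum>k<n. H (zk k x) (x k)) + Q" for x
      proof -
        have ze: "(\<integral>y. f y \<partial>emp n x) = z x f" if "f \<in> J" for f
          unfolding z_def using that J n by (intro integral_emp Cb_measurable) auto
        obtain \<mu> a where \<mu>: "\<mu> \<in> PE" "\<alpha> \<mu> = ereal a"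
          "a + K * (\<Sum>f\<in>J. ((\<integral>x. f x \<partial>\<mu>) - z x f)\<^sup>2) \<le> (\<Sum>f\<in>J. l (z x) f * z x f) - r (z x)"
          using touch by blast
        have "F (emp n x) \<le> s + 2 * \<epsilon> + a + K * (\<Sum>f\<in>J. ((\<integral>x. f x \<partial>\<mu>) - z x f)\<^sup>2)"
          using pen[OF \<mu>(1) emp_PE[OF n] \<mu>(2), of x] by (simp add: ze cong: sum.cong)
        also have "\<dots> \<le> s + 2 * \<epsilon> + ((\<Sum>f\<in>J. l (z x) f * z x f) - r (z x))" using \<mu>(3) by simp
        finally have "real n * F (emp n x) \<le> real n * (s + 2 * \<epsilon> + ((\<Sum>f\<in>J. l (z x) f * z x f) - r (z x)))"
          by (intro mult_left_mono) auto
        also have "\<dots> = real n * (s + 2 * \<epsilon>) + ((\<Sum>f\<in>J. l (z x) f * (real n * z x f)) - real n * r (z x))"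
          by (simp add: algebra_simps sum_distrib_left)
        \<comment> \<open>\<open>z x\<close> is the mean of the observables over the sample, so
          \<open>n\<close> times the affine function at \<open>z x\<close> is a sum over the
          coordinates.\<close>
        also have "(\<Sum>f\<in>J. l (z x) f * (real n * z x f)) - real n * r (z x) = (\<Sum>k<n. H (z x) (x k))"
        proof -
          have "real n * z x f = (\<Sum>k<n. f (x k))" for f using n by (simp add: z_def)
          then have "(\<Sum>f\<in>J. l (z x) f * (real n * z x f)) = (\<Sum>f\<in>J. \<Sum>k<n. l (z x) f * f (x k))"
            by (simp add: sum_distrib_left)
          also have "\<dots> = (\<Sum>k<n. \<Sum>f\<in>J. l (z x) f * f (x k))" by (rule sum.swap)
          finally show ?thesis by (simp add: H_def sum_subtractf)
        qed
        also have "\<dots> \<le> (\<Sum>k<n. H (zk k x) (x k) + Q / real n)"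
        proof (rule sum_mono)
          fix k assume "k \<in> {..<n}"
          then have k: "k < n" by simp
          have "H (z x) (x k) - H (zk k x) (x k) \<le> Q0 * (\<Sum>f\<in>J. \<bar>z x f - zk k x f\<bar>)"
            using H_lip[of "z x" "x k" "zk k x"] by linarith
          also have "\<dots> \<le> Q0 * (real (card J) * B / real n)" by (rule mult_left_mono[OF zk_z[OF k] Q0])
          finally show "H (z x) (x k) \<le> H (zk k x) (x k) + Q / real n" by (simp add: Q_def)
        qed
        also have "\<dots> = (\<Sum>k<n. H (zk k x) (x k)) + Q" using n by (simp add: sum.distrib)
        finally show ?thesis by simp
      qed
      show "rho_n \<alpha> n (\<lambda>x. real n * F (emp n x)) \<le> ereal (real n * (s + 2 * \<epsilon>) + Q)"
        unfolding rho_n_def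
      proof (rule SUP_least)
        fix \<nu> :: "(nat \<Rightarrow> 'a) measure" assume \<nu>: "\<nu> \<in> space (prob_algebra (En n))"
        then have sets: "sets \<nu> = sets (En n)" by (simp add: space_prob_algebra)
        interpret \<nu>: prob_space \<nu> using \<nu> by (simp add: space_prob_algebra)
        note [measurable_cong] = sets
        define a where "a k = (\<integral>x. H (zk k x) (x k) \<partial>\<nu>)" for k
        have H_int: "integrable \<nu> (\<lambda>x. H (zk k x) (x k))" for k
          using H_meas[of k] H_bnd[OF zk_bnd] by (intro \<nu>.integrable_const_bound[of _ cH]) auto
        have F_int: "integrable \<nu> (\<lambda>x. real n * F (emp n x))"
          using usc_on_emp_measurable[OF F n] b[OF emp_PE[OF n]]
          by (intro \<nu>.integrable_const_bound[of _ "real n * b"]) (auto simp: abs_mult mult_left_mono)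
        have "(\<integral>x. real n * F (emp n x) \<partial>\<nu>) \<le> (\<integral>x. real n * (s + 2 * \<epsilon>) + (\<Sum>k<n. H (zk k x) (x k)) + Q \<partial>\<nu>)"
          using pointwise by (intro integral_mono F_int Bochner_Integration.integrable_add Bochner_Integration.integrable_sum H_int) auto
        also have "\<dots> = real n * (s + 2 * \<epsilon>) + (\<Sum>k<n. a k) + Q"
          using H_int by (simp add: a_def \<nu>.prob_space)
        finally have upper: "(\<integral>x. real n * F (emp n x) \<partial>\<nu>) \<le> real n * (s + 2 * \<epsilon>) + (\<Sum>k<n. a k) + Q" .
        have a_le: "ereal (a k) \<le> ereal_integral \<nu> (\<lambda>x. \<alpha> (cond_kernel n k \<nu> (proj_k n k x)))" if k: "k < n" for k
        proof -
          let ?K = "cond_kernel n k \<nu>"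
          note ck = is_cond_kernel_cond_kernel[OF \<nu> k]
          let ?\<phi> = "\<lambda>x. \<integral>y. H (zk k ((proj_k n k x)(k := y))) (((proj_k n k x)(k := y)) k) \<partial>?K (proj_k n k x)"
          \<comment> \<open>Resampling coordinate \<open>k\<close> leaves the parameter unchanged,
            so under the kernel a fixed affine minorant is integrated.\<close>
          have zk_upd: "zk k (y(k := t)) = zk k y" for y t by (auto simp: zk_def fun_eq_iff)
          have KPE: "?K (proj_k n k x) \<in> PE" if "x \<in> space \<nu>" for x
          proof -
            have "?K \<in> measurable (Enk n k) (prob_algebra borel)" using ck by (simp add: is_cond_kernel_def)
            moreover have "proj_k n k x \<in> space (Enk n k)"
              by (rule measurable_space[OF measurable_proj_k]) (use that sets_eq_imp_space_eq[OF sets] in simp)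
            ultimately show ?thesis unfolding PE_def by (rule measurable_space)
          qed
          have H_y: "H w \<in> borel_measurable borel" for w
            unfolding H_def using J by (intro borel_measurable_diff borel_measurable_sum borel_measurable_times borel_measurable_const Cb_measurable) auto
          have "a k = (\<integral>x. ?\<phi> x \<partial>\<nu>)"
            unfolding a_def by (rule is_cond_kernel_integral(1)[OF \<nu> k ck H_meas H_bnd[OF zk_bnd]])
          moreover have "ereal (\<integral>x. ?\<phi> x \<partial>\<nu>) \<le> ereal_integral \<nu> (\<lambda>x. \<alpha> (?K (proj_k n k x)))"
          proof (rule ereal_integral_ge)
            have "\<bar>?\<phi> x\<bar> \<le> cH" if "x \<in> space \<nu>" for x
              using abs_integral_le_PE[OF H_y H_bnd[OF zk_bnd] KPE[OF that]] by (simp add: zk_upd)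
            then show "integrable \<nu> ?\<phi>"
              using is_cond_kernel_integral(2)[OF \<nu> k ck H_meas[of k] H_bnd[OF zk_bnd]]
              by (intro \<nu>.integrable_const_bound[of _ cH] AE_I2) (simp_all only: real_norm_def)
            fix x assume x: "x \<in> space \<nu>"
            interpret K: prob_space "?K (proj_k n k x)" using KPE[OF x] by (simp add: PE_iff)
            have "?\<phi> x = (\<integral>y. (\<Sum>f\<in>J. l (zk k (proj_k n k x)) f * f y) - r (zk k (proj_k n k x)) \<partial>?K (proj_k n k x))"
              by (simp add: zk_upd H_def)
            also have "\<dots> = (\<Sum>f\<in>J. l (zk k (proj_k n k x)) f * (\<integral>y. f y \<partial>?K (proj_k n k x))) - r (zk k (proj_k n k x))"
              using Cb_integrable[OF _ KPE[OF x]] J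
              by (subst Bochner_Integration.integral_diff) (auto simp: K.prob_space subset_iff)
            finally show "ereal (?\<phi> x) \<le> \<alpha> (?K (proj_k n k x))"
              using minorant[OF KPE[OF x], of "zk k (proj_k n k x)"] by simp
          qed
          ultimately show ?thesis by simp
        qed
        have "ereal (\<Sum>k<n. a k) \<le> alpha_n \<alpha> n \<nu>"
          unfolding alpha_n_def sum_ereal[symmetric] by (intro sum_mono a_le) simp
        then have "ereal (\<integral>x. real n * F (emp n x) \<partial>\<nu>) - alpha_n \<alpha> n \<nu>
            \<le> ereal (real n * (s + 2 * \<epsilon>) + (\<Sum>k<n. a k) + Q) - ereal (\<Sum>k<n. a k)"
          using upper by (intro ereal_minus_mono) auto
        then show "ereal (\<integral>x. real n * F (emp n x) \<partial>\<nu>) - alpha_n \<alpha> n \<nu> \<le> ereal (real n * (s + 2 * \<epsilon>) + Q)"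
          by simp
      qed
    qed
  qed
qed

end

section \<open>Lower bound\<close>

text \<open>Countability lets almost sure equality on each generator be merged into one null set.
  Finite intersections of a countable base remain countable, and the empty intersection supplies
  \<open>UNIV\<close>.\<close>

lemma countable_Int_stable_borel_generator:
  obtains G :: "'a::second_countable_topology set set"
  where "countable G" "Int_stable G" "UNIV \<in> G" "G \<subseteq> sets borel" "sets borel = sigma_sets UNIV G"
proof -
  obtain B :: "'a set set" where B: "countable B" "topological_basis B"
    using ex_countable_basis by blast
  define G where "G = Inter ` {S. finite S \<and> S \<subseteq> B}"
  have sB: "sets (borel :: 'a measure) = sigma_sets UNIV B"
    by (subst borel_eq_countable_basis[OF B]) simp
  have GB: "G \<subseteq> sets borel"
  proof
    fix X assume "X \<in> G"
    then obtain S where S: "finite S" "S \<subseteq> B" "X = \<Inter>S" by (auto simp: G_def)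
    then have "open X" using topological_basis_open[OF B(2)] by (auto intro!: open_Inter)
    then show "X \<in> sets borel" by simp
  qed
  show ?thesis
  proof (rule that[of G])
    show "countable G" unfolding G_def using B(1) by (intro countable_image countable_Collect_finite_subset)
    show "Int_stable G"
      unfolding Int_stable_def
    proof (intro ballI)
      fix a b assume "a \<in> G" "b \<in> G"
      then obtain S T where "finite S" "S \<subseteq> B" "a = \<Inter>S" "finite T" "T \<subseteq> B" "b = \<Inter>T" by (auto simp: G_def)
      then show "a \<inter> b \<in> G" unfolding G_def by (intro image_eqI[of _ _ "S \<union> T"]) auto
    qed
    show "UNIV \<in> G" unfolding G_def by (intro image_eqI[of _ _ "{}"]) auto
    show "G \<subseteq> sets borel" by (rule GB)
    have "B \<subseteq> G"
    proof
      fix X assume "X \<in> B" then show "X \<in> G" unfolding G_def by (intro image_eqI[of _ _ "{X}"]) auto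
    qed
    then show "sets borel = sigma_sets UNIV G"
      unfolding sB using GB by (intro sigma_sets_eqI) (auto simp: sB)
  qed
qed

text \<open>\<open>cond_kernel\<close> is an unspecified choice; this lemma lets it be replaced,
  almost surely, by any kernel known explicitly.\<close>

lemma is_cond_kernel_unique:
  fixes \<nu> :: "(nat \<Rightarrow> 'a::second_countable_topology) measure"
  assumes \<nu>: "\<nu> \<in> space (prob_algebra (En n))" and k: "k < n"
    and K: "is_cond_kernel n k \<nu> K" and K': "is_cond_kernel n k \<nu> K'"
  shows "AE x in \<nu>. K (proj_k n k x) = K' (proj_k n k x)"
proof -
  let ?\<eta> = "distr \<nu> (Enk n k) (proj_k n k)"
  have sets: "sets \<nu> = sets (En n)" and p: "prob_space \<nu>" using \<nu> by (auto simp: space_prob_algebra)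
  note [measurable_cong] = sets
  have Y: "proj_k n k \<in> measurable \<nu> (Enk n k)" by measurable
  interpret \<eta>: prob_space ?\<eta> by (rule prob_space.prob_space_distr[OF p Y])
  obtain G :: "'a set set" where G: "countable G" "Int_stable G" "UNIV \<in> G" "G \<subseteq> sets borel" "sets borel = sigma_sets UNIV G"
    using countable_Int_stable_borel_generator by blast
  \<comment> \<open>Restricting coordinate \<open>k\<close> to \<open>B\<close> and the others to
    \<open>C\<close> shows that \<open>emeasure (K y) B\<close>, as a function of \<open>y\<close>,
    is a density with respect to \<open>?\<eta>\<close> of a measure that does not involve
    \<open>K\<close>.\<close>
  have rect: "(\<integral>\<^sup>+y. emeasure (K y) B * indicator C y \<partial>?\<eta>)
      = emeasure \<nu> {x \<in> space (En n). proj_k n k x \<in> C \<and> x k \<in> B}"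
    if K: "is_cond_kernel n k \<nu> K" and B: "B \<in> sets borel" and C: "C \<in> sets (Enk n k)" for K B C
  proof -
    have X: "(\<lambda>x. x k) \<in> borel_measurable (En n)"
      unfolding En_def by (rule measurable_component_singleton) (simp add: k)
    let ?A = "{x \<in> space (En n). proj_k n k x \<in> C \<and> x k \<in> B}"
    have "(proj_k n k -` C \<inter> space (En n)) \<inter> ((\<lambda>x. x k) -` B \<inter> space (En n)) \<in> sets (En n)"
      by (intro sets.Int measurable_sets[OF measurable_proj_k C] measurable_sets[OF X B])
    also have "(proj_k n k -` C \<inter> space (En n)) \<inter> ((\<lambda>x. x k) -` B \<inter> space (En n)) = ?A" by auto
    finally have "emeasure \<nu> ?A = (\<integral>\<^sup>+y. emeasure (K y) {z. y(k := z) \<in> ?A} \<partial>?\<eta>)"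
      using K by (simp add: is_cond_kernel_def)
    also have "\<dots> = (\<integral>\<^sup>+y. emeasure (K y) B * indicator C y \<partial>?\<eta>)"
    proof (intro nn_integral_cong)
      fix y assume "y \<in> space ?\<eta>"
      then have y: "y \<in> space (Enk n k)" by simp
      have "y(k := z) \<in> space (En n)" for z
        using measurable_space[OF measurable_fun_upd_Enk[OF k], of "(y, z)"] y by (simp add: space_pair_measure)
      then have "{z. y(k := z) \<in> ?A} = (if y \<in> C then B else {})" by (auto simp: proj_k_fun_upd[OF y])
      then show "emeasure (K y) {z. y(k := z) \<in> ?A} = emeasure (K y) B * indicator C y" by simp
    qed
    finally show ?thesis by simp
  qed
  have Km: "(\<lambda>y. emeasure (K y) B) \<in> borel_measurable (Enk n k)"
    if K: "is_cond_kernel n k \<nu> K" and B: "B \<in> sets borel" for K B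
    using K unfolding is_cond_kernel_def
    by (intro measurable_compose[OF measurable_prob_algebraD measurable_emeasure_subprob_algebra[OF B]]) auto
  have sK: "K y \<in> PE" if "is_cond_kernel n k \<nu> K" "y \<in> space (Enk n k)" for K y
    using that measurable_space[of K "Enk n k" "prob_algebra borel" y] by (simp add: is_cond_kernel_def PE_def)
  have "AE y in ?\<eta>. \<forall>B\<in>G. emeasure (K y) B = emeasure (K' y) B"
  proof (subst AE_ball_countable[OF G(1)], intro ballI \<eta>.density_unique2)
    fix B assume "B \<in> G"
    then have B: "B \<in> sets borel" using G(4) by auto
    show "(\<lambda>y. emeasure (K y) B) \<in> borel_measurable ?\<eta>" "(\<lambda>y. emeasure (K' y) B) \<in> borel_measurable ?\<eta>"
      using Km[OF K B] Km[OF K' B] by auto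
    fix C assume "C \<in> sets ?\<eta>"
    then show "(\<integral>\<^sup>+y. emeasure (K y) B * indicator C y \<partial>?\<eta>) = (\<integral>\<^sup>+y. emeasure (K' y) B * indicator C y \<partial>?\<eta>)"
      by (simp add: rect[OF K B] rect[OF K' B])
  qed
  moreover have "AE y in ?\<eta>. y \<in> space (Enk n k)" using AE_space[of ?\<eta>] by simp
  ultimately have "AE y in ?\<eta>. K y = K' y"
  proof eventually_elim
    case (elim y)
    show ?case
    proof (rule measure_eqI_generator_eq_countable[where E=G and \<Omega>=UNIV and A="{UNIV}"])
      show "sets (K y) = sigma_sets UNIV G" "sets (K' y) = sigma_sets UNIV G"
        using sK[OF K elim(2)] sK[OF K' elim(2)] by (auto simp: PE_iff G(5))
      show "emeasure (K y) a \<noteq> \<infinity>" if "a \<in> {UNIV}" for a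
        using sK[OF K elim(2)] by (auto simp: PE_iff intro!: finite_measure.emeasure_finite prob_space.finite_measure)
    qed (use G elim in auto)
  qed
  then show ?thesis by (rule AE_distrD[OF Y])
qed

text \<open>Fubini's theorem with coordinate \<open>k\<close> integrated innermost.\<close>

lemma product_cond_kernel:
  fixes \<mu> :: "'a::second_countable_topology measure"
  assumes \<mu>: "\<mu> \<in> PE"
  shows "PiM {..<n} (\<lambda>_. \<mu>) \<in> space (prob_algebra (En n))"
    and "k < n \<Longrightarrow> is_cond_kernel n k (PiM {..<n} (\<lambda>_. \<mu>)) (\<lambda>_. \<mu>)"
proof -
  have sm: "sets \<mu> = sets borel" and p: "prob_space \<mu>" using \<mu> by (auto simp: PE_iff)
  interpret P: product_prob_space "\<lambda>_::nat. \<mu>" "{..<n}"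
    by (intro product_prob_spaceI p)
  have s: "sets (PiM I (\<lambda>_. \<mu>)) = sets (PiM I (\<lambda>_. borel))" for I :: "nat set"
    using sm by (intro sets_PiM_cong) auto
  show "PiM {..<n} (\<lambda>_. \<mu>) \<in> space (prob_algebra (En n))"
    unfolding space_prob_algebra En_def using s by (auto intro: prob_space_PiM p)
  assume k: "k < n"
  let ?I = "{..<n} - {k}"
  have ins: "insert k ?I = {..<n}" using k by auto
  have "distr (PiM {..<n} (\<lambda>_. \<mu>)) (Enk n k) (proj_k n k) = distr (PiM {..<n} (\<lambda>_. \<mu>)) (PiM ?I (\<lambda>_. \<mu>)) (\<lambda>x. restrict x ?I)"
    by (rule distr_cong) (auto simp: Enk_def s proj_k_def)
  also have "\<dots> = PiM ?I (\<lambda>_. \<mu>)" by (rule P.distr_PiM_restrict_finite) auto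
  finally have d: "distr (PiM {..<n} (\<lambda>_. \<mu>)) (Enk n k) (proj_k n k) = PiM ?I (\<lambda>_. \<mu>)" .
  show "is_cond_kernel n k (PiM {..<n} (\<lambda>_. \<mu>)) (\<lambda>_. \<mu>)"
    unfolding is_cond_kernel_def d
  proof (intro conjI ballI)
    show "(\<lambda>_. \<mu>) \<in> measurable (Enk n k) (prob_algebra borel)"
      using \<mu> by (intro measurable_const) (simp add: PE_def)
    fix A assume A: "A \<in> sets (En n :: (nat \<Rightarrow> 'a) measure)"
    then have A': "A \<in> sets (PiM {..<n} (\<lambda>_. \<mu>))" by (simp add: s En_def)
    have "emeasure (PiM {..<n} (\<lambda>_. \<mu>)) A = (\<integral>\<^sup>+x. indicator A x \<partial>PiM (insert k ?I) (\<lambda>_. \<mu>))"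
      by (simp only: ins nn_integral_indicator[OF A'])
    also have "\<dots> = (\<integral>\<^sup>+y. (\<integral>\<^sup>+z. indicator A (y(k := z)) \<partial>\<mu>) \<partial>PiM ?I (\<lambda>_. \<mu>))"
      by (rule P.product_nn_integral_insert) (simp, simp, simp only: ins, rule borel_measurable_indicator[OF A'])
    also have "\<dots> = (\<integral>\<^sup>+y. emeasure \<mu> {z. y(k := z) \<in> A} \<partial>PiM ?I (\<lambda>_. \<mu>))"
    proof (intro nn_integral_cong)
      fix y assume "y \<in> space (PiM ?I (\<lambda>_. \<mu>))"
      then have y: "y \<in> space (Enk n k)" by (simp add: Enk_def sets_eq_imp_space_eq[OF s])
      have "(\<lambda>z. y(k := z)) \<in> measurable borel (En n)"
        using measurable_compose[OF measurable_Pair1'[OF y] measurable_fun_upd_Enk[OF k]] by simp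
      from measurable_sets[OF this A] have S: "{z. y(k := z) \<in> A} \<in> sets \<mu>" by (simp add: sm vimage_def)
      have "(\<integral>\<^sup>+z. indicator A (y(k := z)) \<partial>\<mu>) = (\<integral>\<^sup>+z. indicator {z. y(k := z) \<in> A} z \<partial>\<mu>)"
        by (intro nn_integral_cong) (auto split: split_indicator)
      then show "(\<integral>\<^sup>+z. indicator A (y(k := z)) \<partial>\<mu>) = emeasure \<mu> {z. y(k := z) \<in> A}"
        by (simp only: nn_integral_indicator[OF S])
    qed
    finally show "emeasure (PiM {..<n} (\<lambda>_. \<mu>)) A = (\<integral>\<^sup>+y. emeasure \<mu> {z. y(k := z) \<in> A} \<partial>PiM ?I (\<lambda>_. \<mu>))" .
  qed
qed

text \<open>By uniqueness the chosen kernel is almost surely \<open>\<mu>\<close>, so each summand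
  integrates the constant \<open>a\<close> against a probability measure.\<close>

lemma alpha_n_product:
  fixes \<mu> :: "'a::second_countable_topology measure"
  assumes \<mu>: "\<mu> \<in> PE" and a: "\<alpha> \<mu> = ereal a"
  shows "alpha_n \<alpha> n (PiM {..<n} (\<lambda>_. \<mu>)) = ereal (real n * a)"
proof -
  let ?\<nu> = "PiM {..<n} (\<lambda>_. \<mu>)"
  note \<nu> = product_cond_kernel(1)[OF \<mu>, of n]
  interpret prob_space ?\<nu> using \<nu> by (simp add: space_prob_algebra)
  have e: "e2ennreal (ereal r) = ennreal r" for r by (simp add: e2ennreal_def ennreal_def)
  have "ereal_integral ?\<nu> (\<lambda>x. \<alpha> (cond_kernel n k ?\<nu> (proj_k n k x))) = ereal a" if k: "k < n" for k
  proof -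
    have "is_cond_kernel n k ?\<nu> (cond_kernel n k ?\<nu>)"
      unfolding cond_kernel_def by (rule someI[of "is_cond_kernel n k ?\<nu>"]) (rule product_cond_kernel(2)[OF \<mu> k])
    from is_cond_kernel_unique[OF \<nu> k this product_cond_kernel(2)[OF \<mu> k]]
    have AE: "AE x in ?\<nu>. \<alpha> (cond_kernel n k ?\<nu> (proj_k n k x)) = ereal a"
      by eventually_elim (simp add: a)
    have "(\<integral>\<^sup>+x. e2ennreal (\<alpha> (cond_kernel n k ?\<nu> (proj_k n k x))) \<partial>?\<nu>) = (\<integral>\<^sup>+x. ennreal a \<partial>?\<nu>)"
      using AE by (intro nn_integral_cong_AE) (auto elim!: eventually_mono simp: e)
    moreover have "(\<integral>\<^sup>+x. e2ennreal (- \<alpha> (cond_kernel n k ?\<nu> (proj_k n k x))) \<partial>?\<nu>) = (\<integral>\<^sup>+x. ennreal (- a) \<partial>?\<nu>)"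
      using AE by (intro nn_integral_cong_AE) (auto elim!: eventually_mono simp: e)
    ultimately show ?thesis
      by (cases "0 \<le> a") (auto simp: ereal_integral_def emeasure_space_1 ennreal_neg enn2ereal_ennreal zero_ennreal.rep_eq zero_ereal_def)
  qed
  then have "alpha_n \<alpha> n ?\<nu> = (\<Sum>k<n. ereal a)"
    unfolding alpha_n_def by (intro sum.cong) auto
  then show ?thesis by simp
qed

text \<open>Mixed terms vanish: integrating coordinate \<open>j\<close> innermost, under the
  constant kernel \<open>\<mu>\<close>, meets a factor of mean 0. The \<open>n\<close> diagonal
  terms are at most \<open>B\<^sup>2\<close> each.\<close>

lemma product_variance:
  fixes \<mu> :: "'a::second_countable_topology measure"
  assumes \<mu>: "\<mu> \<in> PE" and g: "g \<in> Cb" and B: "\<And>x. \<bar>g x\<bar> \<le> B" and g0: "(\<integral>x. g x \<partial>\<mu>) = 0"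
  shows "(\<integral>x. (\<Sum>i<n. g (x i))\<^sup>2 \<partial>PiM {..<n} (\<lambda>_. \<mu>)) \<le> real n * B\<^sup>2"
    and "integrable (PiM {..<n} (\<lambda>_. \<mu>)) (\<lambda>x. (\<Sum>i<n. g (x i))\<^sup>2)"
proof -
  let ?\<nu> = "PiM {..<n} (\<lambda>_. \<mu>)"
  note \<nu> = product_cond_kernel(1)[OF \<mu>, of n]
  have sets: "sets ?\<nu> = sets (En n)" using \<nu> by (simp add: space_prob_algebra)
  interpret prob_space ?\<nu> using \<nu> by (simp add: space_prob_algebra)
  have B0: "0 \<le> B" using B[of undefined] by linarith
  have gm: "(\<lambda>x. g (x i) * g (x j)) \<in> borel_measurable (En n)" for i j
  proof (rule borel_measurable_En, rule borel_measurable_continuous_onI)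
    have c: "continuous_on UNIV (\<lambda>x. g (x i))" for i :: nat
      using g continuous_on_compose2[OF _ continuous_on_product_coordinates[of i], of UNIV g]
      by (auto simp: Cb_def)
    show "continuous_on UNIV (\<lambda>x. g (x i) * g (x j))" by (intro continuous_on_mult c)
  qed
  have gb: "\<bar>g (x i) * g (x j)\<bar> \<le> B\<^sup>2" for x i j
    unfolding abs_mult power2_eq_square by (intro mult_mono B B0) auto
  have int: "integrable ?\<nu> (\<lambda>x. g (x i) * g (x j))" for i j
  proof (rule integrable_const_bound[OF AE_I2])
    show "(\<lambda>x. g (x i) * g (x j)) \<in> borel_measurable ?\<nu>"
      using gm by (simp add: measurable_cong_sets[OF sets refl])
    show "norm (g (x i) * g (x j)) \<le> B\<^sup>2" for x
      unfolding real_norm_def by (rule gb)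
  qed
  have off: "(\<integral>x. g (x i) * g (x j) \<partial>?\<nu>) = 0" if "i \<noteq> j" "j < n" for i j
  proof -
    have "(\<integral>x. g (x i) * g (x j) \<partial>?\<nu>) =
      (\<integral>x. (\<integral>z. g (((proj_k n j x)(j := z)) i) * g (((proj_k n j x)(j := z)) j) \<partial>\<mu>) \<partial>?\<nu>)"
      by (rule is_cond_kernel_integral(1)[OF \<nu> that(2) product_cond_kernel(2)[OF \<mu> that(2)] gm[of i j] gb[of _ i j]])
    also have "\<dots> = 0" using that(1) g0 by simp
    finally show ?thesis .
  qed
  have sq: "(\<Sum>i<n. g (x i))\<^sup>2 = (\<Sum>i<n. \<Sum>j<n. g (x i) * g (x j))" for x
    by (simp add: power2_eq_square sum_product)
  show "integrable ?\<nu> (\<lambda>x. (\<Sum>i<n. g (x i))\<^sup>2)"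
    unfolding sq by (intro Bochner_Integration.integrable_sum int)
  have "(\<integral>x. (\<Sum>i<n. g (x i))\<^sup>2 \<partial>?\<nu>) = (\<Sum>i<n. \<Sum>j<n. \<integral>x. g (x i) * g (x j) \<partial>?\<nu>)"
    unfolding sq using int by (simp add: Bochner_Integration.integral_sum Bochner_Integration.integrable_sum)
  also have "\<dots> = (\<Sum>i<n. \<integral>x. g (x i) * g (x i) \<partial>?\<nu>)"
  proof (intro sum.cong refl)
    fix i assume i: "i \<in> {..<n}"
    have "(\<Sum>j<n. \<integral>x. g (x i) * g (x j) \<partial>?\<nu>) = (\<Sum>j<n. if j = i then \<integral>x. g (x i) * g (x i) \<partial>?\<nu> else 0)"
      using off by (intro sum.cong) auto
    then show "(\<Sum>j<n. \<integral>x. g (x i) * g (x j) \<partial>?\<nu>) = (\<integral>x. g (x i) * g (x i) \<partial>?\<nu>)"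
      using i by simp
  qed
  also have "\<dots> \<le> (\<Sum>i<n. B\<^sup>2)"
  proof (intro sum_mono)
    fix i
    have "(\<integral>x. g (x i) * g (x i) \<partial>?\<nu>) \<le> (\<integral>x. B\<^sup>2 \<partial>?\<nu>)"
      by (intro integral_mono int order_trans[OF abs_ge_self gb]) simp
    then show "(\<integral>x. g (x i) * g (x i) \<partial>?\<nu>) \<le> B\<^sup>2" by (simp add: prob_space)
  qed
  finally show "(\<integral>x. (\<Sum>i<n. g (x i))\<^sup>2 \<partial>?\<nu>) \<le> real n * B\<^sup>2" by simp
qed

section \<open>Concentration under product measures\<close>

text \<open>A Chebyshev estimate in pointwise form: outside the neighbourhood of
  \<open>\<mu>\<close> the squared deviations of the observables, scaled by
  \<open>2 * b / \<delta>\<^sup>2\<close>, sum to at least \<open>2 * b\<close>, which covers the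
  whole oscillation of \<open>F\<close>. Integration then turns them into variances.\<close>

lemma rho_n_lower:
  fixes \<alpha> :: "'a::second_countable_topology measure \<Rightarrow> ereal"
  assumes F: "lsc_on weak_top F" and b: "\<And>\<mu>. \<mu> \<in> PE \<Longrightarrow> \<bar>F \<mu>\<bar> \<le> b"
    and \<mu>: "\<mu> \<in> PE" and a: "\<alpha> \<mu> = ereal a" and \<epsilon>: "0 < \<epsilon>"
  obtains Q where "\<And>n. 0 < n \<Longrightarrow>
    ereal (real n * (F \<mu> - a - \<epsilon>) - Q) \<le> rho_n \<alpha> n (\<lambda>x. real n * F (emp n x))"
proof -
  have "openin weak_top {\<nu> \<in> topspace weak_top. F \<nu> > F \<mu> - \<epsilon>}" using F by (simp add: lsc_on_def)
  moreover have "\<mu> \<in> {\<nu> \<in> topspace weak_top. F \<nu> > F \<mu> - \<epsilon>}" using \<mu> \<epsilon> by simp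
  ultimately obtain J \<delta> where J: "finite J" "J \<subseteq> Cb" and \<delta>: "0 < \<delta>"
    and nbhd: "\<And>\<nu>. \<nu> \<in> PE \<Longrightarrow> (\<And>f. f \<in> J \<Longrightarrow> \<bar>(\<integral>x. f x \<partial>\<nu>) - (\<integral>x. f x \<partial>\<mu>)\<bar> < \<delta>) \<Longrightarrow> \<nu> \<in> {\<nu> \<in> topspace weak_top. F \<nu> > F \<mu> - \<epsilon>}"
    by (rule weak_top_nbhd_base) blast
  obtain B where B: "0 < B" "\<And>f x. f \<in> J \<Longrightarrow> \<bar>f x\<bar> \<le> B" using finite_Cb_bounded[OF J] by blast
  interpret \<mu>: prob_space \<mu> using \<mu> by (simp add: PE_iff)
  define g where "g f y = f y - (\<integral>x. f x \<partial>\<mu>)" for f :: "'a \<Rightarrow> real" and y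
  have eB: "\<bar>\<integral>x. f x \<partial>\<mu>\<bar> \<le> B" if "f \<in> J" for f
    using that J B by (intro abs_integral_le_PE \<mu> Cb_measurable) auto
  have gB: "\<bar>g f y\<bar> \<le> 2 * B" if "f \<in> J" for f y
    using eB[OF that] B(2)[OF that, of y] unfolding g_def by linarith
  have gC: "g f \<in> Cb" if f: "f \<in> J" for f
    unfolding Cb_def bounded_iff using gB[OF f] f J(2)
    by (auto simp: g_def[abs_def] Cb_def intro!: continuous_intros exI[of _ "2 * B"])
  have g0: "(\<integral>y. g f y \<partial>\<mu>) = 0" if f: "f \<in> J" for f
    unfolding g_def using Cb_integrable[OF _ \<mu>, of f] f J(2) by (auto simp: \<mu>.prob_space subset_iff)
  have b0: "0 \<le> b" using b[OF \<mu>] by linarith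
  \<comment> \<open>The centred observables \<open>g f\<close> are bounded by \<open>2 * B\<close>,
    so \<open>Q / real n\<close> bounds the integral of the scaled squared deviations.\<close>
  define Q where "Q = (2 * b / \<delta>\<^sup>2) * (real (card J) * (2 * B)\<^sup>2)"
  show ?thesis
  proof (rule that[of Q])
    fix n :: nat assume n: "0 < n"
    let ?\<nu> = "PiM {..<n} (\<lambda>_. \<mu>)"
    note \<nu> = product_cond_kernel(1)[OF \<mu>, of n]
    have sets: "sets ?\<nu> = sets (En n)" using \<nu> by (simp add: space_prob_algebra)
    interpret prob_space ?\<nu> using \<nu> by (simp add: space_prob_algebra)
    have dev: "(\<integral>y. f y \<partial>emp n x) - (\<integral>y. f y \<partial>\<mu>) = (\<Sum>i<n. g f (x i)) / real n" if f: "f \<in> J" for f x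
      using n f J(2) by (subst integral_emp[OF n Cb_measurable]) (auto simp: g_def sum_subtractf field_simps)
    have pointwise: "F \<mu> - \<epsilon> - (2 * b / \<delta>\<^sup>2) * (\<Sum>f\<in>J. ((\<Sum>i<n. g f (x i)) / real n)\<^sup>2) \<le> F (emp n x)" for x
    proof (cases "\<forall>f\<in>J. \<bar>(\<integral>y. f y \<partial>emp n x) - (\<integral>y. f y \<partial>\<mu>)\<bar> < \<delta>")
      case True
      then have "F (emp n x) > F \<mu> - \<epsilon>" using nbhd[OF emp_PE[OF n, of x]] by auto
      moreover have "0 \<le> (2 * b / \<delta>\<^sup>2) * (\<Sum>f\<in>J. ((\<Sum>i<n. g f (x i)) / real n)\<^sup>2)"
        using b0 by (intro mult_nonneg_nonneg sum_nonneg) auto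
      ultimately show ?thesis by linarith
    next
      case False
      then obtain f where f: "f \<in> J" "\<delta> \<le> \<bar>(\<Sum>i<n. g f (x i)) / real n\<bar>" by (auto simp: not_less dev)
      have "\<delta>\<^sup>2 \<le> \<bar>(\<Sum>i<n. g f (x i)) / real n\<bar>\<^sup>2" using f(2) \<delta> by (intro power_mono) auto
      also have "\<dots> = ((\<Sum>i<n. g f (x i)) / real n)\<^sup>2" by (rule power2_abs)
      also have "\<dots> \<le> (\<Sum>f\<in>J. ((\<Sum>i<n. g f (x i)) / real n)\<^sup>2)" using f(1) J(1) by (intro member_le_sum) auto
      finally have "(2 * b / \<delta>\<^sup>2) * \<delta>\<^sup>2 \<le> (2 * b / \<delta>\<^sup>2) * (\<Sum>f\<in>J. ((\<Sum>i<n. g f (x i)) / real n)\<^sup>2)"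
        using b0 by (intro mult_left_mono) auto
      then have "2 * b \<le> (2 * b / \<delta>\<^sup>2) * (\<Sum>f\<in>J. ((\<Sum>i<n. g f (x i)) / real n)\<^sup>2)" using \<delta> by simp
      then show ?thesis using b[OF \<mu>] b[OF emp_PE[OF n, of x]] \<epsilon> by linarith
    qed
    have sq_int: "integrable ?\<nu> (\<lambda>x. ((\<Sum>i<n. g f (x i)) / real n)\<^sup>2)"
      and sq_le: "(\<integral>x. ((\<Sum>i<n. g f (x i)) / real n)\<^sup>2 \<partial>?\<nu>) \<le> (2 * B)\<^sup>2 / real n" if f: "f \<in> J" for f
    proof -
      note v = product_variance[OF \<mu> gC[OF f] gB[OF f] g0[OF f], of n]
      show "integrable ?\<nu> (\<lambda>x. ((\<Sum>i<n. g f (x i)) / real n)\<^sup>2)"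
        unfolding power_divide by (intro integrable_divide_zero impI v(2))
      have "(\<integral>x. ((\<Sum>i<n. g f (x i)) / real n)\<^sup>2 \<partial>?\<nu>) = (\<integral>x. (\<Sum>i<n. g f (x i))\<^sup>2 \<partial>?\<nu>) / (real n)\<^sup>2"
        unfolding power_divide by (rule integral_divide_zero)
      also have "\<dots> \<le> (real n * (2 * B)\<^sup>2) / (real n)\<^sup>2" by (intro divide_right_mono v(1)) auto
      also have "\<dots> = (2 * B)\<^sup>2 / real n" using n by (simp add: power2_eq_square)
      finally show "(\<integral>x. ((\<Sum>i<n. g f (x i)) / real n)\<^sup>2 \<partial>?\<nu>) \<le> (2 * B)\<^sup>2 / real n" .
    qed
    have F_int: "integrable ?\<nu> (\<lambda>x. F (emp n x))"
      using lsc_on_emp_measurable[OF F n] b[OF emp_PE[OF n]]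
      by (intro integrable_const_bound[of _ b]) (auto simp: sets cong: measurable_cong_sets)
    let ?S = "\<lambda>x. \<Sum>f\<in>J. ((\<Sum>i<n. g f (x i)) / real n)\<^sup>2"
    have S_int: "integrable ?\<nu> ?S" by (intro Bochner_Integration.integrable_sum sq_int)
    have "(\<integral>x. ?S x \<partial>?\<nu>) = (\<Sum>f\<in>J. \<integral>x. ((\<Sum>i<n. g f (x i)) / real n)\<^sup>2 \<partial>?\<nu>)"
      by (intro Bochner_Integration.integral_sum sq_int)
    also have "\<dots> \<le> (\<Sum>f\<in>J. (2 * B)\<^sup>2 / real n)" by (intro sum_mono sq_le)
    finally have "(\<integral>x. ?S x \<partial>?\<nu>) \<le> real (card J) * (2 * B)\<^sup>2 / real n" by simp
    then have "(2 * b / \<delta>\<^sup>2) * (\<integral>x. ?S x \<partial>?\<nu>) \<le> (2 * b / \<delta>\<^sup>2) * (real (card J) * (2 * B)\<^sup>2 / real n)"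
      using b0 by (intro mult_left_mono) auto
    also have "\<dots> = Q / real n" by (simp add: Q_def)
    finally have "F \<mu> - \<epsilon> - Q / real n \<le> F \<mu> - \<epsilon> - (2 * b / \<delta>\<^sup>2) * (\<integral>x. ?S x \<partial>?\<nu>)" by simp
    also have "\<dots> = (\<integral>x. F \<mu> - \<epsilon> - (2 * b / \<delta>\<^sup>2) * ?S x \<partial>?\<nu>)"
      using S_int by (simp add: prob_space)
    also have "\<dots> \<le> (\<integral>x. F (emp n x) \<partial>?\<nu>)"
      using S_int pointwise by (intro integral_mono F_int Bochner_Integration.integrable_diff integrable_mult_right) auto
    finally have "real n * (F \<mu> - \<epsilon> - Q / real n) \<le> real n * (\<integral>x. F (emp n x) \<partial>?\<nu>)"
      by (intro mult_left_mono) auto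
    then have "real n * (F \<mu> - a - \<epsilon>) - Q \<le> (\<integral>x. real n * F (emp n x) \<partial>?\<nu>) - real n * a"
      using n by (simp add: algebra_simps)
    then have "ereal (real n * (F \<mu> - a - \<epsilon>) - Q) \<le> ereal (\<integral>x. real n * F (emp n x) \<partial>?\<nu>) - alpha_n \<alpha> n ?\<nu>"
      by (simp add: alpha_n_product[of \<mu> \<alpha> a, OF \<mu> a])
    also have "\<dots> \<le> rho_n \<alpha> n (\<lambda>x. real n * F (emp n x))"
      unfolding rho_n_def by (rule SUP_upper[OF \<nu>])
    finally show "ereal (real n * (F \<mu> - a - \<epsilon>) - Q) \<le> rho_n \<alpha> n (\<lambda>x. real n * F (emp n x))" .
  qed
qed

section \<open>Passage to the limit\<close>

text \<open>Absorbs the constants of the two bounds. \<open>0 < n\<close> is carried along because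
  both bounds start at \<open>n = 1\<close>; \<open>emp 0\<close> is the zero measure.\<close>

lemma eventually_le_mult_real:
  fixes Q \<epsilon> :: real assumes "0 < \<epsilon>"
  shows "\<forall>\<^sub>F n in sequentially. 0 < n \<and> Q \<le> \<epsilon> * real n"
proof -
  have "\<forall>\<^sub>F n in sequentially. Q / real n < \<epsilon>"
    using order_tendstoD(2)[OF lim_const_over_n assms] .
  with eventually_gt_at_top[of "0::nat"] show ?thesis
  proof eventually_elim
    case (elim n)
    then have "0 < real n" by simp
    then show ?case using elim by (simp add: pos_divide_less_eq)
  qed
qed

theorem mainTheorem4:
  fixes \<alpha> :: "'a::polish_space measure \<Rightarrow> ereal"
  assumes meas: "\<alpha> \<in> borel_measurable weak_borel"
    and bdd_below: "\<exists>c::real. \<forall>\<mu>\<in>PE. ereal c \<le> \<alpha> \<mu>"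
    and not_infty: "\<exists>\<mu>\<in>PE. \<alpha> \<mu> \<noteq> \<infinity>"
  shows "(\<forall>F :: 'a measure \<Rightarrow> real. bounded (F ` PE) \<and> lsc_on weak_top F \<longrightarrow>
           liminf (\<lambda>n. ereal (1 / real n) * rho_n \<alpha> n (\<lambda>x. real n * F (emp n x)))
             \<ge> (SUP \<nu>\<in>PE. ereal (F \<nu>) - \<alpha> \<nu>)) \<and>
         (((\<forall>\<mu>\<in>PE. \<forall>\<nu>\<in>PE. \<forall>t\<in>{0..1}.
              \<alpha> (mix t \<mu> \<nu>) \<le> ereal t * \<alpha> \<mu> + ereal (1 - t) * \<alpha> \<nu>) \<and>
           (\<forall>c::real. compactin weak_top {\<mu> \<in> PE. \<alpha> \<mu> \<le> ereal c})) \<longrightarrow>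
          (\<forall>F :: 'a measure \<Rightarrow> real. bounded (F ` PE) \<and> usc_on weak_top F \<longrightarrow>
             limsup (\<lambda>n. ereal (1 / real n) * rho_n \<alpha> n (\<lambda>x. real n * F (emp n x)))
               \<le> (SUP \<nu>\<in>PE. ereal (F \<nu>) - \<alpha> \<nu>)))"
proof (intro conjI allI impI; elim conjE)
  obtain c :: real where c: "\<And>\<mu>. \<mu> \<in> PE \<Longrightarrow> ereal c \<le> \<alpha> \<mu>" using bdd_below by blast
  {
    fix F :: "'a measure \<Rightarrow> real" assume bF: "bounded (F ` PE)" and F: "lsc_on weak_top F"
    let ?\<rho> = "\<lambda>n. rho_n \<alpha> n (\<lambda>x. real n * F (emp n x))"
    obtain b where b: "\<And>\<mu>. \<mu> \<in> PE \<Longrightarrow> \<bar>F \<mu>\<bar> \<le> b" using bF by (auto simp: bounded_iff)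
    show "(SUP \<nu>\<in>PE. ereal (F \<nu>) - \<alpha> \<nu>) \<le> liminf (\<lambda>n. ereal (1 / real n) * ?\<rho> n)"
    proof (rule SUP_least)
      fix \<mu> :: "'a measure" assume \<mu>: "\<mu> \<in> PE"
      show "ereal (F \<mu>) - \<alpha> \<mu> \<le> liminf (\<lambda>n. ereal (1 / real n) * ?\<rho> n)"
      proof (cases "\<alpha> \<mu>")
        case (real a)
        \<comment> \<open>One \<open>\<epsilon>\<close> is lost to semicontinuity of
          \<open>F\<close>, the other absorbs \<open>Q / real n\<close>.\<close>
        have "ereal (F \<mu> - a - 2 * \<epsilon>) \<le> liminf (\<lambda>n. ereal (1 / real n) * ?\<rho> n)" if \<epsilon>: "0 < \<epsilon>" for \<epsilon>
        proof -
          obtain Q where Q: "\<And>n. 0 < n \<Longrightarrow> ereal (real n * (F \<mu> - a - \<epsilon>) - Q) \<le> ?\<rho> n"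
            using rho_n_lower[where \<alpha>=\<alpha>, OF F b \<mu> real \<epsilon>] by blast
          show ?thesis
          proof (rule Liminf_bounded)
            from eventually_le_mult_real[OF \<epsilon>, of Q]
            show "\<forall>\<^sub>F n in sequentially. ereal (F \<mu> - a - 2 * \<epsilon>) \<le> ereal (1 / real n) * ?\<rho> n"
            proof eventually_elim
              case (elim n)
              then have "ereal (F \<mu> - a - 2 * \<epsilon>) \<le> ereal (1 / real n) * ereal (real n * (F \<mu> - a - \<epsilon>) - Q)"
                using elim by (simp add: field_simps)
              also have "\<dots> \<le> ereal (1 / real n) * ?\<rho> n"
                using Q elim by (intro ereal_mult_left_mono) auto
              finally show ?case .
            qed
          qed
        qed
        note le = this
        have "ereal (F \<mu> - a) \<le> liminf (\<lambda>n. ereal (1 / real n) * ?\<rho> n)"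
        proof (rule ereal_le_epsilon2)
          fix e :: real assume "0 < e"
          then have "ereal (F \<mu> - a - e) \<le> liminf (\<lambda>n. ereal (1 / real n) * ?\<rho> n)" using le[of "e / 2"] by simp
          from add_right_mono[OF this, of "ereal e"]
          show "ereal (F \<mu> - a) \<le> liminf (\<lambda>n. ereal (1 / real n) * ?\<rho> n) + ereal e" by simp
        qed
        then show ?thesis by (simp add: real)
      \<comment> \<open>For infinite \<open>\<alpha> \<mu>\<close> the left-hand side is minus
        infinity; the lower bound \<open>c\<close> excludes the value minus infinity of
        \<open>\<alpha>\<close>.\<close>
      qed (use c[OF \<mu>] in auto)
    qed
  next
    fix F :: "'a measure \<Rightarrow> real" assume bF: "bounded (F ` PE)" and F: "usc_on weak_top F"
      and convex: "\<forall>\<mu>\<in>PE. \<forall>\<nu>\<in>PE. \<forall>t\<in>{0..1}. \<alpha> (mix t \<mu> \<nu>) \<le> ereal t * \<alpha> \<mu> + ereal (1 - t) * \<alpha> \<nu>"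
      and compact: "\<forall>c::real. compactin weak_top {\<mu> \<in> PE. \<alpha> \<mu> \<le> ereal c}"
    let ?\<rho> = "\<lambda>n. rho_n \<alpha> n (\<lambda>x. real n * F (emp n x))"
    interpret convex_rate \<alpha> c
      using c not_infty convex compact by unfold_locales auto
    obtain b where b: "\<And>\<mu>. \<mu> \<in> PE \<Longrightarrow> \<bar>F \<mu>\<bar> \<le> b" using bF by (auto simp: bounded_iff)
    \<comment> \<open>The supremum is shown to be a real number before \<open>rho_n_upper\<close> is
      applied: boundedness of \<open>F\<close> and the bound \<open>c\<close> limit it from above, a
      point of finite \<open>\<alpha>\<close> from below.\<close>
    define S where "S = (SUP \<nu>\<in>PE. ereal (F \<nu>) - \<alpha> \<nu>)"
    have "S \<le> ereal (b - c)"
      unfolding S_def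
    proof (rule SUP_least)
      fix \<nu> :: "'a measure" assume \<nu>: "\<nu> \<in> PE"
      have "ereal (F \<nu>) - \<alpha> \<nu> \<le> ereal b - ereal c"
        using b[OF \<nu>] c[OF \<nu>] by (intro ereal_minus_mono) auto
      then show "ereal (F \<nu>) - \<alpha> \<nu> \<le> ereal (b - c)" by simp
    qed
    moreover have "S > - \<infinity>"
    proof -
      obtain \<mu> where \<mu>: "\<mu> \<in> PE" "\<alpha> \<mu> \<noteq> \<infinity>" using not_infty by blast
      have "- \<infinity> < ereal (F \<mu>) - \<alpha> \<mu>" using \<mu> c[OF \<mu>(1)] by (cases "\<alpha> \<mu>") auto
      also have "\<dots> \<le> S" unfolding S_def by (rule SUP_upper[OF \<mu>(1)])
      finally show ?thesis .
    qed
    ultimately obtain s where s: "S = ereal s" by (cases S) auto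
    have sup: "ereal (F \<mu>) - \<alpha> \<mu> \<le> ereal s" if "\<mu> \<in> PE" for \<mu>
      unfolding s[symmetric] S_def by (rule SUP_upper[OF that])
    \<comment> \<open>Two \<open>\<epsilon>\<close> come from \<open>rho_n_upper\<close>, the third
      absorbs \<open>Q / real n\<close>.\<close>
    have "limsup (\<lambda>n. ereal (1 / real n) * ?\<rho> n) \<le> ereal (s + 3 * \<epsilon>)" if \<epsilon>: "0 < \<epsilon>" for \<epsilon>
    proof -
      obtain Q where Q: "\<And>n. 0 < n \<Longrightarrow> ?\<rho> n \<le> ereal (real n * (s + 2 * \<epsilon>) + Q)"
        using rho_n_upper[OF F b sup \<epsilon>] by blast
      show ?thesis
      proof (rule Limsup_bounded)
        from eventually_le_mult_real[OF \<epsilon>, of Q]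
        show "\<forall>\<^sub>F n in sequentially. ereal (1 / real n) * ?\<rho> n \<le> ereal (s + 3 * \<epsilon>)"
        proof eventually_elim
          case (elim n)
          then have "ereal (1 / real n) * ?\<rho> n \<le> ereal (1 / real n) * ereal (real n * (s + 2 * \<epsilon>) + Q)"
            using Q by (intro ereal_mult_left_mono) auto
          also have "\<dots> \<le> ereal (s + 3 * \<epsilon>)"
            using elim by (simp add: field_simps)
          finally show ?case .
        qed
      qed
    qed
    note le = this
    have "limsup (\<lambda>n. ereal (1 / real n) * ?\<rho> n) \<le> S"
    proof (rule ereal_le_epsilon2)
      fix e :: real assume "0 < e"
      then show "limsup (\<lambda>n. ereal (1 / real n) * ?\<rho> n) \<le> S + ereal e" using le[of "e / 3"] by (simp add: s)
    qed
    then show "limsup (\<lambda>n. ereal (1 / real n) * ?\<rho> n) \<le> (SUP \<nu>\<in>PE. ereal (F \<nu>) - \<alpha> \<nu>)" by (simp add: S_def)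
  }
qed

end
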